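(* Let $f=\sum_{s\ge0}a_s\phi_r^s$ be a non-zero element of $K[x]_{\mu\text{-att}}$ ($\deg a_s<m_r$), let $R_r(f)=c_0+c_1y+\cdots+c_dy^d\in\kappa_r[y]$, and for each $j$ with $c_j\neq0$ put $s_j=s_r(f)+je_r$. Then, for each such $j$: if $r=0$, $a_{s_j}\in K^*$, $v(a_{s_j})\in\Gamma_{-1}$ and $c_j$ is the residue class in $k=\kappa_0$ of $a_{s_j}/\pi_0^{v(a_{s_j})}$; if $r>0$, $a_{s_j}\in K[x]_{\mu_{r-1}\text{-att}}$ and $$c_j=\epsilon_{r-1}(a_{s_j})\,R_{r-1}(a_{s_j})(z_{r-1}).$$
   Context: Let $(K,v)$ be a valued field with non-trivial value group $\Gamma$, residue field $k$, $\Gamma_{\mathbb Q}=\Gamma\otimes\mathbb Q$. For a valuation $\mu$ on $K[x]$: graded algebra $\mathcal G_\mu=\bigoplus_\alpha\{\mu\ge\alpha\}/\{\mu>\alpha\}$, degree-zero part $\Delta_\mu$, initial form $H_\mu$ (multiplicative, extended to quotients); $h\mid_\mu g$ iff $H_\mu(h)\mid H_\mu(g)$. Key polynomial: monic $\phi$ with $H_\mu(\phi)\mathcal G_\mu$ non-zero prime and $\phi\nmid_\mu f$ for non-zero $f$ of smaller degree; $[\mu;\phi,\gamma](\sum a_s\phi^s)=\min(\mu(a_s)+s\gamma)$ for $\gamma>\mu(\phi)$; canonical map $\mathcal G_\mu\to\mathcal G_{\mu'}$ ($\mu\le\mu'$ in a chain): $H_\mu(f)\mapsto H_{\mu'}(f)$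 if $\mu(f)=\mu'(f)$, else $0$. MacLane chain $\mu_{-\infty}\xrightarrow{\phi_0,\gamma_0}\mu_0\to\cdots\xrightarrow{\phi_r,\gamma_r}\mu_r=\mu$: $\gamma_i\in\Gamma_{\mathbb Q}$, $\phi_0=x+a$, $\mu_0(\sum a_s\phi_0^s)=\min(v(a_s)+s\gamma_0)$, $\phi_i$ key polynomial for $\mu_{i-1}$, $\mu_i=[\mu_{i-1};\phi_i,\gamma_i]$, $\phi_{i+1}\nmid_{\mu_i}\phi_i$. $\mu_{-1}=v$, $\Gamma_{\mu_{-1}}=\Gamma$, $m_i=\deg\phi_i$, $e_i=(\Gamma_{\mu_i}:\Gamma_{\mu_{i-1}})$, $h_i=e_i\gamma_i$. $\kappa_0$ = image of $k$ in $\Delta_{\mu_0}$ (identified with $k$), $\kappa_i$ = image of $\Delta_{\mu_{i-1}}\to\Delta_{\mu_i}$; $k=\kappa_0\subset\cdots\subset\kappa_r$. Fix a finitely generated $\Gamma_{-1}\subseteq\Gamma$ with $h_i\in\Gamma_{-1}+\langle\gamma_0,\dots,\gamma_{i-1}\rangle$; $\Gamma_i=\langle\Gamma_{-1},\gamma_0,\dots,\gamma_i\rangle$. Bases: $\iota_{0,1},\dots,\iota_{0,n}$ of $\Gamma_{-1}$; recursively $\gamma_i=\sum_j(h_{i,j}/e_{i,j})\iota_{i,j}$ (coprime, $e_{i,j}>0$), $e'_{i,1}=d_{i,1}=1$, $e'_{i,j}=\prod_{t<j}e_{i,t}/\prod_{t<j}d_{i,t}$, $d_{i,j}=\gcd(e_{i,j},e'_{i,j})$,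 integers $\ell_{i,j}h_{i,j}e'_{i,j}+\ell'_{i,j}e_{i,j}=d_{i,j}$, $0\le\ell_{i,j}<e_{i,j}/d_{i,j}$, $(\iota_{i+1,\cdot})=(\iota_{i,\cdot})Q_i$, $Q_i$ lower triangular with diagonal $d_{i,j}/e_{i,j}$, $(m,j)$-entry $\ell_{i,j}e'_{i,j}h_{i,m}/e_{i,m}$. $\pi_{0,j}\in K^*$, $v(\pi_{0,j})=\iota_{0,j}$; $\pi_{i+1,j}=(\phi_i\pi_{i,1}^{-h_{i,1}/e_{i,1}}\cdots\pi_{i,j-1}^{-h_{i,j-1}/e_{i,j-1}})^{\ell_{i,j}e'_{i,j}}\pi_{i,j}^{\ell'_{i,j}}$; $\pi_i^\alpha=\prod_j\pi_{i,j}^{n_j}$ for $\alpha=\sum n_j\iota_{i,j}\in\Gamma_{i-1}$; $Y_i=\phi_i^{e_i}\pi_i^{-h_i}$; $p_i^\alpha=H_{\mu_i}(\pi_i^\alpha)$, $y_i=H_{\mu_i}(Y_i)$; $z_i\in\kappa_{i+1}^*$ the image of $y_i$ in $\mathcal G_{\mu_{i+1}}$ (and further in $\mathcal G_{\mu}$). $L'_i=\ell'_{i,1}\cdots\ell'_{i,n}$, $L_{i,j}=\ell_{i,j}\ell'_{i,j+1}\cdots\ell'_{i,n}$, $L_i$ the $\mathbb Q$-linear map on $\Gamma_{i-1}\otimes\mathbb Q$ with $L_i(\iota_{i,j})=L_{i,j}$. For $0\le i\le r$: for non-zero $g=\sum_sb_s\phi_i^s$ ($\deg b_s<m_i$), $N_i(g)$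 is the lower convex hull in $\mathbb Q\times\Gamma_{\mathbb Q}$ of $Q_s=(s,\mu_{i-1}(b_s))$, $b_s\ne0$; $S_{\gamma_i}(g)$ = its points minimizing $u+s\gamma_i$, left endpoint $(s_i(g),u_i(g))$, right endpoint abscissa $s'_i(g)$. $K[x]_{\mu_i\text{-att}}=\{0\}\cup\{g\ne0:\mu_i(g)\in\Gamma_i\}$; for non-zero $g$ in it, with $d=(s'_i(g)-s_i(g))/e_i$, $t_j=s_i(g)+je_i$: $R_i(g)=\sum_{j=0}^dc_jy^j\in\kappa_i[y]$, $c_j=p_i^{-\mu_{i-1}(b_{t_j})}H_{\mu_i}(b_{t_j})$ if $Q_{t_j}$ lies on $N_i(g)$, else $0$. For $0\le i<r$ and non-zero $a\in K[x]_{\mu_i\text{-att}}$, define $\epsilon_i(a)=z_i^{\,L'_i s_i(a)-L_i(u_i(a))}\in\kappa_{i+1}^*$. *)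

theory Defs
  imports "HOL-Computational_Algebra.Polynomial" "HOL-Computational_Algebra.Fraction_Field"
begin

definition gmul :: "int \<Rightarrow> 'g::ab_group_add \<Rightarrow> 'g" where
  "gmul k x = (if 0 \<le> k then sum (\<lambda>_. x) {..<nat k} else - sum (\<lambda>_. x) {..<nat (- k)})"

definition divisible_group :: "'g::ab_group_add itself \<Rightarrow> bool" where
  "divisible_group _ \<longleftrightarrow> (\<forall>x::'g. \<forall>k>0. \<exists>y. gmul k y = x)"

text \<open>rational multiple q x in the divisible (torsion-free) group: the unique y with den*y = num*x\<close>
definition qmul :: "rat \<Rightarrow> 'g::ab_group_add \<Rightarrow> 'g" where
  "qmul q x = (THE y. gmul (snd (quotient_of q)) y = gmul (fst (quotient_of q)) x)"

definition is_valuation :: "('k::field \<Rightarrow> 'g::linordered_ab_group_add) \<Rightarrow> bool" where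
  "is_valuation v \<longleftrightarrow>
     (\<forall>a b. a \<noteq> 0 \<longrightarrow> b \<noteq> 0 \<longrightarrow> v (a * b) = v a + v b) \<and>
     (\<forall>a b. a \<noteq> 0 \<longrightarrow> b \<noteq> 0 \<longrightarrow> a + b \<noteq> 0 \<longrightarrow> min (v a) (v b) \<le> v (a + b))"

definition value_group :: "('k::field \<Rightarrow> 'g) \<Rightarrow> 'g set" where
  "value_group v = {v a | a. a \<noteq> 0}"

text \<open>Gamma_Q inside the divisible ambient group\<close>
definition rat_hull :: "'g::ab_group_add set \<Rightarrow> 'g set" where
  "rat_hull G = {x. \<exists>k>0. gmul k x \<in> G}"

definition gindex :: "'g::ab_group_add set \<Rightarrow> 'g set \<Rightarrow> nat" where
  "gindex A B = card ((\<lambda>x. (\<lambda>b. x + b) ` B) ` A)"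

text \<open>s-th coefficient a_s of the phi-expansion f = sum a_s phi^s, deg a_s < deg phi\<close>
definition expc :: "'k::field poly \<Rightarrow> 'k poly \<Rightarrow> nat \<Rightarrow> 'k poly" where
  "expc \<phi> f s = (f div \<phi> ^ s) mod \<phi>"

text \<open>valuations on K[x] are functions meaningful on non-zero polynomials\<close>
definition aug :: "('k::field poly \<Rightarrow> 'g::linordered_ab_group_add) \<Rightarrow> 'k poly \<Rightarrow> 'g \<Rightarrow> 'k poly \<Rightarrow> 'g" where
  "aug \<mu> \<phi> \<gamma> f = Min {\<mu> (expc \<phi> f s) + gmul (int s) \<gamma> | s. s \<le> degree f \<and> expc \<phi> f s \<noteq> 0}"

text \<open>h mu-divides g: H(h) divides H(g) in G_mu\<close>
definition mdvd :: "('k::field poly \<Rightarrow> 'g::linordered_ab_group_add) \<Rightarrow> 'k poly \<Rightarrow> 'k poly \<Rightarrow> bool" where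
  "mdvd \<mu> h g \<longleftrightarrow> g = 0 \<or> (\<exists>q. g - h * q = 0 \<or> \<mu> g < \<mu> (g - h * q))"

text \<open>key polynomial: monic, H(phi) generates a non-zero prime (homogeneous) ideal, mu-minimal\<close>
definition keypoly :: "('k::field poly \<Rightarrow> 'g::linordered_ab_group_add) \<Rightarrow> 'k poly \<Rightarrow> bool" where
  "keypoly \<mu> \<phi> \<longleftrightarrow> lead_coeff \<phi> = 1 \<and> \<not> mdvd \<mu> \<phi> 1 \<and>
     (\<forall>f g. f \<noteq> 0 \<longrightarrow> g \<noteq> 0 \<longrightarrow> mdvd \<mu> \<phi> (f * g) \<longrightarrow> mdvd \<mu> \<phi> f \<or> mdvd \<mu> \<phi> g) \<and>
     (\<forall>f. f \<noteq> 0 \<longrightarrow> degree f < degree \<phi> \<longrightarrow> \<not> mdvd \<mu> \<phi> f)"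

definition vgrp :: "('k::field poly \<Rightarrow> 'g::ab_group_add) \<Rightarrow> 'g set" where
  "vgrp \<mu> = {\<mu> f - \<mu> g | f g. f \<noteq> 0 \<and> g \<noteq> 0}"

definition muF :: "('k::field poly \<Rightarrow> 'g::ab_group_add) \<Rightarrow> 'k poly fract \<Rightarrow> 'g" where
  "muF \<mu> q = (THE w. \<exists>a b. a \<noteq> 0 \<and> b \<noteq> 0 \<and> q = Fract a b \<and> w = \<mu> a - \<mu> b)"

text \<open>residue class of q (with mu(q) >= 0): Delta_mu is identified with its image in the
  residue field {mu >= 0}/{mu > 0} of (K(x), mu)\<close>
definition cls :: "('k::field poly \<Rightarrow> 'g::linordered_ab_group_add) \<Rightarrow> 'k poly fract \<Rightarrow> 'k poly fract set" where
  "cls \<mu> q = {q'. q' = q \<or> (q' \<noteq> q \<and> 0 < muF \<mu> (q' - q))}"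

definition crep :: "'k poly fract set \<Rightarrow> 'k::field poly fract" where
  "crep A = (SOME q. q \<in> A)"

definition cmul :: "('k::field poly \<Rightarrow> 'g::linordered_ab_group_add) \<Rightarrow> 'k poly fract set \<Rightarrow> 'k poly fract set \<Rightarrow> 'k poly fract set" where
  "cmul \<mu> A B = cls \<mu> (crep A * crep B)"

definition cpowi :: "('k::field poly \<Rightarrow> 'g::linordered_ab_group_add) \<Rightarrow> 'k poly fract set \<Rightarrow> int \<Rightarrow> 'k poly fract set" where
  "cpowi \<mu> A k = cls \<mu> (crep A powi k)"

text \<open>canonical map Delta_mu -> Delta_mu': H_mu(f) |-> H_mu'(f) if mu f = mu' f, else 0\<close>
definition canon :: "('k::field poly \<Rightarrow> 'g::linordered_ab_group_add) \<Rightarrow> ('k poly \<Rightarrow> 'g) \<Rightarrow> 'k poly fract set \<Rightarrow> 'k poly fract set" where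
  "canon \<mu> \<mu>' A = (let P = (\<lambda>f. f \<noteq> 0 \<and> \<mu> f = 0 \<and> \<mu>' f = 0 \<and> A = cls \<mu> (Fract f 1)) in
     if \<exists>f. P f then cls \<mu>' (Fract (SOME f. P f) 1) else cls \<mu>' 0)"

record ('k, 'g) mlc =
  vK  :: "'k \<Rightarrow> 'g"
  ph  :: "nat \<Rightarrow> 'k list"    \<comment> \<open>coefficient lists of phi_0, ..., phi_r\<close>
  gm  :: "nat \<Rightarrow> 'g"
  rk  :: nat                   \<comment> \<open>n = rank of Gamma_{-1}\<close>
  io0 :: "nat \<Rightarrow> 'g"         \<comment> \<open>basis iota_{0,1..n} of Gamma_{-1}\<close>
  pk0 :: "nat \<Rightarrow> 'k"
  G1  :: "'g set"

definition phi :: "('k::field, 'g) mlc \<Rightarrow> nat \<Rightarrow> 'k poly" where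
  "phi C i = Poly (ph C i)"

fun mu :: "('k::field, 'g::linordered_ab_group_add) mlc \<Rightarrow> nat \<Rightarrow> 'k poly \<Rightarrow> 'g" where
  "mu C 0 = aug (\<lambda>b. vK C (coeff b 0)) (phi C 0) (gm C 0)"
| "mu C (Suc i) = aug (mu C i) (phi C (Suc i)) (gm C (Suc i))"

definition muprev :: "('k::field, 'g::linordered_ab_group_add) mlc \<Rightarrow> nat \<Rightarrow> 'k poly \<Rightarrow> 'g" where
  "muprev C i = (if i = 0 then (\<lambda>b. vK C (coeff b 0)) else mu C (i - 1))"

definition Gprev :: "('k::field, 'g::linordered_ab_group_add) mlc \<Rightarrow> nat \<Rightarrow> 'g set" where
  "Gprev C i = (if i = 0 then value_group (vK C) else vgrp (mu C (i - 1)))"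

definition ee :: "('k::field, 'g::linordered_ab_group_add) mlc \<Rightarrow> nat \<Rightarrow> int" where
  "ee C i = int (gindex (vgrp (mu C i)) (Gprev C i))"

definition hh :: "('k::field, 'g::linordered_ab_group_add) mlc \<Rightarrow> nat \<Rightarrow> 'g" where
  "hh C i = gmul (ee C i) (gm C i)"

text \<open>Gup C m = Gamma_{m-1} = < Gamma_{-1}, gamma_0, ..., gamma_{m-1} >\<close>
definition Gup :: "('k::field, 'g::linordered_ab_group_add) mlc \<Rightarrow> nat \<Rightarrow> 'g set" where
  "Gup C m = {g + (\<Sum>t<m. gmul (c t) (gm C t)) | g c. g \<in> G1 C}"

definition maclane_chain :: "('k::field, 'g::linordered_ab_group_add) mlc \<Rightarrow> nat \<Rightarrow> bool" where
  "maclane_chain C r \<longleftrightarrow>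
     is_valuation (vK C) \<and> value_group (vK C) \<noteq> {0} \<and>
     (\<forall>i\<le>r. gm C i \<in> rat_hull (value_group (vK C))) \<and>
     (\<exists>a. phi C 0 = [:a, 1:]) \<and>
     (\<forall>i. 1 \<le> i \<and> i \<le> r \<longrightarrow> keypoly (mu C (i - 1)) (phi C i) \<and> mu C (i - 1) (phi C i) < gm C i) \<and>
     (\<forall>i<r. \<not> mdvd (mu C i) (phi C (Suc i)) (phi C i))"

definition coordq :: "(nat \<Rightarrow> 'g::ab_group_add) \<Rightarrow> nat \<Rightarrow> 'g \<Rightarrow> nat \<Rightarrow> rat" where
  "coordq B n x = (THE c. x = (\<Sum>j=1..n. qmul (c j) (B j)) \<and> (\<forall>j. j \<notin> {1..n} \<longrightarrow> c j = 0))"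

definition basis_data :: "('k::field, 'g::linordered_ab_group_add) mlc \<Rightarrow> nat \<Rightarrow> bool" where
  "basis_data C r \<longleftrightarrow>
     G1 C \<subseteq> value_group (vK C) \<and>
     G1 C = {\<Sum>j=1..rk C. gmul (c j) (io0 C j) | c. True} \<and>
     (\<forall>c. (\<Sum>j=1..rk C. gmul (c j) (io0 C j)) = 0 \<longrightarrow> (\<forall>j\<in>{1..rk C}. c j = 0)) \<and>
     (\<forall>j\<in>{1..rk C}. pk0 C j \<noteq> 0 \<and> vK C (pk0 C j) = io0 C j) \<and>
     (\<forall>i\<le>r. hh C i \<in> Gup C i)"

definition hB :: "(nat \<Rightarrow> 'g::ab_group_add) \<Rightarrow> nat \<Rightarrow> 'g \<Rightarrow> nat \<Rightarrow> int" where
  "hB B n g j = fst (quotient_of (coordq B n g j))"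
definition eB :: "(nat \<Rightarrow> 'g::ab_group_add) \<Rightarrow> nat \<Rightarrow> 'g \<Rightarrow> nat \<Rightarrow> int" where
  "eB B n g j = snd (quotient_of (coordq B n g j))"

text \<open>Dp E j = d_1 * ... * d_{j-1}\<close>
fun Dp :: "(nat \<Rightarrow> int) \<Rightarrow> nat \<Rightarrow> int" where
  "Dp E 0 = 1"
| "Dp E (Suc k) = Dp E k * (if k = 0 then 1 else gcd (E k) ((\<Prod>t\<in>{1..<k}. E t) div Dp E k))"

definition epr :: "(nat \<Rightarrow> int) \<Rightarrow> nat \<Rightarrow> int" where
  "epr E j = (\<Prod>t\<in>{1..<j}. E t) div Dp E j"
definition dd :: "(nat \<Rightarrow> int) \<Rightarrow> nat \<Rightarrow> int" where
  "dd E j = gcd (E j) (epr E j)"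
definition ell :: "(nat \<Rightarrow> int) \<Rightarrow> (nat \<Rightarrow> int) \<Rightarrow> nat \<Rightarrow> int" where
  "ell H E j = (THE l. 0 \<le> l \<and> l < E j div dd E j \<and> E j dvd (dd E j - l * H j * epr E j))"
definition ell' :: "(nat \<Rightarrow> int) \<Rightarrow> (nat \<Rightarrow> int) \<Rightarrow> nat \<Rightarrow> int" where
  "ell' H E j = (dd E j - ell H E j * H j * epr E j) div E j"

fun io :: "('k::field, 'g::linordered_ab_group_add) mlc \<Rightarrow> nat \<Rightarrow> nat \<Rightarrow> 'g" where
  "io C 0 = io0 C"
| "io C (Suc i) = (let B = io C i; n = rk C; H = hB B n (gm C i); E = eB B n (gm C i) in
     (\<lambda>j. qmul (of_int (dd E j) / of_int (E j)) (B j) +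
          (\<Sum>m\<in>{j<..n}. qmul (of_int (ell H E j * epr E j * H m) / of_int (E m)) (B m))))"

definition hI where "hI C i = hB (io C i) (rk C) (gm C i)"
definition eI where "eI C i = eB (io C i) (rk C) (gm C i)"
definition lI where "lI C i = ell (hI C i) (eI C i)"
definition l'I where "l'I C i = ell' (hI C i) (eI C i)"

fun pii :: "('k::field, 'g::linordered_ab_group_add) mlc \<Rightarrow> nat \<Rightarrow> nat \<Rightarrow> 'k poly fract" where
  "pii C 0 = (\<lambda>j. Fract [:pk0 C j:] 1)"
| "pii C (Suc i) = (\<lambda>j. let H = hI C i; E = eI C i; le = lI C i j * epr E j in
     Fract (phi C i) 1 powi le *
     (\<Prod>t\<in>{1..<j}. pii C i t powi ((- (le * H t)) div E t)) *
     pii C i j powi l'I C i j)"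

text \<open>pi_i^alpha for alpha in Gamma_{i-1}\<close>
definition pipow :: "('k::field, 'g::linordered_ab_group_add) mlc \<Rightarrow> nat \<Rightarrow> 'g \<Rightarrow> 'k poly fract" where
  "pipow C i \<alpha> = (\<Prod>j\<in>{1..rk C}. pii C i j powi \<lfloor>coordq (io C i) (rk C) \<alpha> j\<rfloor>)"

definition piK :: "('k::field, 'g::linordered_ab_group_add) mlc \<Rightarrow> 'g \<Rightarrow> 'k" where
  "piK C \<alpha> = (\<Prod>j\<in>{1..rk C}. pk0 C j powi \<lfloor>coordq (io0 C) (rk C) \<alpha> j\<rfloor>)"

definition YY :: "('k::field, 'g::linordered_ab_group_add) mlc \<Rightarrow> nat \<Rightarrow> 'k poly fract" where
  "YY C i = Fract (phi C i) 1 ^ nat (ee C i) * pipow C i (- hh C i)"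

text \<open>z_i in kappa_{i+1}: image of y_i = H_{mu_i}(Y_i) in G_{mu_{i+1}}\<close>
definition zz :: "('k::field, 'g::linordered_ab_group_add) mlc \<Rightarrow> nat \<Rightarrow> 'k poly fract set" where
  "zz C i = canon (mu C i) (mu C (Suc i)) (cls (mu C i) (YY C i))"

definition bco where "bco C i g s = expc (phi C i) g s"
definition uco where "uco C i g s = muprev C i (bco C i g s)"

text \<open>Q_s lies on S_{gamma_i}(g), i.e. attains the minimum of u + s gamma_i\<close>
definition onS :: "('k::field, 'g::linordered_ab_group_add) mlc \<Rightarrow> nat \<Rightarrow> 'k poly \<Rightarrow> nat \<Rightarrow> bool" where
  "onS C i g s \<longleftrightarrow> s \<le> degree g \<and> bco C i g s \<noteq> 0 \<and>
     uco C i g s + gmul (int s) (gm C i) = mu C i g"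

definition sI where "sI C i g = Min {s. onS C i g s}"
definition s'I where "s'I C i g = Max {s. onS C i g s}"
definition uI where "uI C i g = uco C i g (sI C i g)"

definition att :: "('k::field, 'g::linordered_ab_group_add) mlc \<Rightarrow> nat \<Rightarrow> 'k poly \<Rightarrow> bool" where
  "att C i g \<longleftrightarrow> g = 0 \<or> mu C i g \<in> Gup C (Suc i)"

definition dR where "dR C i g = (s'I C i g - sI C i g) div nat (ee C i)"

text \<open>j-th coefficient c_j of R_i(g), as a class in Delta_{mu_i}\<close>
definition Rco :: "('k::field, 'g::linordered_ab_group_add) mlc \<Rightarrow> nat \<Rightarrow> 'k poly \<Rightarrow> nat \<Rightarrow> 'k poly fract set" where
  "Rco C i g j = (let t = sI C i g + j * nat (ee C i) in
     if onS C i g t then cls (mu C i) (Fract (bco C i g t) 1 * pipow C i (- uco C i g t))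
     else cls (mu C i) 0)"

text \<open>R_i(g)(z_i), evaluated in Delta_{mu_{i+1}} (coefficients pushed along kappa_i -> kappa_{i+1})\<close>
definition Reval :: "('k::field, 'g::linordered_ab_group_add) mlc \<Rightarrow> nat \<Rightarrow> 'k poly \<Rightarrow> 'k poly fract set" where
  "Reval C i g = cls (mu C (Suc i))
     (\<Sum>j\<le>dR C i g. crep (canon (mu C i) (mu C (Suc i)) (Rco C i g j)) * crep (zz C i) ^ j)"

definition Lp where "Lp C i = (\<Prod>j\<in>{1..rk C}. l'I C i j)"
definition Lj where "Lj C i j = lI C i j * (\<Prod>t\<in>{j<..rk C}. l'I C i t)"
definition Lmap :: "('k::field, 'g::linordered_ab_group_add) mlc \<Rightarrow> nat \<Rightarrow> 'g \<Rightarrow> rat" where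
  "Lmap C i \<alpha> = (\<Sum>j\<in>{1..rk C}. coordq (io C i) (rk C) \<alpha> j * of_int (Lj C i j))"

definition eps :: "('k::field, 'g::linordered_ab_group_add) mlc \<Rightarrow> nat \<Rightarrow> 'k poly \<Rightarrow> 'k poly fract set" where
  "eps C i a = cpowi (mu C (Suc i)) (zz C i)
     \<lfloor>of_int (Lp C i) * of_nat (sI C i a) - Lmap C i (uI C i a)\<rfloor>"

end

theory Submission
  imports Defs
begin

text \<open>
  Residue classes are computed in the residue field of \<open>(K(x), \<mu>)\<close>. Write \<open>i = r - 1\<close>, let \<open>a\<close> be one of the
  coefficients \<open>a\<^sub>s\<close> in question and \<open>\<alpha> = \<mu>\<^sub>i(a)\<close>. Modulo elements of larger \<open>\<mu>\<^sub>i\<close>-value, hence of larger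
  \<open>\<mu>\<^sub>r\<close>-value, \<open>a\<close> is the sum of the terms \<open>b\<^sub>s \<phi>\<^sub>i\<^sup>s\<close> on the segment \<open>S\<close>, and their abscissas are
  \<open>s\<^sub>i(a) + k e\<^sub>i\<close>. Since \<open>Y\<^sub>i = \<phi>\<^sub>i\<^sup>e \<pi>\<^sub>i\<^sup>-\<^sup>h\<close>, dividing this sum by \<open>\<pi>\<^sub>r\<^sup>\<alpha>\<close> gives \<open>R\<^sub>i(a)(Y\<^sub>i)\<close> times the
  monomial \<open>\<phi>\<^sub>i\<^sup>s \<pi>\<^sub>i\<^sup>u \<pi>\<^sub>r\<^sup>-\<^sup>\<alpha>\<close> of the left endpoint \<open>(s, u)\<close> of \<open>S\<close>. That monomial has value zero, hence is a power of
  \<open>Y\<^sub>i\<close>, and a chain of unimodular changes of generators shows that the exponent is \<open>L'\<^sub>i s - L\<^sub>i(u)\<close>.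
\<close>

section \<open>Integer and rational multiples in a divisible ordered group\<close>

text \<open>Two obstacles shape the proof. The map \<open>canon\<close> is defined through
  polynomial representatives, while the elements to be moved along the chain are quotients.
  Invertibility makes it computable: a non-zero polynomial of degree below that of
  \<open>phi C i\<close> has an invertible initial form for \<open>mu C i\<close>, and
  \<open>phi C i\<close> acquires one for \<open>mu C (Suc i)\<close> because the next key
  polynomial does not divide it. Invertible initial forms keep their values and their inverses at
  all later stages. Secondly, \<open>ee C i\<close> is an index of full value groups, whereas the
  bases span only the finitely generated groups \<open>Gup C i\<close>. The condition
  \<open>hh C i \<in> Gup C i\<close> reconciles the two: it makes \<open>ee C i\<close> the least
  common multiple of the denominators of \<open>gm C i\<close>, and it forces the ordinates of a
  segment into \<open>Gup C i\<close>. In the change of generators only the exponent of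
  \<open>YY C i\<close> is computed. The accompanying monomial in the new generators is identified
  afterwards by its value, since \<open>YY C i\<close> has value 0.\<close>

lemma gmul_0 [simp]: "gmul 0 x = 0"
  by (simp add: gmul_def)

lemma gmul_add_one: "gmul (k + 1) x = gmul k x + x"
proof -
  consider "0 \<le> k" | "k = -1" | "k < -1" by linarith
  then show ?thesis
  proof cases
    case 1
    then have "nat (k + 1) = Suc (nat k)" by simp
    with 1 show ?thesis by (simp add: gmul_def)
  next
    case 2
    then show ?thesis by (simp add: gmul_def)
  next
    case 3
    then have "nat (- k) = Suc (nat (- (k + 1)))" by linarith
    with 3 show ?thesis by (simp add: gmul_def)
  qed
qed

lemma gmul_add: "gmul (a + b) x = gmul a x + gmul b x"
proof (induction b rule: int_induct [where k = 0])
  case (step1 i)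
  have "gmul (a + (i + 1)) x = gmul (a + i) x + x"
    by (metis add.assoc gmul_add_one)
  with step1 show ?case by (simp add: gmul_add_one add.assoc)
next
  case (step2 i)
  have 1: "gmul (a + i) x = gmul (a + (i - 1)) x + x"
    using gmul_add_one [of "a + (i - 1)" x] by simp
  have 2: "gmul i x = gmul (i - 1) x + x"
    using gmul_add_one [of "i - 1" x] by simp
  from step2 1 2 show ?case by (simp add: algebra_simps)
qed simp

lemma gmul_1 [simp]: "gmul 1 x = x"
  using gmul_add_one [of 0 x] by simp

lemma gmul_minus: "gmul (- a) x = - gmul a x"
  using gmul_add [of a "- a" x] by (simp add: eq_neg_iff_add_eq_0 add.commute)

lemma gmul_diff: "gmul (a - b) x = gmul a x - gmul b x"
  using gmul_add [of a "- b" x] by (simp add: gmul_minus)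

lemma gmul_add_right: "gmul a (x + y) = gmul a x + gmul a y"
proof (induction a rule: int_induct [where k = 0])
  case (step2 i)
  have "gmul i z = gmul (i - 1) z + z" for z :: 'a
    using gmul_add_one [of "i - 1" z] by simp
  then have *: "gmul (i - 1) z = gmul i z - z" for z :: 'a
    by (simp add: eq_diff_eq)
  from step2 show ?case by (simp add: *)
qed (simp_all add: gmul_add_one algebra_simps)

lemma gmul_0_right [simp]: "gmul a 0 = 0"
  using gmul_add_right [of a 0 0] by simp

lemma gmul_minus_right: "gmul a (- x) = - gmul a x"
  using gmul_add_right [of a x "- x"] by (simp add: eq_neg_iff_add_eq_0 add.commute)

lemma gmul_mult: "gmul (a * b) x = gmul a (gmul b x)"
proof (induction a rule: int_induct [where k = 0])
  case (step2 i)
  have "gmul (i * b) x = gmul ((i - 1) * b) x + gmul b x"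
    using gmul_add [of "(i - 1) * b" b x] by (simp add: algebra_simps)
  moreover have "gmul i (gmul b x) = gmul (i - 1) (gmul b x) + gmul b x"
    using gmul_add_one [of "i - 1" "gmul b x"] by simp
  ultimately show ?case using step2 by simp
qed (simp_all add: gmul_add distrib_right)

lemma gmul_pos:
  fixes x :: "'g::linordered_ab_group_add"
  assumes "0 < k" "0 < x"
  shows "0 < gmul k x"
  using assms(1)
proof (induction k rule: int_gr_induct)
  case (step i)
  then show ?case using assms(2) by (simp add: gmul_add add_pos_pos)
qed (use assms in simp)

lemma gmul_eq_0_iff:
  fixes x :: "'g::linordered_ab_group_add"
  assumes "k \<noteq> 0"
  shows "gmul k x = 0 \<longleftrightarrow> x = 0"
proof -
  have *: "x = 0" if "0 < k" "gmul k x = 0" for k :: int and x :: 'g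
    using gmul_pos [of k x] gmul_pos [of k "- x"] that
    by (cases x "0 :: 'g" rule: linorder_cases) (auto simp: gmul_minus_right)
  show ?thesis
    using * [of k x] * [of "- k" x] assms by (cases "0 < k") (auto simp: gmul_minus)
qed

lemma gmul_cancel:
  fixes x :: "'g::linordered_ab_group_add"
  assumes "k \<noteq> 0"
  shows "gmul k x = gmul k y \<longleftrightarrow> x = y"
  using gmul_eq_0_iff [OF assms, of "x - y"] gmul_add_right [of k x "- y"]
  by (simp add: gmul_minus_right)

text \<open>\<open>qmul\<close> refers to the reduced fraction. Cross-multiplication frees later
  arguments from reducing: any representation of the scalar will do. The order supplies
  torsion-freeness, hence uniqueness; divisibility supplies existence.\<close>

lemma qmul_eq_iff:
  fixes x :: "'g::linordered_ab_group_add"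
  assumes div: "divisible_group TYPE('g)" and k: "k \<noteq> 0"
  shows "qmul (of_int n / of_int k) x = y \<longleftrightarrow> gmul k y = gmul n x"
proof -
  let ?q = "of_int n / of_int k :: rat"
  obtain a b where ab: "quotient_of ?q = (a, b)" by (cases "quotient_of ?q")
  then have b: "b > 0" and q: "?q = of_int a / of_int b"
    by (simp_all add: quotient_of_denom_pos quotient_of_div)
  from q b k have "(of_int (n * b) :: rat) = of_int (a * k)" by (simp add: field_simps)
  then have nk: "n * b = a * k" by linarith
  have iff: "gmul b z = gmul a x \<longleftrightarrow> gmul k z = gmul n x" for z
  proof -
    have "gmul b z = gmul a x \<longleftrightarrow> gmul k (gmul b z) = gmul k (gmul a x)"
      using k by (simp add: gmul_cancel)
    also have "\<dots> \<longleftrightarrow> gmul b (gmul k z) = gmul b (gmul n x)"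
      using nk by (simp add: gmul_mult [symmetric] mult.commute)
    also have "\<dots> \<longleftrightarrow> gmul k z = gmul n x"
      using b by (simp add: gmul_cancel)
    finally show ?thesis .
  qed
  obtain z where z: "gmul b z = gmul a x"
    using div b unfolding divisible_group_def by blast
  have "qmul ?q x = z"
    unfolding qmul_def ab
    proof (rule the_equality)
    fix y assume "gmul (snd (a, b)) y = gmul (fst (a, b)) x"
    with z have "gmul b y = gmul b z" by simp
    with b show "y = z" by (simp add: gmul_cancel)
  qed (use z in simp)
  with z b iff [of y] gmul_cancel [of b y z] show ?thesis by auto
qed

lemma rat_eq_fraction: obtains n k where "(q :: rat) = of_int n / of_int k" "k \<noteq> 0"
  by (metis less_irrefl quotient_of_denom_pos' quotient_of_div surjective_pairing)

context
  assumes div: "divisible_group TYPE('g::linordered_ab_group_add)"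
begin

lemma qmul_of_int: "qmul (of_int n) (x :: 'g) = gmul n x"
  using qmul_eq_iff [OF div, of 1 n x] by simp

lemma qmul_0 [simp]: "qmul 0 (x :: 'g) = 0"
  using qmul_of_int [of 0 x] by simp

lemma gmul_qmul:
  "k \<noteq> 0 \<Longrightarrow> gmul k (qmul (of_int n / of_int k) (x :: 'g)) = gmul n x"
  using qmul_eq_iff [OF div] by blast

lemma qmul_add: "qmul (p + q) (x :: 'g) = qmul p x + qmul q x"
proof -
  obtain a b where p: "p = of_int a / of_int b" "b \<noteq> 0" by (rule rat_eq_fraction)
  obtain c d where q: "q = of_int c / of_int d" "d \<noteq> 0" by (rule rat_eq_fraction)
  have pq: "p + q = of_int (a * d + c * b) / of_int (b * d)"
    using p q by (simp add: field_simps)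
  have "gmul (b * d) (qmul p x + qmul q x) = gmul (d * b) (qmul p x) + gmul (b * d) (qmul q x)"
    by (simp add: gmul_add_right mult.commute)
  also have "\<dots> = gmul (a * d + c * b) x"
    by (simp add: gmul_mult p q gmul_qmul gmul_add) (simp add: gmul_mult [symmetric] mult.commute)
  finally show ?thesis
    unfolding pq using p q by (subst qmul_eq_iff [OF div]) auto
qed

lemma qmul_mult: "qmul (p * q) (x :: 'g) = qmul p (qmul q x)"
proof -
  obtain a b where p: "p = of_int a / of_int b" "b \<noteq> 0" by (rule rat_eq_fraction)
  obtain c d where q: "q = of_int c / of_int d" "d \<noteq> 0" by (rule rat_eq_fraction)
  have pq: "p * q = of_int (a * c) / of_int (d * b)"
    using p q by (simp add: field_simps)
  have "gmul (d * b) (qmul p (qmul q x)) = gmul (a * d) (qmul q x)"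
    by (simp add: gmul_mult p gmul_qmul) (simp add: gmul_mult [symmetric] mult.commute)
  also have "\<dots> = gmul (a * c) x"
    by (simp add: gmul_mult q gmul_qmul)
  finally show ?thesis
    unfolding pq using p q by (subst qmul_eq_iff [OF div]) auto
qed

lemma qmul_add_right: "qmul p (x + y :: 'g) = qmul p x + qmul p y"
proof -
  obtain a b where p: "p = of_int a / of_int b" "b \<noteq> 0" by (rule rat_eq_fraction)
  show ?thesis
    unfolding p using p by (subst qmul_eq_iff [OF div]) (auto simp: gmul_add_right gmul_qmul)
qed

lemma qmul_0_right [simp]: "qmul p (0 :: 'g) = 0"
  using qmul_add_right [of p 0 0] by simp

lemma qmul_minus: "qmul (- p) (x :: 'g) = - qmul p x"
  using qmul_add [of p "- p" x] by (simp add: eq_neg_iff_add_eq_0 add.commute)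

lemma qmul_sum: "qmul (\<Sum>i\<in>A. c i) (x :: 'g) = (\<Sum>i\<in>A. qmul (c i) x)"
  by (induction A rule: infinite_finite_induct) (simp_all add: qmul_add)

lemma qmul_sum_right: "qmul p (\<Sum>i\<in>A. x i :: 'g) = (\<Sum>i\<in>A. qmul p (x i))"
  by (induction A rule: infinite_finite_induct) (simp_all add: qmul_add_right)

end

definition qindep :: "(nat \<Rightarrow> 'g::ab_group_add) \<Rightarrow> nat \<Rightarrow> bool" where
  "qindep B n \<longleftrightarrow> (\<forall>c. (\<Sum>j=1..n. qmul (c j) (B j)) = 0 \<longrightarrow> (\<forall>j\<in>{1..n}. c j = 0))"

text \<open>Multiplying a rational relation by the product of all denominators gives an integral
  one.\<close>

lemma qindep_if_zindep:
  fixes B :: "nat \<Rightarrow> 'g::linordered_ab_group_add"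
  assumes div: "divisible_group TYPE('g)"
    and z: "\<And>c. (\<Sum>j=1..n. gmul (c j) (B j)) = 0 \<Longrightarrow> \<forall>j\<in>{1..n}. c j = 0"
  shows "qindep B n"
  unfolding qindep_def
proof (intro allI impI)
  fix c assume 0: "(\<Sum>j=1..n. qmul (c j) (B j)) = 0"
  define N where "N = (\<Prod>j=1..n. snd (quotient_of (c j)))"
  have pos: "snd (quotient_of q) > 0" for q by (rule quotient_of_denom_pos')
  have N: "N > 0" unfolding N_def by (rule prod_pos) (use pos in auto)
  have "\<exists>k. of_int N * c j = of_int k" if "j \<in> {1..n}" for j
  proof -
    have "snd (quotient_of (c j)) dvd N"
      unfolding N_def using that by (intro dvd_prodI) auto
    then obtain m where m: "N = snd (quotient_of (c j)) * m" ..
    have "c j = of_int (fst (quotient_of (c j))) / of_int (snd (quotient_of (c j)))"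
      by (rule quotient_of_div) simp
    then have "of_int N * c j = of_int (fst (quotient_of (c j)) * m)"
      using pos [of "c j"] unfolding m by (simp add: field_simps)
    then show ?thesis by blast
  qed
  then obtain k where k: "\<And>j. j \<in> {1..n} \<Longrightarrow> of_int N * c j = of_int (k j)" by metis
  have "(\<Sum>j=1..n. gmul (k j) (B j)) = (\<Sum>j=1..n. qmul (of_int N) (qmul (c j) (B j)))"
    by (intro sum.cong refl) (simp add: qmul_mult [OF div, symmetric] k qmul_of_int [OF div])
  also have "\<dots> = 0"
    using 0 by (simp add: qmul_sum_right [OF div, symmetric] qmul_0_right [OF div])
  finally have "\<forall>j\<in>{1..n}. k j = 0" by (rule z)
  then have "of_int N * c j = 0" if "j \<in> {1..n}" for j using k that by simp
  then show "\<forall>j\<in>{1..n}. c j = 0" using N by simp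
qed

lemma coordq_eq:
  fixes B :: "nat \<Rightarrow> 'g::linordered_ab_group_add"
  assumes div: "divisible_group TYPE('g)" and ind: "qindep B n"
    and x: "x = (\<Sum>j=1..n. qmul (c j) (B j))"
  shows "coordq B n x = (\<lambda>j. if j \<in> {1..n} then c j else 0)"
  unfolding coordq_def
proof (rule the_equality)
  show "x = (\<Sum>j=1..n. qmul (if j \<in> {1..n} then c j else 0) (B j)) \<and>
    (\<forall>j. j \<notin> {1..n} \<longrightarrow> (if j \<in> {1..n} then c j else 0) = 0)"
    unfolding x by (auto intro!: sum.cong)
next
  fix d assume d: "x = (\<Sum>j=1..n. qmul (d j) (B j)) \<and> (\<forall>j. j \<notin> {1..n} \<longrightarrow> d j = 0)"
  let ?D = "\<lambda>j. d j + - c j"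
  have "(\<Sum>j=1..n. qmul (?D j) (B j)) = (\<Sum>j=1..n. qmul (d j) (B j)) + - (\<Sum>j=1..n. qmul (c j) (B j))"
    by (simp only: qmul_add [OF div] qmul_minus [OF div] sum_negf sum.distrib)
  also have "\<dots> = x + - x" using d x by (metis (no_types))
  finally have "(\<Sum>j=1..n. qmul (?D j) (B j)) = 0" by simp
  then have "\<forall>j\<in>{1..n}. ?D j = 0"
    by (rule ind [unfolded qindep_def, THEN spec, THEN mp])
  with d show "d = (\<lambda>j. if j \<in> {1..n} then c j else 0)" by fastforce
qed

lemma coordq_eq_int:
  fixes B :: "nat \<Rightarrow> 'g::linordered_ab_group_add"
  assumes div: "divisible_group TYPE('g)" and ind: "qindep B n"
    and x: "x = (\<Sum>j=1..n. gmul (c j) (B j))"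
  shows "coordq B n x = (\<lambda>j. if j \<in> {1..n} then of_int (c j) else 0)"
  by (rule coordq_eq [OF div ind]) (simp add: x qmul_of_int [OF div])

section \<open>Augmented valuations\<close>

text \<open>Nothing is demanded at 0, since the group of values has no infinite element. The domain
  is general because the same notion serves \<open>vK C\<close> on the field, \<open>mu C i\<close>
  on polynomials and \<open>muF (mu C i)\<close> on their quotients.\<close>

definition ring_val :: "('a::idom \<Rightarrow> 'g::linordered_ab_group_add) \<Rightarrow> bool" where
  "ring_val \<mu> \<longleftrightarrow>
     (\<forall>a b. a \<noteq> 0 \<longrightarrow> b \<noteq> 0 \<longrightarrow> \<mu> (a * b) = \<mu> a + \<mu> b) \<and>
     (\<forall>a b. a \<noteq> 0 \<longrightarrow> b \<noteq> 0 \<longrightarrow> a + b \<noteq> 0 \<longrightarrow> min (\<mu> a) (\<mu> b) \<le> \<mu> (a + b))"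

definition vge :: "('a::zero \<Rightarrow> 'g::linorder) \<Rightarrow> 'g \<Rightarrow> 'a \<Rightarrow> bool" where
  "vge \<mu> \<alpha> f \<longleftrightarrow> f = 0 \<or> \<alpha> \<le> \<mu> f"

definition vgt :: "('a::zero \<Rightarrow> 'g::linorder) \<Rightarrow> 'g \<Rightarrow> 'a \<Rightarrow> bool" where
  "vgt \<mu> \<alpha> f \<longleftrightarrow> f = 0 \<or> \<alpha> < \<mu> f"

lemma vge_0 [simp]: "vge \<mu> \<alpha> 0" and vgt_0 [simp]: "vgt \<mu> \<alpha> 0"
  by (simp_all add: vge_def vgt_def)

lemma vgt_imp_vge: "vgt \<mu> \<alpha> f \<Longrightarrow> vge \<mu> \<alpha> f"
  by (auto simp: vge_def vgt_def)

context
  fixes \<mu> :: "'a::idom \<Rightarrow> 'g::linordered_ab_group_add"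
  assumes val: "ring_val \<mu>"
begin

lemma val_mult: "a \<noteq> 0 \<Longrightarrow> b \<noteq> 0 \<Longrightarrow> \<mu> (a * b) = \<mu> a + \<mu> b"
  using val by (simp add: ring_val_def)

lemma val_1 [simp]: "\<mu> 1 = 0"
  using val_mult [of 1 1] by simp

lemma val_uminus [simp]: "\<mu> (- a) = \<mu> a"
proof (cases "a = 0")
  case False
  have "\<mu> (- 1) + \<mu> (- 1) = 0"
    using val_mult [of "- 1" "- 1"] by simp
  then have "\<mu> (- 1) = 0" by simp
  with False show ?thesis using val_mult [of "- 1" a] by simp
qed simp

lemma val_add: "a \<noteq> 0 \<Longrightarrow> b \<noteq> 0 \<Longrightarrow> a + b \<noteq> 0 \<Longrightarrow> min (\<mu> a) (\<mu> b) \<le> \<mu> (a + b)"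
  using val by (simp add: ring_val_def)

lemma vge_add: "vge \<mu> \<alpha> a \<Longrightarrow> vge \<mu> \<alpha> b \<Longrightarrow> vge \<mu> \<alpha> (a + b)"
  using val_add [of a b] unfolding vge_def
  by (cases "a = 0 \<or> b = 0 \<or> a + b = 0") (auto simp: min_le_iff_disj intro: order_trans)

lemma vgt_add: "vgt \<mu> \<alpha> a \<Longrightarrow> vgt \<mu> \<alpha> b \<Longrightarrow> vgt \<mu> \<alpha> (a + b)"
  using val_add [of a b] unfolding vgt_def
  by (cases "a = 0 \<or> b = 0 \<or> a + b = 0") (auto simp: min_le_iff_disj intro: order_less_le_trans)

lemma vge_uminus [simp]: "vge \<mu> \<alpha> (- a) \<longleftrightarrow> vge \<mu> \<alpha> a"
  and vgt_uminus [simp]: "vgt \<mu> \<alpha> (- a) \<longleftrightarrow> vgt \<mu> \<alpha> a"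
  by (simp_all add: vge_def vgt_def)

lemma vge_diff: "vge \<mu> \<alpha> a \<Longrightarrow> vge \<mu> \<alpha> b \<Longrightarrow> vge \<mu> \<alpha> (a - b)"
  using vge_add [of \<alpha> a "- b"] by simp

lemma vgt_diff: "vgt \<mu> \<alpha> a \<Longrightarrow> vgt \<mu> \<alpha> b \<Longrightarrow> vgt \<mu> \<alpha> (a - b)"
  using vgt_add [of \<alpha> a "- b"] by simp

lemma vge_mult: "vge \<mu> \<alpha> a \<Longrightarrow> vge \<mu> \<beta> b \<Longrightarrow> vge \<mu> (\<alpha> + \<beta>) (a * b)"
  by (cases "a = 0 \<or> b = 0") (auto simp: vge_def val_mult intro: add_mono)

lemma vgt_mult: "vgt \<mu> \<alpha> a \<Longrightarrow> vge \<mu> \<beta> b \<Longrightarrow> vgt \<mu> (\<alpha> + \<beta>) (a * b)"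
  by (cases "a = 0 \<or> b = 0") (auto simp: vge_def vgt_def val_mult intro: add_less_le_mono)

lemma vge_sum: "(\<And>i. i \<in> A \<Longrightarrow> vge \<mu> \<alpha> (f i)) \<Longrightarrow> vge \<mu> \<alpha> (\<Sum>i\<in>A. f i)"
  by (induction A rule: infinite_finite_induct) (auto intro: vge_add)

lemma vgt_sum: "(\<And>i. i \<in> A \<Longrightarrow> vgt \<mu> \<alpha> (f i)) \<Longrightarrow> vgt \<mu> \<alpha> (\<Sum>i\<in>A. f i)"
  by (induction A rule: infinite_finite_induct) (auto intro: vgt_add)

lemma val_add_eq:
  assumes "a \<noteq> 0" "vgt \<mu> (\<mu> a) b"
  shows "a + b \<noteq> 0" "\<mu> (a + b) = \<mu> a"
proof -
  show nz: "a + b \<noteq> 0"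
    using assms val_uminus [of a] by (auto simp: vgt_def add_eq_0_iff)
  have "vge \<mu> (\<mu> a) (a + b)"
    using assms by (intro vge_add vgt_imp_vge [of _ _ b]) (auto simp: vge_def)
  moreover have "\<not> \<mu> a < \<mu> (a + b)"
  proof
    assume "\<mu> a < \<mu> (a + b)"
    then have "vgt \<mu> (\<mu> a) ((a + b) - b)"
      using assms by (intro vgt_diff) (auto simp: vgt_def)
    then show False using assms by (simp add: vgt_def)
  qed
  ultimately show "\<mu> (a + b) = \<mu> a" using nz by (simp add: vge_def)
qed

lemma val_power: "a \<noteq> 0 \<Longrightarrow> \<mu> (a ^ k) = gmul (int k) (\<mu> a)"
  by (induction k) (simp_all add: val_mult gmul_add add.commute)

end

section \<open>Expansions in powers of a polynomial\<close>

lemma expc_0: "expc \<phi> f 0 = f mod \<phi>"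
  by (simp add: expc_def)

lemma expc_Suc: "expc \<phi> f (Suc s) = expc \<phi> (f div \<phi>) s"
  by (simp add: expc_def poly_div_mult_right)

lemma expc_add: "expc \<phi> (f + g) s = expc \<phi> f s + expc \<phi> g s"
  by (simp add: expc_def poly_div_add_left poly_mod_add_left)

lemma expc_zero [simp]: "expc \<phi> 0 s = 0"
  by (simp add: expc_def)

lemma degree_expc: "0 < degree \<phi> \<Longrightarrow> degree (expc \<phi> f s) < degree \<phi>"
  unfolding expc_def by (metis degree_0 degree_mod_less' gr_implies_not0)

lemma degree_div_add:
  fixes f \<phi> :: "'a::field poly"
  assumes "0 < degree \<phi>" "f div \<phi> \<noteq> 0"
  shows "degree (f div \<phi>) + degree \<phi> = degree f"
proof -
  have \<phi>: "\<phi> \<noteq> 0" using assms by auto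
  have "degree (f div \<phi> * \<phi>) = degree (f div \<phi>) + degree \<phi>"
    using assms \<phi> by (intro degree_mult_eq)
  moreover have "degree f = degree (f div \<phi> * \<phi> + f mod \<phi>)" by simp
  moreover have "degree (f mod \<phi>) < degree \<phi>"
    using assms \<phi> by (metis degree_0 degree_mod_less')
  then have "degree (f div \<phi> * \<phi> + f mod \<phi>) = degree (f div \<phi> * \<phi>)"
    using calculation(1) by (intro degree_add_eq_left) simp
  ultimately show ?thesis by simp
qed

lemma degree_div_less:
  fixes f \<phi> :: "'a::field poly"
  assumes "0 < degree \<phi>" "f div \<phi> \<noteq> 0"
  shows "degree (f div \<phi>) < degree f"
  using degree_div_add [OF assms] assms by simp

lemma expansion_sum:
  assumes \<phi>: "0 < degree \<phi>" and n: "degree f \<le> n"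
  shows "f = (\<Sum>s\<le>n. expc \<phi> f s * \<phi> ^ s)"
  using n
proof (induction n arbitrary: f)
  case 0
  then show ?case using \<phi> by (simp add: expc_0 mod_poly_less)
next
  case (Suc n)
  have "degree (f div \<phi>) \<le> n"
    using degree_div_less [OF \<phi>, of f] Suc.prems by (cases "f div \<phi> = 0") auto
  then have *: "f div \<phi> = (\<Sum>s\<le>n. expc \<phi> (f div \<phi>) s * \<phi> ^ s)" by (rule Suc.IH)
  have "(\<Sum>s\<le>Suc n. expc \<phi> f s * \<phi> ^ s) = f mod \<phi> + \<phi> * (\<Sum>s\<le>n. expc \<phi> (f div \<phi>) s * \<phi> ^ s)"
    by (simp only: sum.atMost_Suc_shift) (simp add: expc_0 expc_Suc sum_distrib_left algebra_simps)
  also have "\<dots> = f" by (simp add: * [symmetric])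
  finally show ?case by simp
qed

lemma expc_eq_0: "0 < degree \<phi> \<Longrightarrow> degree f < s \<Longrightarrow> expc \<phi> f s = 0"
proof (induction s arbitrary: f)
  case (Suc s)
  show ?case
  proof (cases "f div \<phi> = 0")
    case False
    then show ?thesis using Suc degree_div_less [OF Suc.prems(1) False] by (simp add: expc_Suc)
  qed (simp add: expc_Suc)
qed simp

text \<open>The conditions on the lower valuation \<open>\<nu>\<close> concern polynomials of degree below \<open>degree \<phi>\<close> only, so
  that the first step of a chain, where \<open>\<nu>\<close> is defined on constants, is covered as well.\<close>
locale augmentation =
  fixes \<nu> :: "'k::field poly \<Rightarrow> 'g::linordered_ab_group_add" and \<phi> :: "'k poly" and \<gamma> :: 'g
  assumes deg: "0 < degree \<phi>"
    and add: "\<lbrakk>a \<noteq> 0; b \<noteq> 0; a + b \<noteq> 0; degree a < degree \<phi>; degree b < degree \<phi>\<rbrakk>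
      \<Longrightarrow> min (\<nu> a) (\<nu> b) \<le> \<nu> (a + b)"
    and mult: "\<lbrakk>a \<noteq> 0; b \<noteq> 0; degree a < degree \<phi>; degree b < degree \<phi>\<rbrakk>
      \<Longrightarrow> a * b mod \<phi> \<noteq> 0 \<and> \<nu> (a * b mod \<phi>) = \<nu> a + \<nu> b"
    and carry: "\<lbrakk>a \<noteq> 0; b \<noteq> 0; degree a < degree \<phi>; degree b < degree \<phi>; a * b div \<phi> \<noteq> 0\<rbrakk>
      \<Longrightarrow> \<nu> a + \<nu> b < \<nu> (a * b div \<phi>) + \<gamma>"
begin

abbreviation "M \<equiv> aug \<nu> \<phi> \<gamma>"

lemma phi_nz: "\<phi> \<noteq> 0" using deg by auto

lemma finite_support: "finite {\<nu> (expc \<phi> f s) + gmul (int s) \<gamma> | s. s \<le> degree f \<and> expc \<phi> f s \<noteq> 0}"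
  by simp

lemma support_nonempty:
  assumes "f \<noteq> 0"
  shows "\<exists>s\<le>degree f. expc \<phi> f s \<noteq> 0"
proof (rule ccontr)
  assume "\<not> ?thesis"
  then have "(\<Sum>s\<le>degree f. expc \<phi> f s * \<phi> ^ s) = 0" by (intro sum.neutral) auto
  with expansion_sum [OF deg order_refl, of f] assms show False by simp
qed

lemma aug_attained:
  assumes "f \<noteq> 0"
  obtains s where "s \<le> degree f" "expc \<phi> f s \<noteq> 0" "M f = \<nu> (expc \<phi> f s) + gmul (int s) \<gamma>"
proof -
  have "M f \<in> {\<nu> (expc \<phi> f s) + gmul (int s) \<gamma> | s. s \<le> degree f \<and> expc \<phi> f s \<noteq> 0}"
    unfolding aug_def using support_nonempty [OF assms] by (intro Min_in finite_support) auto
  with that show ?thesis by blast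
qed

lemma aug_le: "expc \<phi> f s \<noteq> 0 \<Longrightarrow> M f \<le> \<nu> (expc \<phi> f s) + gmul (int s) \<gamma>"
  unfolding aug_def using expc_eq_0 [OF deg, of f s] not_less [of "degree f" s]
  by (intro Min_le finite_support) blast

lemma vge_aug_iff:
  "vge M \<alpha> f \<longleftrightarrow> (\<forall>s. expc \<phi> f s \<noteq> 0 \<longrightarrow> \<alpha> \<le> \<nu> (expc \<phi> f s) + gmul (int s) \<gamma>)"
proof (cases "f = 0")
  case False
  then obtain s where "expc \<phi> f s \<noteq> 0" "M f = \<nu> (expc \<phi> f s) + gmul (int s) \<gamma>"
    by (rule aug_attained)
  with False show ?thesis using aug_le [of f] unfolding vge_def by (metis order_trans)
qed simp

text \<open>Division with remainder peels off the constant coefficient of the expansion. This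
  replaces the minimum over all coefficients by an induction on the degree.\<close>

lemma vge_aug_rec: "vge M \<alpha> f \<longleftrightarrow> vge \<nu> \<alpha> (f mod \<phi>) \<and> vge M (\<alpha> - \<gamma>) (f div \<phi>)"
proof -
  have all_split: "(\<forall>s. P s) \<longleftrightarrow> P 0 \<and> (\<forall>s. P (Suc s))" for P :: "nat \<Rightarrow> bool"
    by (metis nat.exhaust)
  have "vge M \<alpha> f \<longleftrightarrow> vge \<nu> \<alpha> (f mod \<phi>) \<and>
    (\<forall>s. expc \<phi> f (Suc s) \<noteq> 0 \<longrightarrow> \<alpha> \<le> \<nu> (expc \<phi> f (Suc s)) + gmul (int (Suc s)) \<gamma>)"
    using all_split [of "\<lambda>s. expc \<phi> f s \<noteq> 0 \<longrightarrow> \<alpha> \<le> \<nu> (expc \<phi> f s) + gmul (int s) \<gamma>"]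
    unfolding vge_aug_iff by (simp add: expc_0 vge_def) blast
  also have "(\<forall>s. expc \<phi> f (Suc s) \<noteq> 0 \<longrightarrow> \<alpha> \<le> \<nu> (expc \<phi> f (Suc s)) + gmul (int (Suc s)) \<gamma>)
      \<longleftrightarrow> vge M (\<alpha> - \<gamma>) (f div \<phi>)"
    unfolding vge_aug_iff expc_Suc by (simp add: gmul_add diff_le_eq algebra_simps)
  finally show ?thesis .
qed

lemma aug_small: "degree a < degree \<phi> \<Longrightarrow> a \<noteq> 0 \<Longrightarrow> M a = \<nu> a"
  using vge_aug_rec [of _ a]
  by (simp add: mod_poly_less div_poly_less vge_def) (metis order_antisym order_refl)

lemma vge_aug_small: "degree a < degree \<phi> \<Longrightarrow> vge M \<alpha> a \<longleftrightarrow> vge \<nu> \<alpha> a"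
  using vge_aug_rec [of \<alpha> a] by (simp add: mod_poly_less div_poly_less)

lemma aug_phi_mult: "f \<noteq> 0 \<Longrightarrow> M (\<phi> * f) = \<gamma> + M f"
  using vge_aug_rec [of _ "\<phi> * f"] phi_nz
  by (simp add: vge_def diff_le_eq) (metis add.commute order_antisym order_refl)

lemma vge_phi_mult: "vge M \<alpha> (\<phi> * f) \<longleftrightarrow> vge M (\<alpha> - \<gamma>) f"
  using vge_aug_rec [of _ "\<phi> * f"] phi_nz by simp

lemma vge_aug_add:
  assumes "vge M \<alpha> f" "vge M \<alpha> g"
  shows "vge M \<alpha> (f + g)"
  unfolding vge_aug_iff
proof (intro allI impI)
  fix s assume nz: "expc \<phi> (f + g) s \<noteq> 0"
  let ?a = "expc \<phi> f s" and ?b = "expc \<phi> g s" and ?\<beta> = "gmul (int s) \<gamma>"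
  have a: "?a = 0 \<or> \<alpha> - ?\<beta> \<le> \<nu> ?a" and b: "?b = 0 \<or> \<alpha> - ?\<beta> \<le> \<nu> ?b"
    using assms unfolding vge_aug_iff by (auto simp: diff_le_eq)
  have "\<alpha> - ?\<beta> \<le> \<nu> (?a + ?b)"
  proof (cases "?a = 0 \<or> ?b = 0")
    case True
    with a b nz show ?thesis by (auto simp: expc_add)
  next
    case False
    with nz have "min (\<nu> ?a) (\<nu> ?b) \<le> \<nu> (?a + ?b)"
      by (intro add) (auto simp: expc_add degree_expc [OF deg])
    with a b False show ?thesis by (meson min.boundedI order_trans)
  qed
  then show "\<alpha> \<le> \<nu> (expc \<phi> (f + g) s) + ?\<beta>" by (simp add: expc_add diff_le_eq)
qed

lemma degree_mult_div:
  assumes "degree a < degree \<phi>" "degree b < degree \<phi>"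
  shows "degree (a * b div \<phi>) < degree \<phi>"
proof (cases "a * b div \<phi> = 0")
  case False
  have "degree (a * b) < degree \<phi> + degree \<phi>"
    using degree_mult_le [of a b] assms by simp
  moreover have "degree (a * b div \<phi>) + degree \<phi> = degree (a * b)"
    by (rule degree_div_add [OF deg False])
  ultimately show ?thesis by linarith
qed (use deg in simp)

text \<open>Split \<open>a * b\<close> into its remainder and \<open>\<phi>\<close> times its
  quotient. \<open>mult\<close> gives the value of the remainder, and \<open>carry\<close> places
  the quotient, shifted by \<open>\<gamma>\<close>, strictly higher.\<close>

lemma vge_small_mult:
  assumes "degree a < degree \<phi>" "degree b < degree \<phi>" "vge M \<alpha> a" "vge M \<beta> b"
  shows "vge M (\<alpha> + \<beta>) (a * b)"
proof (cases "a = 0 \<or> b = 0")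
  case False
  then have nz: "a \<noteq> 0" "b \<noteq> 0" by auto
  have le: "\<alpha> + \<beta> \<le> \<nu> a + \<nu> b"
    using assms nz by (auto simp: vge_def aug_small intro: add_mono)
  have "vge \<nu> (\<alpha> + \<beta>) (a * b mod \<phi>)"
    using mult [OF nz assms(1,2)] le by (simp add: vge_def)
  moreover have "vge M (\<alpha> + \<beta> - \<gamma>) (a * b div \<phi>)"
    using carry [OF nz assms(1,2)] le degree_mult_div [OF assms(1,2)]
    by (cases "a * b div \<phi> = 0") (simp_all add: vge_def aug_small diff_le_eq)
  ultimately show ?thesis using vge_aug_rec by blast
qed auto

text \<open>Induction on \<open>g\<close>: its remainder gives a product of two small polynomials,
  its quotient has smaller degree. The general product below repeats this peeling on the other
  factor.\<close>

lemma vge_small_mult_poly: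
  assumes "degree a < degree \<phi>" "vge M \<alpha> a" "vge M \<beta> g"
  shows "vge M (\<alpha> + \<beta>) (a * g)"
  using assms(3)
proof (induction "degree g" arbitrary: g \<beta> rule: less_induct)
  case less
  have g: "a * g = a * (g mod \<phi>) + \<phi> * (a * (g div \<phi>))"
    by (metis add.commute distrib_left mult.left_commute mult_div_mod_eq)
  have "degree (g mod \<phi>) < degree \<phi>" using deg degree_expc [of \<phi> g 0] by (simp add: expc_0)
  moreover from this have "vge M \<beta> (g mod \<phi>)"
    using less.prems vge_aug_rec [of \<beta> g] by (simp add: vge_aug_small)
  ultimately have 1: "vge M (\<alpha> + \<beta>) (a * (g mod \<phi>))"
    using assms by (intro vge_small_mult)
  have "vge M (\<alpha> + (\<beta> - \<gamma>)) (a * (g div \<phi>))"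
  proof (cases "g div \<phi> = 0")
    case False
    then show ?thesis
      using less vge_aug_rec [of \<beta> g] degree_div_less [OF deg False] by blast
  qed simp
  then have "vge M (\<alpha> + \<beta>) (\<phi> * (a * (g div \<phi>)))"
    by (simp add: vge_phi_mult algebra_simps)
  with 1 show ?case unfolding g by (rule vge_aug_add)
qed

lemma vge_aug_mult:
  assumes "vge M \<alpha> f" "vge M \<beta> g"
  shows "vge M (\<alpha> + \<beta>) (f * g)"
  using assms(1)
proof (induction "degree f" arbitrary: f \<alpha> rule: less_induct)
  case less
  have f: "f * g = (f mod \<phi>) * g + \<phi> * ((f div \<phi>) * g)"
    by (metis add.commute distrib_right mult.assoc mult_div_mod_eq)
  have "degree (f mod \<phi>) < degree \<phi>" using deg degree_expc [of \<phi> f 0] by (simp add: expc_0)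
  moreover from this have "vge M \<alpha> (f mod \<phi>)"
    using less.prems vge_aug_rec [of \<alpha> f] by (simp add: vge_aug_small)
  ultimately have 1: "vge M (\<alpha> + \<beta>) ((f mod \<phi>) * g)"
    using assms by (intro vge_small_mult_poly)
  have "vge M ((\<alpha> - \<gamma>) + \<beta>) ((f div \<phi>) * g)"
  proof (cases "f div \<phi> = 0")
    case False
    then show ?thesis
      using less vge_aug_rec [of \<alpha> f] degree_div_less [OF deg False] by blast
  qed simp
  then have "vge M (\<alpha> + \<beta>) (\<phi> * ((f div \<phi>) * g))"
    by (simp add: vge_phi_mult algebra_simps)
  with 1 show ?case unfolding f by (rule vge_aug_add)
qed

lemma aug_uminus: "M (- f) = M f"
proof -
  have le: "vge M \<alpha> (- f)" if "vge M \<alpha> f" for f \<alpha>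
  proof -
    have one: "\<nu> 1 = 0"
      using mult [of 1 1] deg by (simp add: mod_poly_less)
    have "\<nu> (- 1) + \<nu> (- 1) = 0"
      using mult [of "- 1" "- 1"] deg one by (simp add: mod_poly_less)
    then have "\<nu> (- 1) = 0" by simp
    then have "vge M 0 (- 1)" using deg by (simp add: vge_def aug_small)
    from vge_aug_mult [OF this that] show ?thesis by simp
  qed
  show ?thesis
    using le [of "M f" f] le [of "M (- f)" "- f"] by (cases "f = 0") (auto simp: vge_def)
qed

text \<open>The half of \<open>val_add_eq\<close> that follows from additivity and signs alone; the
  full rule presupposes \<open>ring_val\<close>, whose multiplicative part is still open for
  \<open>M\<close> at this point.\<close>

lemma aug_add_eq:
  assumes "f \<noteq> 0" "vgt M (M f) g"
  shows "M (f + g) \<le> M f"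
proof (rule ccontr)
  assume gt: "\<not> ?thesis"
  show False
  proof (cases "g = 0")
    case True
    then show False using gt by simp
  next
    case False
    with assms have g: "M f < M g" by (simp add: vgt_def)
    let ?\<beta> = "min (M (f + g)) (M g)"
    have "vge M ?\<beta> (f + g)" "vge M ?\<beta> (- g)"
      by (simp_all add: vge_def aug_uminus)
    from vge_aug_add [OF this] assms have "?\<beta> \<le> M f" by (simp add: vge_def)
    with gt g show False by (auto simp: min_le_iff_disj)
  qed
qed

text \<open>If the constant coefficients of both factors attain the minimum, then by
  \<open>mult\<close> so does the constant coefficient of the product. Otherwise one factor has a
  negligible constant coefficient and may be replaced by \<open>\<phi>\<close> times its quotient,
  which lowers the degree.\<close>

lemma aug_mult_le: "f \<noteq> 0 \<Longrightarrow> g \<noteq> 0 \<Longrightarrow> M (f * g) \<le> M f + M g"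
proof (induction "degree f + degree g" arbitrary: f g rule: less_induct)
  case less
  \<comment> \<open>Formulated with the induction hypothesis as an assumption, so that by
    commutativity it serves for either factor.\<close>
  have step: "M (f * g) \<le> M f + M g"
    if f: "f \<noteq> 0" and g: "g \<noteq> 0" and a: "\<not> (f mod \<phi> \<noteq> 0 \<and> \<nu> (f mod \<phi>) = M f)"
      and IH: "f div \<phi> \<noteq> 0 \<Longrightarrow> M ((f div \<phi>) * g) \<le> M (f div \<phi>) + M g" for f g
  proof -
    have vf: "vge M (M f) f" by (simp add: vge_def)
    have da: "degree (f mod \<phi>) < degree \<phi>" using deg degree_expc [of \<phi> f 0] by (simp add: expc_0)
    have ga: "f mod \<phi> = 0 \<or> M f < M (f mod \<phi>)"
      using vf a vge_aug_rec [of "M f" f] aug_small [OF da]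
      by (cases "f mod \<phi> = 0") (auto simp: vge_def)
    have q: "f div \<phi> \<noteq> 0"
    proof
      assume q0: "f div \<phi> = 0"
      then have "f mod \<phi> = f" using div_mult_mod_eq [of f \<phi>] by simp
      with ga f show False by auto
    qed
    have "vge M (M (f mod \<phi>)) (f mod \<phi>)" "vge M (M g) g" by (simp_all add: vge_def)
    from vge_aug_mult [OF this] have vag: "vgt M (M f + M g) (f mod \<phi> * g)"
      using ga order_less_le_trans [OF add_strict_right_mono [of "M f" "M (f mod \<phi>)" "M g"]]
      by (auto simp: vge_def vgt_def)
    have Mq: "M f = \<gamma> + M (f div \<phi>)"
    proof (rule order_antisym)
      show "M f \<le> \<gamma> + M (f div \<phi>)"
        using vf q vge_aug_rec [of "M f" f] by (simp add: vge_def diff_le_eq add.commute)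
      have nz: "\<phi> * (f div \<phi>) \<noteq> 0" using q phi_nz by simp
      show "\<gamma> + M (f div \<phi>) \<le> M f"
      proof (rule ccontr)
        assume gt: "\<not> \<gamma> + M (f div \<phi>) \<le> M f"
        \<comment> \<open>\<open>\<beta>\<close> bounds the remainder and the shifted quotient from
          below, hence also \<open>M f\<close>; but under the negated claim it exceeds
          \<open>M f\<close>.\<close>
        define \<beta> where
          "\<beta> = (if f mod \<phi> = 0 then \<gamma> + M (f div \<phi>) else min (\<gamma> + M (f div \<phi>)) (M (f mod \<phi>)))"
        have "vge \<nu> \<beta> (f mod \<phi>)"
          unfolding vge_aug_small [OF da, symmetric] by (simp add: vge_def \<beta>_def)
        moreover have "vge M (\<beta> - \<gamma>) (f div \<phi>)"
          by (simp add: vge_def \<beta>_def diff_le_eq add.commute min_le_iff_disj)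
        ultimately have "\<beta> \<le> M f"
          using vge_aug_rec [of \<beta> f] f by (simp add: vge_def)
        moreover have "M f < \<beta>" using gt ga by (auto simp: \<beta>_def)
        ultimately show False by simp
      qed
    qed
    have "M (\<phi> * ((f div \<phi>) * g)) = \<gamma> + M ((f div \<phi>) * g)"
      using q g by (intro aug_phi_mult) simp
    also have "\<dots> = M f + M g"
      using IH [OF q] vge_aug_mult [of "M (f div \<phi>)" "f div \<phi>" "M g" g] q g Mq
      by (simp add: vge_def add.assoc)
    finally have "M (\<phi> * ((f div \<phi>) * g)) = M f + M g" .
    moreover have "\<phi> * ((f div \<phi>) * g) \<noteq> 0" using q g phi_nz by simp
    ultimately have "M (\<phi> * ((f div \<phi>) * g) + f mod \<phi> * g) \<le> M f + M g"
      using aug_add_eq [of "\<phi> * ((f div \<phi>) * g)" "f mod \<phi> * g"] vag by simp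
    moreover have "\<phi> * ((f div \<phi>) * g) + f mod \<phi> * g = f * g"
      using mult_div_mod_eq [of \<phi> f] by (metis distrib_right mult.assoc)
    ultimately show ?thesis by simp
  qed
  let ?P = "\<lambda>f. f mod \<phi> \<noteq> 0 \<and> \<nu> (f mod \<phi>) = M f"
  consider "\<not> ?P f" | "\<not> ?P g" | "?P f \<and> ?P g" by argo
  then show ?case
  proof cases
    case 1
    show ?thesis
    proof (rule step [OF less.prems 1])
      assume q: "f div \<phi> \<noteq> 0"
      show "M (f div \<phi> * g) \<le> M (f div \<phi>) + M g"
        by (rule less.hyps) (use degree_div_less [OF deg q] q less.prems in auto)
    qed
  next
    case 2
    have "M (g * f) \<le> M g + M f"
    proof (rule step [OF less.prems(2,1) 2])
      assume q: "g div \<phi> \<noteq> 0"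
      show "M (g div \<phi> * f) \<le> M (g div \<phi>) + M f"
        by (rule less.hyps) (use degree_div_less [OF deg q] q less.prems in auto)
    qed
    then show ?thesis by (simp add: mult.commute add.commute)
  next
    case 3
    have "f * g mod \<phi> \<noteq> 0 \<and> \<nu> (f * g mod \<phi>) = \<nu> (f mod \<phi>) + \<nu> (g mod \<phi>)"
      using mult [of "f mod \<phi>" "g mod \<phi>"] 3 deg degree_expc [of \<phi> f 0] degree_expc [of \<phi> g 0]
      by (simp add: expc_0 mod_mult_eq)
    then show ?thesis using aug_le [of "f * g" 0] 3 by (simp add: expc_0)
  qed
qed

lemma ring_val_aug: "ring_val M"
  unfolding ring_val_def
proof (intro conjI allI impI)
  fix a b :: "'k poly"
  assume nz: "a \<noteq> 0" "b \<noteq> 0"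
  then have "M a + M b \<le> M (a * b)"
    using vge_aug_mult [of "M a" a "M b" b] by (simp add: vge_def)
  with aug_mult_le [OF nz] show "M (a * b) = M a + M b" by simp
next
  fix a b :: "'k poly"
  assume "a \<noteq> 0" "b \<noteq> 0" "a + b \<noteq> 0"
  then show "min (M a) (M b) \<le> M (a + b)"
    using vge_aug_add [of "min (M a) (M b)" a b] by (simp add: vge_def)
qed

lemma aug_phi: "M \<phi> = \<gamma>"
  using aug_phi_mult [of 1] val_1 [OF ring_val_aug] by simp

text \<open>Euclidean descent modulo \<open>\<phi>\<close>, with \<open>mult\<close> in the role of
  irreducibility: if \<open>a\<close> had positive degree and divided \<open>\<phi>\<close>, then
  \<open>a\<close> and its cofactor would be small polynomials whose product vanishes modulo
  \<open>\<phi>\<close>.\<close>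

lemma small_inverse_mod:
  assumes "a \<noteq> 0" "degree a < degree \<phi>"
  shows "\<exists>b. a * b mod \<phi> = 1"
  using assms
proof (induction "degree a" arbitrary: a rule: less_induct)
  case less
  show ?case
  proof (cases "degree a = 0")
    case True
    then obtain c where c: "a = [:c:]" by (metis degree_eq_zeroE)
    with less.prems have "a * [:inverse c:] = 1" by (simp add: pCons_one)
    then show ?thesis using deg by (metis degree_1 mod_poly_less)
  next
    case False
    let ?q = "\<phi> div a" and ?r = "\<phi> mod a"
    have dr: "degree ?r < degree a" using False by (metis degree_0 degree_mod_less' gr0I less.prems(1))
    have "?r \<noteq> 0"
    proof
      assume r: "?r = 0"
      then have \<phi>: "\<phi> = a * ?q" using mult_div_mod_eq [of a \<phi>] by simp
      then have q: "?q \<noteq> 0" using phi_nz by auto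
      have "degree \<phi> = degree a + degree ?q"
        using degree_mult_eq [OF less.prems(1) q] \<phi> by simp
      then have "a * ?q mod \<phi> \<noteq> 0" using False less.prems q mult [of a ?q] by simp
      then show False by (simp add: \<phi> [symmetric])
    qed
    then obtain b where b: "?r * b mod \<phi> = 1"
      using less.hyps [OF dr] dr less.prems by auto
    have "r * b = a * (- q * b) + p * b" if "a * q + r = p" for p q r
      unfolding that [symmetric] by (simp add: algebra_simps)
    from this [OF mult_div_mod_eq] have "?r * b = a * (- ?q * b) + \<phi> * b" .
    then have "a * (- ?q * b) mod \<phi> = 1"
      using b by (metis mod_mult_self2)
    then show ?thesis by blast
  qed
qed

text \<open>Reduce an inverse modulo \<open>\<phi>\<close> to a small polynomial \<open>b\<close>.
  Then \<open>a * b\<close> is 1 plus a multiple of \<open>\<phi>\<close>, and \<open>carry\<close>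
  shows that this multiple has positive value.\<close>

lemma small_unit:
  assumes "a \<noteq> 0" "degree a < degree \<phi>"
  shows "mdvd M a 1"
proof -
  obtain b' where b': "a * b' mod \<phi> = 1" using small_inverse_mod [OF assms] by blast
  define b where "b = b' mod \<phi>"
  have ab: "a * b mod \<phi> = 1" unfolding b_def using b' by (simp add: mod_mult_right_eq)
  have b: "b \<noteq> 0" "degree b < degree \<phi>"
    using ab deg degree_expc [of \<phi> b' 0] by (auto simp: b_def expc_0)
  let ?d = "a * b div \<phi>"
  have "\<nu> a + \<nu> b = 0"
    using mult [OF assms(1) b(1) assms(2) b(2)] ab aug_small [of 1] deg val_1 [OF ring_val_aug] by simp
  then have d: "?d \<noteq> 0 \<Longrightarrow> 0 < \<nu> ?d + \<gamma>"
    using carry [OF assms(1) b(1) assms(2) b(2)] by simp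
  have eq: "1 - a * b = - (\<phi> * ?d)"
    using mult_div_mod_eq [of \<phi> "a * b"] unfolding ab by (simp add: algebra_simps)
  show ?thesis
  proof (cases "?d = 0")
    case True
    then show ?thesis unfolding mdvd_def using eq by auto
  next
    case False
    then have "0 < M (\<phi> * ?d)"
      using d degree_mult_div [OF assms(2) b(2)] by (simp add: aug_phi_mult aug_small add.commute)
    then have "M 1 < M (1 - a * b)"
      unfolding eq using val_1 [OF ring_val_aug] by (simp add: aug_uminus)
    then show ?thesis unfolding mdvd_def by blast
  qed
qed

end

section \<open>Key polynomials, initial forms and residue classes\<close>

context
  fixes \<mu> :: "'k::field poly \<Rightarrow> 'g::linordered_ab_group_add" and \<phi> :: "'k poly"
  assumes val: "ring_val \<mu>" and key: "keypoly \<mu> \<phi>"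
begin

lemma keypoly_degree: "0 < degree \<phi>"
proof (rule ccontr)
  assume "\<not> ?thesis"
  then obtain c where "\<phi> = [:c:]" by (metis degree_eq_zeroE gr0I)
  moreover from this key have "c = 1" by (auto simp: keypoly_def split: if_splits)
  ultimately have "\<phi> = 1" by (simp add: pCons_one)
  moreover have "mdvd \<mu> 1 1" unfolding mdvd_def by (rule disjI2, rule exI [of _ 1]) simp
  ultimately show False using key by (simp add: keypoly_def)
qed

lemma keypoly_not_mdvd_small: "f \<noteq> 0 \<Longrightarrow> degree f < degree \<phi> \<Longrightarrow> \<not> mdvd \<mu> \<phi> f"
  using key by (simp add: keypoly_def)

lemma degree_mod_keypoly: "degree (f mod \<phi>) < degree \<phi>"
  using degree_expc [OF keypoly_degree, of f 0] by (simp add: expc_0)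

text \<open>Were the value of the remainder below \<open>\<alpha>\<close>, the initial forms of
  \<open>f mod \<phi>\<close> and of \<open>- (\<phi> * (f div \<phi>))\<close> would coincide, so
  \<open>\<phi>\<close> would divide a non-zero polynomial of smaller degree in the graded
  sense.\<close>

lemma keypoly_vge_mod:
  assumes "vge \<mu> \<alpha> f"
  shows "vge \<mu> \<alpha> (f mod \<phi>)" "vge \<mu> \<alpha> (\<phi> * (f div \<phi>))"
proof -
  show 1: "vge \<mu> \<alpha> (f mod \<phi>)"
  proof (rule ccontr)
    assume "\<not> ?thesis"
    then have nz: "f mod \<phi> \<noteq> 0" and lt: "\<mu> (f mod \<phi>) < \<alpha>" by (auto simp: vge_def)
    have "f mod \<phi> - \<phi> * (- (f div \<phi>)) = 0 \<or>
      \<mu> (f mod \<phi>) < \<mu> (f mod \<phi> - \<phi> * (- (f div \<phi>)))"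
      using assms lt by (auto simp: vge_def)
    then have "mdvd \<mu> \<phi> (f mod \<phi>)" unfolding mdvd_def by blast
    then show False using keypoly_not_mdvd_small [OF nz degree_mod_keypoly] by blast
  qed
  have "\<phi> * (f div \<phi>) = f - f mod \<phi>" by (simp add: minus_mod_eq_mult_div)
  then show "vge \<mu> \<alpha> (\<phi> * (f div \<phi>))" using vge_diff [OF val assms 1] by simp
qed

text \<open>With \<open>f div \<phi>\<close> as cofactor, non-divisibility says that the remainder
  does not lie strictly above \<open>f\<close>; \<open>keypoly_vge_mod\<close> says that it does not
  lie below.\<close>

lemma not_mdvd_mod:
  assumes "\<not> mdvd \<mu> \<phi> f"
  shows "f mod \<phi> \<noteq> 0" "\<mu> (f mod \<phi>) = \<mu> f"
proof -
  have eq: "f - \<phi> * (f div \<phi>) = f mod \<phi>" by (simp add: minus_mult_div_eq_mod)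
  have *: "f mod \<phi> \<noteq> 0 \<and> \<not> \<mu> f < \<mu> (f mod \<phi>)"
    using assms eq unfolding mdvd_def by metis
  moreover have "vge \<mu> (\<mu> f) (f mod \<phi>)"
    by (rule keypoly_vge_mod) (simp add: vge_def)
  ultimately show "f mod \<phi> \<noteq> 0" "\<mu> (f mod \<phi>) = \<mu> f" by (auto simp: vge_def)
qed

context
  fixes \<gamma> :: 'g
  assumes gt: "\<mu> \<phi> < \<gamma>"
begin

text \<open>\<open>mult\<close> combines primality and minimality of the initial form of
  \<open>\<phi>\<close>. \<open>carry\<close> is the inequality of \<open>keypoly_vge_mod\<close>
  made strict by \<open>\<mu> \<phi> < \<gamma>\<close>.\<close>

lemma augmentation_keypoly: "augmentation \<mu> \<phi> \<gamma>"
proof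
  show "0 < degree \<phi>" by (rule keypoly_degree)
next
  fix a b :: "'k poly"
  assume "a \<noteq> 0" "b \<noteq> 0" "a + b \<noteq> 0"
  then show "min (\<mu> a) (\<mu> b) \<le> \<mu> (a + b)" by (rule val_add [OF val])
next
  fix a b :: "'k poly"
  assume ab: "a \<noteq> 0" "b \<noteq> 0" "degree a < degree \<phi>" "degree b < degree \<phi>"
  then have "\<not> mdvd \<mu> \<phi> (a * b)"
    using key keypoly_not_mdvd_small unfolding keypoly_def by blast
  from not_mdvd_mod [OF this] ab
  show "a * b mod \<phi> \<noteq> 0 \<and> \<mu> (a * b mod \<phi>) = \<mu> a + \<mu> b" by (simp add: val_mult [OF val])
next
  fix a b :: "'k poly"
  assume ab: "a \<noteq> 0" "b \<noteq> 0" and d: "a * b div \<phi> \<noteq> 0"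
  have \<phi>: "\<phi> \<noteq> 0" using keypoly_degree by auto
  have "vge \<mu> (\<mu> (a * b)) (\<phi> * (a * b div \<phi>))"
    by (rule keypoly_vge_mod) (simp add: vge_def)
  then have "\<mu> a + \<mu> b \<le> \<mu> \<phi> + \<mu> (a * b div \<phi>)"
    using ab d \<phi> by (simp add: vge_def val_mult [OF val])
  also have "\<dots> < \<gamma> + \<mu> (a * b div \<phi>)" using gt by simp
  finally show "\<mu> a + \<mu> b < \<mu> (a * b div \<phi>) + \<gamma>" by (simp add: add.commute)
qed

interpretation augmentation \<mu> \<phi> \<gamma> by (rule augmentation_keypoly)

lemma vge_aug_keypoly: "vge \<mu> \<alpha> f \<Longrightarrow> vge (aug \<mu> \<phi> \<gamma>) \<alpha> f"
proof (induction "degree f" arbitrary: f \<alpha> rule: less_induct)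
  case less
  have "vge \<mu> (\<alpha> - \<gamma>) (f div \<phi>)"
  proof (cases "f div \<phi> = 0")
    case False
    with keypoly_vge_mod(2) [OF less.prems] have "\<alpha> \<le> \<mu> \<phi> + \<mu> (f div \<phi>)"
      using phi_nz by (simp add: vge_def val_mult [OF val])
    also have "\<dots> \<le> \<mu> (f div \<phi>) + \<gamma>" using gt by (simp add: add.commute less_imp_le)
    finally show ?thesis by (simp add: vge_def diff_le_eq)
  qed simp
  then have "vge (aug \<mu> \<phi> \<gamma>) (\<alpha> - \<gamma>) (f div \<phi>)"
    using less.hyps degree_div_less [OF deg, of f] by (cases "f div \<phi> = 0") auto
  with keypoly_vge_mod(1) [OF less.prems] show ?case by (simp add: vge_aug_rec [of _ f])
qed

lemma le_aug_keypoly: "f \<noteq> 0 \<Longrightarrow> \<mu> f \<le> aug \<mu> \<phi> \<gamma> f"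
  using vge_aug_keypoly [of "\<mu> f" f] by (simp add: vge_def)

text \<open>The augmentation raises only what is divisible by \<open>\<phi>\<close>. So the
  remainder of \<open>g\<close>, which is small and therefore invertible, dominates
  \<open>\<phi> * (g div \<phi>)\<close>, and an inverse of the remainder also inverts
  \<open>g\<close>.\<close>

lemma not_mdvd_aug:
  assumes g: "\<not> mdvd \<mu> \<phi> g"
  shows "aug \<mu> \<phi> \<gamma> g = \<mu> g" "mdvd (aug \<mu> \<phi> \<gamma>) g 1"
proof -
  let ?c = "g mod \<phi>" and ?d = "g div \<phi>"
  note c = not_mdvd_mod [OF g]
  have Mc: "M ?c = \<mu> g" using aug_small [OF degree_mod_keypoly c(1)] c(2) by simp
  have d: "vgt M (\<mu> g) (\<phi> * ?d)"
  proof (cases "?d = 0")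
    case False
    have "vge \<mu> (\<mu> g) (\<phi> * ?d)" by (rule keypoly_vge_mod) (simp add: vge_def)
    then have "\<mu> g \<le> \<mu> \<phi> + \<mu> ?d" using False phi_nz by (simp add: vge_def val_mult [OF val])
    also have "\<dots> < \<gamma> + \<mu> ?d" using gt by simp
    also have "\<dots> \<le> \<gamma> + M ?d" using le_aug_keypoly [OF False] by simp
    finally show ?thesis using False by (simp add: vgt_def aug_phi_mult)
  qed simp
  have g_eq: "g = ?c + \<phi> * ?d" by simp
  show "M g = \<mu> g"
    using val_add_eq(2) [OF ring_val_aug c(1), of "\<phi> * ?d"] d Mc by simp
  obtain b where b: "vgt M 0 (1 - ?c * b)"
    using small_unit [OF c(1) degree_mod_keypoly] val_1 [OF ring_val_aug]
    unfolding mdvd_def vgt_def by auto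
  have "vgt M 0 (- (1 - ?c * b))" using b by (simp only: vgt_uminus [OF ring_val_aug])
  then have cb: "?c * b \<noteq> 0" "M (?c * b) = 0"
    using val_add_eq [OF ring_val_aug, of 1 "- (1 - ?c * b)"] val_1 [OF ring_val_aug] by auto
  then have "M b = - \<mu> g" using val_mult [OF ring_val_aug, of ?c b] Mc by (auto simp: eq_neg_iff_add_eq_0 add.commute)
  then have "vge M (- \<mu> g) b" by (simp add: vge_def)
  from vgt_mult [OF ring_val_aug d this] have "vgt M 0 (\<phi> * ?d * b)" by simp
  from vgt_diff [OF ring_val_aug b this] have "vgt M 0 (1 - (?c + \<phi> * ?d) * b)"
    by (simp only: distrib_right diff_diff_eq)
  then have "vgt M 0 (1 - g * b)" by simp
  then show "mdvd M g 1"
    unfolding mdvd_def vgt_def using val_1 [OF ring_val_aug] by auto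
qed

end

end

section \<open>Invertible initial forms, expressed by \<open>mdvd \<mu> A 1\<close>\<close>

lemma mdvd_1_iff: "ring_val \<mu> \<Longrightarrow> mdvd \<mu> A 1 \<longleftrightarrow> (\<exists>q. vgt \<mu> 0 (1 - A * q))"
  unfolding mdvd_def vgt_def by (simp add: val_1)

lemma unit_inverse:
  assumes val: "ring_val \<mu>" and "mdvd \<mu> A 1"
  obtains B where "A \<noteq> 0" "B \<noteq> 0" "\<mu> A + \<mu> B = 0" "vgt \<mu> 0 (1 - A * B)"
proof -
  obtain B where B: "vgt \<mu> 0 (1 - A * B)" using assms mdvd_1_iff by blast
  then have "vgt \<mu> 0 (- (1 - A * B))" by (simp only: vgt_uminus [OF val])
  then have "A * B \<noteq> 0" "\<mu> (A * B) = 0"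
    using val_add_eq [OF val, of 1 "- (1 - A * B)"] val_1 [OF val] by auto
  with B that val_mult [OF val] show ?thesis by auto
qed

lemma unit_nz: "ring_val \<mu> \<Longrightarrow> mdvd \<mu> A 1 \<Longrightarrow> A \<noteq> 0"
  by (metis unit_inverse)

lemma unit_mult:
  assumes val: "ring_val \<mu>" and A: "mdvd \<mu> A 1" and B: "mdvd \<mu> B 1"
  shows "mdvd \<mu> (A * B) 1"
proof -
  obtain A' where A': "A \<noteq> 0" "A' \<noteq> 0" "\<mu> A + \<mu> A' = 0" "vgt \<mu> 0 (1 - A * A')"
    using unit_inverse [OF val A] .
  obtain B' where B': "vgt \<mu> 0 (1 - B * B')" using unit_inverse [OF val B] .
  have "vge \<mu> 0 (A * A')" using A' by (simp add: vge_def val_mult [OF val])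
  from vgt_mult [OF val B' this] have "vgt \<mu> 0 ((1 - B * B') * (A * A'))" by simp
  from vgt_add [OF val A'(4) this] have "vgt \<mu> 0 (1 - A * B * (A' * B'))"
    by (simp add: algebra_simps)
  then show ?thesis using mdvd_1_iff [OF val] by blast
qed

text \<open>An inverse \<open>B\<close> for the smaller valuation remains one for the larger. Both
  value sums of \<open>A\<close> and \<open>B\<close> are then 0, while neither summand can drop, so
  no value changes.\<close>

lemma unit_mono:
  assumes val: "ring_val \<mu>" "ring_val \<mu>'" and le: "\<And>f. f \<noteq> 0 \<Longrightarrow> \<mu> f \<le> \<mu>' f"
    and A: "mdvd \<mu> A 1"
  shows "mdvd \<mu>' A 1" "\<mu>' A = \<mu> A"
proof -
  obtain B where B: "A \<noteq> 0" "B \<noteq> 0" "\<mu> A + \<mu> B = 0" "vgt \<mu> 0 (1 - A * B)"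
    using unit_inverse [OF val(1) A] .
  then have gt: "vgt \<mu>' 0 (1 - A * B)" using le by (auto simp: vgt_def intro: order_less_le_trans)
  then show "mdvd \<mu>' A 1" using mdvd_1_iff [OF val(2)] by blast
  have "vgt \<mu>' 0 (- (1 - A * B))" using gt by (simp only: vgt_uminus [OF val(2)])
  then have "\<mu>' (A * B) = 0"
    using val_add_eq [OF val(2), of 1 "- (1 - A * B)"] val_1 [OF val(2)] by auto
  then have "\<mu>' A + \<mu>' B = 0" using B by (simp add: val_mult [OF val(2)])
  moreover have "\<mu>' A + \<mu> B \<le> \<mu>' A + \<mu>' B" using le [OF B(2)] by simp
  ultimately have "\<mu>' A + \<mu> B \<le> \<mu> A + \<mu> B" using B(3) by simp
  then show "\<mu>' A = \<mu> A" using le [OF B(1)] by simp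
qed

section \<open>Extension of a valuation to the fraction field\<close>

lemma muF_Fract:
  assumes val: "ring_val \<mu>" and ab: "a \<noteq> 0" "b \<noteq> 0"
  shows "muF \<mu> (Fract a b) = \<mu> a - \<mu> b"
  unfolding muF_def
proof (rule the_equality)
  show "\<exists>aa ba. aa \<noteq> 0 \<and> ba \<noteq> 0 \<and> Fract a b = Fract aa ba \<and> \<mu> a - \<mu> b = \<mu> aa - \<mu> ba"
    using ab by blast
next
  fix w assume "\<exists>c d. c \<noteq> 0 \<and> d \<noteq> 0 \<and> Fract a b = Fract c d \<and> w = \<mu> c - \<mu> d"
  then obtain c d where cd: "c \<noteq> 0" "d \<noteq> 0" "Fract a b = Fract c d" "w = \<mu> c - \<mu> d" by blast
  then have "a * d = c * b" using ab by (simp add: eq_fract)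
  then have "\<mu> a + \<mu> d = \<mu> c + \<mu> b" using ab cd by (metis val_mult [OF val])
  then show "w = \<mu> a - \<mu> b" unfolding cd(4) by (simp add: diff_eq_eq diff_add_eq)
qed

lemma vge_Fract:
  assumes "ring_val \<mu>" "b \<noteq> 0"
  shows "vge (muF \<mu>) \<alpha> (Fract a b) \<longleftrightarrow> vge \<mu> (\<alpha> + \<mu> b) a"
    and "vgt (muF \<mu>) \<alpha> (Fract a b) \<longleftrightarrow> vgt \<mu> (\<alpha> + \<mu> b) a"
  using assms by (cases "a = 0"; simp add: vge_def vgt_def muF_Fract le_diff_eq less_diff_eq eq_fract Zero_fract_def)+

lemma ring_val_muF:
  assumes val: "ring_val \<mu>"
  shows "ring_val (muF \<mu>)"
  unfolding ring_val_def
proof (intro conjI allI impI)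
  fix p q :: "'a poly fract"
  assume nz: "p \<noteq> 0" "q \<noteq> 0"
  obtain a b where p: "p = Fract a b" "b \<noteq> 0" by (cases p)
  obtain c d where q: "q = Fract c d" "d \<noteq> 0" by (cases q)
  have ac: "a \<noteq> 0" "c \<noteq> 0" using nz p q by (auto simp: Zero_fract_def eq_fract)
  show "muF \<mu> (p * q) = muF \<mu> p + muF \<mu> q"
    unfolding p q using p q ac by (simp add: muF_Fract [OF val] val_mult [OF val])
next
  fix p q :: "'a poly fract"
  assume nz: "p \<noteq> 0" "q \<noteq> 0" "p + q \<noteq> 0"
  obtain a b where p: "p = Fract a b" "b \<noteq> 0" by (cases p)
  obtain c d where q: "q = Fract c d" "d \<noteq> 0" by (cases q)
  define m where "m = min (muF \<mu> p) (muF \<mu> q)"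
  have "vge (muF \<mu>) m (Fract a b)" "vge (muF \<mu>) m (Fract c d)"
    unfolding p(1) [symmetric] q(1) [symmetric] by (simp_all add: m_def vge_def)
  then have "vge \<mu> (m + \<mu> b) a" "vge \<mu> (m + \<mu> d) c"
    using p q vge_Fract [OF val] by blast+
  moreover have "vge \<mu> (\<mu> d) d" "vge \<mu> (\<mu> b) b" by (simp_all add: vge_def)
  ultimately have "vge \<mu> (m + \<mu> b + \<mu> d) (a * d)" "vge \<mu> (m + \<mu> d + \<mu> b) (c * b)"
    using vge_mult [OF val] by blast+
  then have "vge \<mu> (m + \<mu> (b * d)) (a * d + c * b)"
    using p q by (intro vge_add [OF val]) (simp_all add: val_mult [OF val] add.assoc add.left_commute add.commute)
  then have "vge (muF \<mu>) m (p + q)"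
    using p q vge_Fract [OF val, of "b * d"] by simp
  then show "min (muF \<mu> p) (muF \<mu> q) \<le> muF \<mu> (p + q)"
    using nz by (simp add: vge_def m_def)
qed

lemma val_power_int:
  fixes w :: "'a::field \<Rightarrow> 'g::linordered_ab_group_add"
  assumes val: "ring_val w" and x: "x \<noteq> 0"
  shows "w (x powi k) = gmul k (w x)"
proof -
  have inv: "w (inverse y) = - w y" if "y \<noteq> 0" for y
    using val_mult [OF val, of y "inverse y"] that val_1 [OF val] by (simp add: eq_neg_iff_add_eq_0 add.commute)
  show ?thesis
  proof (cases "0 \<le> k")
    case True
    then show ?thesis using val_power [OF val x, of "nat k"] by (simp add: power_int_def)
  next
    case False
    then have "w (x powi k) = - gmul (- k) (w x)"
      using val_power [OF val x, of "nat (- k)"] inv [of "x ^ nat (- k)"] x by (simp add: power_int_def power_inverse)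
    then show ?thesis by (simp add: gmul_minus)
  qed
qed

lemma val_prod:
  assumes val: "ring_val w" and "\<And>i. i \<in> A \<Longrightarrow> f i \<noteq> 0"
  shows "w (\<Prod>i\<in>A. f i) = (\<Sum>i\<in>A. w (f i))"
  using assms(2)
  by (induction A rule: infinite_finite_induct) (simp_all add: val_1 [OF val] val_mult [OF val])

text \<open>This and the next congruence rules make the classes produced by \<open>cmul\<close>,
  \<open>cpowi\<close> and \<open>Reval\<close> independent of the representatives that
  \<open>crep\<close> picks.\<close>

lemma vgt_diff_mult:
  assumes val: "ring_val w" and "vge w 0 a" "vge w 0 b'" "vgt w 0 (a - a')" "vgt w 0 (b - b')"
  shows "vgt w 0 (a * b - a' * b')"
proof -
  have "a * b - a' * b' = (b - b') * a + (a - a') * b'" by (simp add: algebra_simps)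
  then show ?thesis
    using vgt_add [OF val vgt_mult [OF val assms(5,2)] vgt_mult [OF val assms(4,3)]] by simp
qed

lemma vge_power:
  assumes "ring_val w" "vge w 0 a"
  shows "vge w 0 (a ^ n)"
proof (induction n)
  case 0
  then show ?case using assms by (simp add: vge_def val_1)
next
  case (Suc n)
  from vge_mult [OF assms(1) assms(2) Suc] show ?case by simp
qed

lemma vgt_diff_power:
  assumes val: "ring_val w" and "vge w 0 a" "vge w 0 b" "vgt w 0 (a - b)"
  shows "vgt w 0 (a ^ n - b ^ n)"
proof (induction n)
  case (Suc n)
  show ?case unfolding power_Suc
    by (rule vgt_diff_mult [OF val]) (use Suc assms vge_power [OF val] in auto)
qed simp

lemma vgt_diff_inverse:
  fixes a b :: "'a::field"
  assumes val: "ring_val w" and "a \<noteq> 0" "b \<noteq> 0" "w a = 0" "w b = 0" "vgt w 0 (a - b)"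
  shows "vgt w 0 (inverse a - inverse b)"
proof -
  have "w (inverse c) = 0" if "c \<noteq> 0" "w c = 0" for c
    using val_power_int [OF val that(1), of "-1"] that by (simp add: gmul_minus power_int_minus)
  then have "vge w 0 (- (inverse a * inverse b))"
    using assms by (simp add: vge_def val_mult [OF val] val_uminus [OF val])
  from vgt_mult [OF val assms(6) this] have "vgt w 0 ((a - b) * - (inverse a * inverse b))" by (simp only: add_0)
  moreover have "(a - b) * - (inverse a * inverse b) = inverse a - inverse b"
    using assms by (simp add: field_simps)
  ultimately show ?thesis by (simp only:)
qed

lemma vgt_diff_power_int:
  fixes a b :: "'a::field"
  assumes val: "ring_val w" and "a \<noteq> 0" "b \<noteq> 0" "w a = 0" "w b = 0" "vgt w 0 (a - b)"
  shows "vgt w 0 (a powi n - b powi n)"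
proof (cases "0 \<le> n")
  case True
  then show ?thesis using assms vgt_diff_power [OF val, of a b "nat n"] by (simp add: power_int_def vge_def)
next
  case False
  have "w (inverse c) = 0" if "c \<noteq> 0" "w c = 0" for c
    using val_power_int [OF val that(1), of "-1"] that by (simp add: gmul_minus power_int_minus)
  with False show ?thesis
    using assms vgt_diff_power [OF val, of "inverse a" "inverse b" "nat (- n)"] vgt_diff_inverse [OF assms]
    by (simp add: power_int_def vge_def)
qed

section \<open>Residue classes and their representatives\<close>

lemma mem_cls: "q' \<in> cls \<mu> q \<longleftrightarrow> vgt (muF \<mu>) 0 (q' - q)"
  by (auto simp: cls_def vgt_def)

lemma cls_eq_iff:
  assumes "ring_val \<mu>"
  shows "cls \<mu> q = cls \<mu> q' \<longleftrightarrow> vgt (muF \<mu>) 0 (q - q')"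
proof
  assume "cls \<mu> q = cls \<mu> q'"
  moreover have "q \<in> cls \<mu> q" by (simp add: mem_cls)
  ultimately show "vgt (muF \<mu>) 0 (q - q')" using mem_cls by blast
next
  note val = ring_val_muF [OF assms]
  assume *: "vgt (muF \<mu>) 0 (q - q')"
  have "vgt (muF \<mu>) 0 (x - q) \<longleftrightarrow> vgt (muF \<mu>) 0 (x - q')" for x
    using vgt_add [OF val _ *, of "x - q"] vgt_diff [OF val _ *, of "x - q'"] by auto
  then show "cls \<mu> q = cls \<mu> q'" by (auto simp: mem_cls)
qed

lemma crep_cls: "vgt (muF \<mu>) 0 (crep (cls \<mu> q) - q)"
proof -
  have "q \<in> cls \<mu> q" by (simp add: mem_cls)
  then have "crep (cls \<mu> q) \<in> cls \<mu> q" unfolding crep_def by (rule someI)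
  then show ?thesis by (simp add: mem_cls)
qed

text \<open>Quotients of polynomials whose initial forms are units of the graded algebra.\<close>
definition unit_quot :: "('k::field poly \<Rightarrow> 'g::linordered_ab_group_add) \<Rightarrow> 'k poly fract set" where
  "unit_quot \<mu> = {Fract A B | A B. mdvd \<mu> A 1 \<and> mdvd \<mu> B 1}"

context
  fixes \<mu> :: "'k::field poly \<Rightarrow> 'g::linordered_ab_group_add"
  assumes val: "ring_val \<mu>"
begin

lemma unit_1: "mdvd \<mu> 1 1"
  unfolding mdvd_def by (rule disjI2, rule exI [of _ 1]) simp

lemma unit_quot_poly: "mdvd \<mu> A 1 \<Longrightarrow> Fract A 1 \<in> unit_quot \<mu>"
  using unit_1 by (auto simp: unit_quot_def)

lemma unit_quot_nz: "q \<in> unit_quot \<mu> \<Longrightarrow> q \<noteq> 0"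
  using unit_nz [OF val] by (auto simp: unit_quot_def Zero_fract_def eq_fract)

lemma unit_quot_1: "1 \<in> unit_quot \<mu>"
  using unit_quot_poly [OF unit_1] by (simp add: One_fract_def)

lemma unit_quot_mult: "p \<in> unit_quot \<mu> \<Longrightarrow> q \<in> unit_quot \<mu> \<Longrightarrow> p * q \<in> unit_quot \<mu>"
  unfolding unit_quot_def using unit_mult [OF val] by (auto, blast)

lemma unit_quot_inverse: "p \<in> unit_quot \<mu> \<Longrightarrow> inverse p \<in> unit_quot \<mu>"
  unfolding unit_quot_def by (auto, blast)

lemma unit_quot_power: "p \<in> unit_quot \<mu> \<Longrightarrow> p ^ n \<in> unit_quot \<mu>"
  by (induction n) (auto intro: unit_quot_mult unit_quot_1)

lemma unit_quot_power_int: "p \<in> unit_quot \<mu> \<Longrightarrow> p powi n \<in> unit_quot \<mu>"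
  unfolding power_int_def by (auto intro: unit_quot_power unit_quot_inverse)

lemma unit_quot_prod: "(\<And>i. i \<in> A \<Longrightarrow> f i \<in> unit_quot \<mu>) \<Longrightarrow> (\<Prod>i\<in>A. f i) \<in> unit_quot \<mu>"
  by (induction A rule: infinite_finite_induct) (auto intro: unit_quot_mult unit_quot_1)

end

context
  fixes \<mu> \<mu>' :: "'k::field poly \<Rightarrow> 'g::linordered_ab_group_add"
  assumes val: "ring_val \<mu>" and val': "ring_val \<mu>'" and le: "\<And>f. f \<noteq> 0 \<Longrightarrow> \<mu> f \<le> \<mu>' f"
begin

lemma unit_quot_mono:
  assumes "q \<in> unit_quot \<mu>"
  shows "q \<in> unit_quot \<mu>'" "muF \<mu>' q = muF \<mu> q"
proof -
  obtain A B where q: "q = Fract A B" "mdvd \<mu> A 1" "mdvd \<mu> B 1"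
    using assms by (auto simp: unit_quot_def)
  note A = unit_mono [OF val val' le q(2)] and B = unit_mono [OF val val' le q(3)]
  from A B show "q \<in> unit_quot \<mu>'" unfolding q(1) unit_quot_def by auto
  show "muF \<mu>' q = muF \<mu> q"
    using A B q unit_nz [OF val] by (simp add: muF_Fract [OF val] muF_Fract [OF val'])
qed

text \<open>A non-zero polynomial in the class of 0 has positive value and is no admissible
  representative, so \<open>canon\<close> takes its default.\<close>

lemma canon_zero: "canon \<mu> \<mu>' (cls \<mu> 0) = cls \<mu>' 0"
proof -
  have "\<not> (f \<noteq> 0 \<and> \<mu> f = 0 \<and> \<mu>' f = 0 \<and> cls \<mu> 0 = cls \<mu> (Fract f 1))" for f
  proof
    assume *: "f \<noteq> 0 \<and> \<mu> f = 0 \<and> \<mu>' f = 0 \<and> cls \<mu> 0 = cls \<mu> (Fract f 1)"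
    then have "vgt (muF \<mu>) 0 (Fract f 1 - 0)" using cls_eq_iff [OF val] by metis
    then show False using * vge_Fract(2) [OF val, of 1 0 f] val_1 [OF val] by (simp add: vgt_def)
  qed
  then show ?thesis unfolding canon_def Let_def by auto
qed

text \<open>A polynomial representative of the class of \<open>g u\<close> arises by replacing the denominator of \<open>u\<close> by an
  inverse of its initial form.\<close>
lemma canon_cls:
  assumes g: "g \<noteq> 0" "\<mu>' g = \<mu> g" and u: "u \<in> unit_quot \<mu>" and 0: "muF \<mu> (Fract g 1 * u) = 0"
  shows "canon \<mu> \<mu>' (cls \<mu> (Fract g 1 * u)) = cls \<mu>' (Fract g 1 * u)"
proof -
  obtain A B where AB: "u = Fract A B" "mdvd \<mu> A 1" "mdvd \<mu> B 1"
    using u by (auto simp: unit_quot_def)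
  have nz: "A \<noteq> 0" "B \<noteq> 0" using AB unit_nz [OF val] by auto
  have q: "Fract g 1 * u = Fract (g * A) B" by (simp add: AB)
  have A': "\<mu>' A = \<mu> A" and B': "\<mu>' B = \<mu> B" using unit_mono(2) [OF val val' le] AB by blast+
  have AB0: "\<mu> g + \<mu> A = \<mu> B"
    using 0 nz g unfolding q by (simp add: muF_Fract [OF val] val_mult [OF val])
  define P where "P = (\<lambda>f. f \<noteq> 0 \<and> \<mu> f = 0 \<and> \<mu>' f = 0 \<and> cls \<mu> (Fract g 1 * u) = cls \<mu> (Fract f 1))"
  have eq: "Fract (g * A) B - Fract f 1 = Fract (g * A - f * B) B" for f using nz by simp
  have "\<exists>f. P f"
  proof -
    obtain D where D: "D \<noteq> 0" "\<mu> B + \<mu> D = 0" "vgt \<mu> 0 (1 - B * D)" using unit_inverse [OF val AB(3)] .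
    have "mdvd \<mu> D 1" unfolding mdvd_1_iff [OF val] using D(3) by (auto simp: mult.commute)
    then have D': "\<mu>' D = \<mu> D" using unit_mono(2) [OF val val' le] by blast
    have "vge \<mu> (\<mu> B) (g * A)" using nz g AB0 by (simp add: vge_def val_mult [OF val])
    from vgt_mult [OF val D(3) this] have "vgt \<mu> (\<mu> B) (g * A - g * A * D * B)"
      by (simp add: algebra_simps)
    then have "cls \<mu> (Fract g 1 * u) = cls \<mu> (Fract (g * A * D) 1)"
      unfolding cls_eq_iff [OF val] q eq using nz by (simp add: vge_Fract [OF val])
    moreover have "\<mu> (g * A * D) = 0" "\<mu>' (g * A * D) = 0"
      using nz g D D' A' AB0 by (simp_all add: val_mult [OF val] val_mult [OF val'])
    ultimately have "P (g * A * D)" using nz g D by (simp add: P_def)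
    then show ?thesis ..
  qed
  then have P: "P (SOME f. P f)" by (rule someI_ex)
  \<comment> \<open>The choice made by \<open>canon\<close> is immaterial: a difference of positive
    \<open>\<mu>\<close>-value also has positive \<open>\<mu>'\<close>-value.\<close>
  have "cls \<mu>' (Fract f 1) = cls \<mu>' (Fract g 1 * u)" if "P f" for f
  proof -
    from that have "cls \<mu> (Fract g 1 * u) = cls \<mu> (Fract f 1)" by (simp add: P_def)
    then have "vgt \<mu> (\<mu> B) (g * A - f * B)"
      unfolding cls_eq_iff [OF val] q eq using nz by (simp add: vge_Fract [OF val])
    then have "vgt \<mu>' (\<mu>' B) (g * A - f * B)"
      unfolding B' using le by (auto simp: vgt_def intro: order_less_le_trans)
    then have "cls \<mu>' (Fract g 1 * u) = cls \<mu>' (Fract f 1)"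
      unfolding cls_eq_iff [OF val'] q eq using nz by (simp add: vge_Fract [OF val'])
    then show ?thesis ..
  qed
  from this [OF P] \<open>\<exists>f. P f\<close> show ?thesis
    unfolding canon_def Let_def P_def by simp
qed

end

section \<open>The integers entering the change of basis\<close>

lemma power_int_add_nz: "x \<noteq> 0 \<Longrightarrow> x powi (m + n) = x powi m * x powi n" for x :: "'a::field"
  by (simp add: power_int_add)

lemma prod_power_int: "(\<Prod>i\<in>A. f i) powi k = (\<Prod>i\<in>A. f i powi k)" for f :: "'b \<Rightarrow> 'a::field"
  by (induction A rule: infinite_finite_induct) (simp_all add: power_int_mult_distrib)

text \<open>For \<open>\<phi> = \<phi>\<^sub>i\<close> and \<open>p\<^sub>j = \<pi>\<^sub>i\<^sub>,\<^sub>j\<close> one has \<open>P\<^sub>j = \<pi>\<^sub>i\<^sub>+\<^sub>1\<^sub>,\<^sub>j\<close>, and the elements \<open>W\<^sub>j\<close> interpolate between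
  \<open>W\<^sub>1 = \<phi>\<close> and \<open>W\<^sub>n\<^sub>+\<^sub>1 = Y\<^sub>i\<close>. The pair \<open>(W\<^sub>j, p\<^sub>j)\<close> is carried to \<open>(P\<^sub>j, W\<^sub>j\<^sub>+\<^sub>1)\<close> by an integer matrix of
  determinant \<open>-1\<close>.\<close>
definition Wel :: "(nat \<Rightarrow> int) \<Rightarrow> (nat \<Rightarrow> int) \<Rightarrow> 'f::field \<Rightarrow> (nat \<Rightarrow> 'f) \<Rightarrow> nat \<Rightarrow> 'f" where
  "Wel E H \<phi> p j = \<phi> powi epr E j * (\<Prod>t\<in>{1..<j}. p t powi (- (epr E j * H t div E t)))"

definition Pel :: "(nat \<Rightarrow> int) \<Rightarrow> (nat \<Rightarrow> int) \<Rightarrow> 'f::field \<Rightarrow> (nat \<Rightarrow> 'f) \<Rightarrow> nat \<Rightarrow> 'f" where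
  "Pel E H \<phi> p j = \<phi> powi (ell H E j * epr E j) *
     (\<Prod>t\<in>{1..<j}. p t powi ((- (ell H E j * epr E j * H t)) div E t)) * p j powi ell' H E j"

context
  fixes E :: "nat \<Rightarrow> int"
  assumes E: "\<And>t. 0 < E t"
begin

lemma dd_pos: "0 < dd E j"
  using E [of j] by (simp add: dd_def)

lemma dd_dvd: "dd E j dvd E j" "dd E j dvd epr E j"
  by (simp_all add: dd_def)

text \<open>The division in the definition of \<open>epr\<close> is exact. The induction works
  because passing to the next index inserts the exact quotient of \<open>E k\<close> by
  \<open>dd E k\<close>.\<close>

lemma Dp_mult_epr: "1 \<le> j \<Longrightarrow> 0 < Dp E j \<and> Dp E j * epr E j = (\<Prod>t\<in>{1..<j}. E t)"
proof (induction j rule: nat_induct_at_least)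
  case base
  then show ?case by (simp add: epr_def)
next
  case (Suc k)
  have D: "Dp E (Suc k) = Dp E k * dd E k" using Suc.hyps by (simp add: dd_def epr_def)
  have pos: "0 < Dp E (Suc k)" unfolding D using Suc.IH dd_pos by simp
  have "(\<Prod>t\<in>{1..<Suc k}. E t) = (\<Prod>t\<in>{1..<k}. E t) * E k"
    using Suc.hyps by (simp add: prod.atLeastLessThan_Suc)
  also have "\<dots> = Dp E k * epr E k * E k" using Suc.IH by simp
  also have "\<dots> = Dp E (Suc k) * (epr E k * (E k div dd E k))"
    unfolding D using dd_dvd(1) [of k] by simp
  finally have *: "(\<Prod>t\<in>{1..<Suc k}. E t) = Dp E (Suc k) * (epr E k * (E k div dd E k))" .
  then have "epr E (Suc k) = epr E k * (E k div dd E k)" using pos by (simp add: epr_def)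
  with * pos show ?case by simp
qed

lemma epr_1: "epr E 1 = 1"
  using Dp_mult_epr [of 1] by (simp add: zmult_eq_1_iff)

lemma epr_Suc:
  assumes "1 \<le> k"
  shows "epr E (Suc k) = epr E k * (E k div dd E k)"
proof -
  have D: "Dp E (Suc k) = Dp E k * dd E k" using assms by (simp add: dd_def epr_def)
  have "Dp E (Suc k) * epr E (Suc k) = (\<Prod>t\<in>{1..<k}. E t) * E k"
    using Dp_mult_epr [of "Suc k"] assms by (simp add: prod.atLeastLessThan_Suc)
  also have "\<dots> = Dp E k * epr E k * E k" using Dp_mult_epr assms by simp
  also have "\<dots> = Dp E (Suc k) * (epr E k * (E k div dd E k))"
    unfolding D using dd_dvd(1) [of k] by simp
  finally show ?thesis using Dp_mult_epr [of "Suc k"] by (auto simp del: Dp.simps)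
qed

lemma epr_pos: "1 \<le> j \<Longrightarrow> 0 < epr E j"
  using Dp_mult_epr [of j] prod_pos [of "{1..<j}" E] E
  by (metis mult_less_cancel_left_pos mult_zero_right)

text \<open>Hence \<open>epr E j\<close> is the least common multiple of all earlier denominators;
  the two lemmas below are its universal property.\<close>

lemma epr_Suc_lcm:
  assumes "1 \<le> k"
  shows "epr E (Suc k) = lcm (E k) (epr E k)"
proof -
  have "dd E k * lcm (E k) (epr E k) = E k * epr E k"
    unfolding dd_def using E [of k] epr_pos [OF assms] by (simp add: gcd_mult_lcm abs_mult)
  also have "\<dots> = dd E k * epr E (Suc k)"
    unfolding epr_Suc [OF assms] using dd_dvd(1) [of k] by simp
  finally show ?thesis using dd_pos [of k] by simp
qed

lemma E_dvd_epr: "1 \<le> t \<Longrightarrow> t < j \<Longrightarrow> E t dvd epr E j"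
proof (induction j)
  case (Suc k)
  then show ?case using epr_Suc_lcm [of k] by (cases "t = k") (auto intro: dvd_lcmI2)
qed simp

lemma epr_dvd: "1 \<le> j \<Longrightarrow> (\<And>t. t \<in> {1..<j} \<Longrightarrow> E t dvd c) \<Longrightarrow> epr E j dvd c"
proof (induction j rule: nat_induct_at_least)
  case base
  then show ?case by (simp only: epr_1) simp
next
  case (Suc k)
  then show ?case using epr_Suc_lcm [of k] by simp
qed

context
  fixes H :: "nat \<Rightarrow> int"
  assumes cop: "\<And>t. coprime (H t) (E t)"
begin

text \<open>Divided by \<open>dd E j\<close>, the congruence defining \<open>ell\<close> reads
  \<open>l * m\<close> congruent to 1 modulo \<open>e\<close>, with \<open>m\<close> and
  \<open>e\<close> coprime. It has a unique solution in the prescribed range, which makes the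
  definite description meaningful.\<close>

lemma ell_spec:
  assumes j: "1 \<le> j"
  shows "ell H E j * H j * epr E j + ell' H E j * E j = dd E j"
proof -
  define d where "d = dd E j"
  define e where "e = E j div d"
  define m where "m = H j * (epr E j div d)"
  have d: "0 < d" "E j = d * e" "epr E j = d * (epr E j div d)"
    using dd_pos dd_dvd unfolding d_def e_def by auto
  have e: "0 < e" using E [of j] d by (metis zero_less_mult_pos)
  have "coprime (H j) e" using cop [of j] d by (metis coprime_mult_right_iff)
  moreover have "coprime (E j div d) (epr E j div d)"
    unfolding d_def dd_def using E [of j] by (intro div_gcd_coprime) auto
  ultimately have me: "coprime m e" unfolding m_def e_def by (simp add: coprime_commute)
  have eq: "d - l * H j * epr E j = d * (1 - l * m)" for l
    using d(3) unfolding m_def by (simp add: right_diff_distrib)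
  have iff: "E j dvd d - l * H j * epr E j \<longleftrightarrow> e dvd 1 - l * m" for l
    unfolding eq using d by (metis dvd_mult_cancel_left less_irrefl)
  obtain u v where uv: "u * m + v * e = 1" using bezout_int [of m e] me by auto
  have 1: "e dvd 1 - (u mod e) * m"
  proof -
    have "1 - (u mod e) * m = e * (v + (u div e) * m)"
      using uv by (simp add: minus_mult_div_eq_mod [symmetric] algebra_simps)
    then show ?thesis by simp
  qed
  have uniq: "l = l'" if "0 \<le> l" "l < e" "e dvd 1 - l * m" "0 \<le> l'" "l' < e" "e dvd 1 - l' * m" for l l'
  proof -
    have "e dvd (1 - l' * m) - (1 - l * m)" by (rule dvd_diff [OF that(6,3)])
    also have "(1 - l' * m) - (1 - l * m) = (l - l') * m" by (simp add: algebra_simps)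
    finally have "e dvd l - l'" using me by (simp add: coprime_commute coprime_dvd_mult_left_iff)
    then have "l mod e = l' mod e" by (simp add: mod_eq_dvd_iff)
    with that show ?thesis by simp
  qed
  have "\<exists>!l. 0 \<le> l \<and> l < E j div dd E j \<and> E j dvd (dd E j - l * H j * epr E j)"
    using 1 e uniq iff unfolding d_def [symmetric] e_def [symmetric]
    by (intro ex1I [of _ "u mod e"]) auto
  from theI' [OF this, folded ell_def]
  have "E j dvd dd E j - ell H E j * H j * epr E j" by (elim conjE)
  then show ?thesis unfolding ell'_def by simp
qed

text \<open>Up to sign this is the determinant of the integer matrix that carries the pair of
  \<open>Wel_def\<close> generators to the next one.\<close>

lemma ell_spec_div:
  assumes "1 \<le> j"
  shows "ell H E j * (H j * (epr E j div dd E j)) + ell' H E j * (E j div dd E j) = 1"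
proof -
  have "dd E j * (ell H E j * (H j * (epr E j div dd E j)) + ell' H E j * (E j div dd E j))
    = ell H E j * H j * (dd E j * (epr E j div dd E j)) + ell' H E j * (dd E j * (E j div dd E j))"
    by (simp only: algebra_simps)
  also have "\<dots> = dd E j * 1"
    using ell_spec [OF assms] dd_dvd [of j] by (simp only: dvd_mult_div_cancel mult_1_right)
  finally show ?thesis using dd_pos [of j] by (simp del: mult_1_right)
qed

context
  fixes \<phi> :: "'f::field" and p :: "nat \<Rightarrow> 'f" and n :: nat
  assumes \<phi>: "\<phi> \<noteq> 0" and p: "\<And>t. t \<in> {1..n} \<Longrightarrow> p t \<noteq> 0"
begin

abbreviation "W \<equiv> Wel E H \<phi> p"
abbreviation "P \<equiv> Pel E H \<phi> p"

lemma Wel_1: "W 1 = \<phi>"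
  unfolding Wel_def epr_1 by simp

lemma Wel_nz: "j \<le> Suc n \<Longrightarrow> W j \<noteq> 0"
  using \<phi> p by (auto simp: Wel_def power_int_eq_0_iff)

lemma Pel_eq: "P j = W j powi ell H E j * p j powi ell' H E j"
proof -
  \<comment> \<open>\<open>E t\<close> divides \<open>epr E j\<close> for every earlier
    \<open>t\<close>, so the integer division is exact and commutes with the sign.\<close>
  have *: "(- (ell H E j * epr E j * H t)) div E t = - (epr E j * H t div E t) * ell H E j" if t: "t \<in> {1..<j}" for t
  proof -
    obtain c where c: "epr E j = E t * c" using E_dvd_epr [of t j] t by auto
    have "- (ell H E j * epr E j * H t) = E t * (- (c * H t) * ell H E j)" by (simp add: c)
    moreover have "epr E j * H t = E t * (c * H t)" by (simp add: c)
    ultimately show ?thesis using E [of t] by (metis less_irrefl nonzero_mult_div_cancel_left)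
  qed
  have "(\<Prod>t\<in>{1..<j}. p t powi ((- (ell H E j * epr E j * H t)) div E t))
    = (\<Prod>t\<in>{1..<j}. p t powi (- (epr E j * H t div E t))) powi ell H E j"
    unfolding prod_power_int by (intro prod.cong refl) (simp only: * power_int_mult)
  then show ?thesis
    unfolding Pel_def Wel_def power_int_mult_distrib
    by (simp add: power_int_mult [symmetric] mult.commute)
qed

lemma Pel_nz: "j \<in> {1..n} \<Longrightarrow> P j \<noteq> 0"
  using Wel_nz [of j] p by (auto simp: Pel_eq power_int_eq_0_iff)

lemma Wel_Suc:
  assumes j: "1 \<le> j"
  shows "W (Suc j) = W j powi (E j div dd E j) * p j powi (- (H j * (epr E j div dd E j)))"
proof -
  let ?e = "E j div dd E j"
  have 1: "epr E (Suc j) * H t div E t = (epr E j * H t div E t) * ?e" if t: "t \<in> {1..<j}" for t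
  proof -
    obtain c where c: "epr E j = E t * c" using E_dvd_epr [of t j] t by auto
    have "epr E (Suc j) * H t = E t * (c * H t * ?e)" by (simp add: epr_Suc [OF j] c)
    moreover have "epr E j * H t = E t * (c * H t)" by (simp add: c)
    ultimately show ?thesis using E [of t] by (metis less_irrefl nonzero_mult_div_cancel_left)
  qed
  have 2: "epr E (Suc j) * H j div E j = H j * (epr E j div dd E j)"
  proof -
    have "epr E (Suc j) * H j = (dd E j * (epr E j div dd E j)) * ?e * H j"
      by (simp add: epr_Suc [OF j] dd_dvd)
    also have "\<dots> = (dd E j * ?e) * (H j * (epr E j div dd E j))" by (simp only: ac_simps)
    also have "\<dots> = E j * (H j * (epr E j div dd E j))" by (simp add: dd_dvd)
    finally show ?thesis using E [of j] by (metis less_irrefl nonzero_mult_div_cancel_left)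
  qed
  have "(\<Prod>t\<in>{1..<Suc j}. p t powi (- (epr E (Suc j) * H t div E t)))
    = (\<Prod>t\<in>{1..<j}. p t powi (- (epr E j * H t div E t) * ?e)) * p j powi (- (H j * (epr E j div dd E j)))"
    using j 1 2 by (simp add: prod.atLeastLessThan_Suc)
  then show ?thesis
    unfolding Wel_def epr_Suc [OF j] power_int_mult power_int_mult_distrib prod_power_int
    by (simp add: mult.assoc)
qed

text \<open>The exponents are the entries of the inverse matrix, which is integral since the
  determinant is -1.\<close>

lemma Wel_back:
  assumes j: "j \<in> {1..n}"
  shows "W j = P j powi (H j * (epr E j div dd E j)) * W (Suc j) powi ell' H E j"
    and "p j = P j powi (E j div dd E j) * W (Suc j) powi (- ell H E j)"
proof -
  define A e l l' where "A = H j * (epr E j div dd E j)" and "e = E j div dd E j"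
    and "l = ell H E j" and "l' = ell' H E j"
  have 1: "l * A + l' * e = 1"
    using ell_spec_div [of j] j by (simp add: A_def e_def l_def l'_def)
  have nz: "W j \<noteq> 0" "p j \<noteq> 0" using Wel_nz p j by auto
  have P: "P j = W j powi l * p j powi l'" by (simp add: Pel_eq l_def l'_def)
  have S: "W (Suc j) = W j powi e * p j powi (- A)" using Wel_Suc j by (simp add: A_def e_def)
  have "P j powi A * W (Suc j) powi l' = W j powi (l * A + e * l') * p j powi (l' * A + (- A) * l')"
    unfolding P S power_int_mult_distrib power_int_add_nz [OF nz(1)] power_int_add_nz [OF nz(2)] power_int_mult
    by (simp only: ac_simps)
  also have "\<dots> = W j" using 1 by (simp add: mult.commute)
  finally show "W j = P j powi (H j * (epr E j div dd E j)) * W (Suc j) powi ell' H E j"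
    by (simp add: A_def l'_def)
  have "P j powi e * W (Suc j) powi (- l) = W j powi (l * e + e * (- l)) * p j powi (l' * e + (- A) * (- l))"
    unfolding P S power_int_mult_distrib power_int_add_nz [OF nz(1)] power_int_add_nz [OF nz(2)] power_int_mult
    by (simp only: ac_simps)
  also have "\<dots> = p j" using 1 by (simp add: mult.commute add.commute)
  finally show "p j = P j powi (E j div dd E j) * W (Suc j) powi (- ell H E j)"
    by (simp add: e_def l_def)
qed

text \<open>The exponents of the \<open>P t\<close> are deliberately forgotten here: only the
  exponent of the last \<open>W\<close> is tracked.\<close>

definition Pspan :: "'f set" where
  "Pspan = {\<Prod>t\<in>{1..n}. P t powi c t | c. True}"

lemma Pspan_one: "1 \<in> Pspan"
  unfolding Pspan_def by (rule CollectI, rule exI [of _ "\<lambda>_. 0"]) simp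

lemma Pspan_Pel: "j \<in> {1..n} \<Longrightarrow> P j \<in> Pspan"
  unfolding Pspan_def
  by (rule CollectI, rule exI [of _ "\<lambda>t. if t = j then 1 else 0"])
    (simp add: if_distrib [of "\<lambda>k. _ powi k"] cong: if_cong)

lemma Pspan_mult: "x \<in> Pspan \<Longrightarrow> y \<in> Pspan \<Longrightarrow> x * y \<in> Pspan"
proof -
  assume "x \<in> Pspan" "y \<in> Pspan"
  then obtain c d where x: "x = (\<Prod>t\<in>{1..n}. P t powi c t)" and y: "y = (\<Prod>t\<in>{1..n}. P t powi d t)"
    by (auto simp: Pspan_def)
  have "x * y = (\<Prod>t\<in>{1..n}. P t powi (c t + d t))"
    unfolding x y prod.distrib [symmetric] by (intro prod.cong refl) (simp add: power_int_add Pel_nz)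
  then show ?thesis
    unfolding Pspan_def by (intro CollectI exI [of _ "\<lambda>t. c t + d t"]) simp
qed

lemma Pspan_power_int: "x \<in> Pspan \<Longrightarrow> x powi k \<in> Pspan"
proof -
  assume "x \<in> Pspan"
  then obtain c where x: "x = (\<Prod>t\<in>{1..n}. P t powi c t)" by (auto simp: Pspan_def)
  have "x powi k = (\<Prod>t\<in>{1..n}. P t powi (c t * k))"
    unfolding x prod_power_int by (simp add: power_int_mult)
  then show ?thesis
    unfolding Pspan_def by (intro CollectI exI [of _ "\<lambda>t. c t * k"]) simp
qed

lemma Pspan_prod: "(\<And>i. i \<in> A \<Longrightarrow> f i \<in> Pspan) \<Longrightarrow> (\<Prod>i\<in>A. f i) \<in> Pspan"
  by (induction A rule: infinite_finite_induct) (auto intro: Pspan_one Pspan_mult)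

text \<open>Downward induction by the first identity of \<open>Wel_back\<close>: each step
  multiplies the exponent of \<open>W (Suc n)\<close> by one more \<open>ell'\<close>.\<close>

lemma Wel_span:
  assumes "1 \<le> j" "j \<le> Suc n"
  shows "\<exists>s\<in>Pspan. W j = s * W (Suc n) powi (\<Prod>t\<in>{j..n}. ell' H E t)"
  using assms(2,1)
proof (induction j rule: inc_induct)
  case base
  show ?case by (rule bexI [OF _ Pspan_one]) simp
next
  case (step j)
  then obtain s where s: "s \<in> Pspan" "W (Suc j) = s * W (Suc n) powi (\<Prod>t\<in>{Suc j..n}. ell' H E t)" by auto
  have j: "j \<in> {1..n}" using step by auto
  have "{j..n} = insert j {Suc j..n}" using j by auto
  then have eq: "(\<Prod>t\<in>{j..n}. ell' H E t) = (\<Prod>t\<in>{Suc j..n}. ell' H E t) * ell' H E j" by simp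
  have "W j = (P j powi (H j * (epr E j div dd E j)) * s powi ell' H E j) *
      W (Suc n) powi (\<Prod>t\<in>{j..n}. ell' H E t)"
    unfolding eq by (subst Wel_back(1) [OF j]) (simp add: s power_int_mult_distrib power_int_mult)
  moreover have "P j powi (H j * (epr E j div dd E j)) * s powi ell' H E j \<in> Pspan"
    using j s by (intro Pspan_mult Pspan_power_int Pspan_Pel)
  ultimately show ?case by blast
qed

text \<open>One use of the second identity of \<open>Wel_back\<close>, followed by
  \<open>Wel_span\<close> from the index \<open>Suc j\<close> on. The resulting exponent is the
  origin of \<open>Lj\<close>, with its minus sign in \<open>eps\<close>.\<close>

lemma p_span:
  assumes j: "j \<in> {1..n}"
  shows "\<exists>s\<in>Pspan. p j = s * W (Suc n) powi (- (ell H E j * (\<Prod>t\<in>{j<..n}. ell' H E t)))"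
proof -
  obtain s where s: "s \<in> Pspan" "W (Suc j) = s * W (Suc n) powi (\<Prod>t\<in>{Suc j..n}. ell' H E t)"
    using Wel_span [of "Suc j"] j by auto
  have "p j = (P j powi (E j div dd E j) * s powi (- ell H E j)) *
      W (Suc n) powi (- (ell H E j * (\<Prod>t\<in>{Suc j..n}. ell' H E t)))"
    by (subst Wel_back(2) [OF j])
      (simp add: s power_int_mult_distrib power_int_mult [symmetric] mult.commute del: power_int_minus)
  moreover have "P j powi (E j div dd E j) * s powi (- ell H E j) \<in> Pspan"
    using j s by (intro Pspan_mult Pspan_power_int Pspan_Pel)
  moreover have "{j<..n} = {Suc j..n}" by auto
  ultimately show ?thesis by auto
qed

text \<open>Collecting the exponents of \<open>W (Suc n)\<close> contributed by
  \<open>\<phi>\<close> and by each \<open>p j\<close> yields the affine expression of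
  \<open>Lp\<close> and \<open>Lmap\<close>.\<close>

lemma monomial_span:
  "\<exists>c. \<phi> powi s * (\<Prod>j\<in>{1..n}. p j powi m j) = (\<Prod>t\<in>{1..n}. P t powi c t) *
     W (Suc n) powi ((\<Prod>t\<in>{1..n}. ell' H E t) * s
       - (\<Sum>j\<in>{1..n}. m j * (ell H E j * (\<Prod>t\<in>{j<..n}. ell' H E t))))"
proof -
  let ?Y = "W (Suc n)" and ?L = "\<lambda>j. ell H E j * (\<Prod>t\<in>{j<..n}. ell' H E t)"
  have Y: "?Y \<noteq> 0" by (simp add: Wel_nz)
  obtain a where a: "a \<in> Pspan" "\<phi> = a * ?Y powi (\<Prod>t\<in>{1..n}. ell' H E t)"
    using Wel_span [of 1] unfolding Wel_1 by auto
  obtain b where b: "\<And>j. j \<in> {1..n} \<Longrightarrow> b j \<in> Pspan \<and> p j = b j * ?Y powi (- ?L j)"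
    using p_span by metis
  have "(\<Prod>j\<in>{1..n}. p j powi m j) = (\<Prod>j\<in>{1..n}. b j powi m j * ?Y powi (- ?L j * m j))"
  proof (intro prod.cong refl)
    fix j assume "j \<in> {1..n}"
    then have "p j = b j * ?Y powi (- ?L j)" using b by blast
    then show "p j powi m j = b j powi m j * ?Y powi (- ?L j * m j)"
      by (simp only: power_int_mult_distrib power_int_mult)
  qed
  also have "\<dots> = (\<Prod>j\<in>{1..n}. b j powi m j) * ?Y powi (\<Sum>j\<in>{1..n}. - ?L j * m j)"
  proof -
    have "(\<Prod>j\<in>A. ?Y powi f j) = ?Y powi (\<Sum>j\<in>A. f j)" for A and f :: "nat \<Rightarrow> int"
      by (induction A rule: infinite_finite_induct) (simp_all add: power_int_add Y)
    then show ?thesis by (simp only: prod.distrib)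
  qed
  finally have "\<phi> powi s * (\<Prod>j\<in>{1..n}. p j powi m j) =
    (a powi s * (\<Prod>j\<in>{1..n}. b j powi m j)) *
      ?Y powi ((\<Prod>t\<in>{1..n}. ell' H E t) * s + (\<Sum>j\<in>{1..n}. - ?L j * m j))"
    by (subst a(2)) (simp only: power_int_mult_distrib power_int_mult [symmetric] power_int_add_nz [OF Y] ac_simps)
  moreover have "(\<Sum>j\<in>{1..n}. - ?L j * m j) = - (\<Sum>j\<in>{1..n}. m j * ?L j)"
    by (simp add: sum_negf mult.commute mult.left_commute)
  moreover have "a powi s * (\<Prod>j\<in>{1..n}. b j powi m j) \<in> Pspan"
    using a b by (intro Pspan_mult Pspan_power_int Pspan_prod) auto
  ultimately show ?thesis unfolding Pspan_def by auto
qed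

end

end

end

section \<open>MacLane chains and ramification indices\<close>

definition is_subgroup :: "'g::ab_group_add set \<Rightarrow> bool" where
  "is_subgroup G \<longleftrightarrow> 0 \<in> G \<and> (\<forall>x\<in>G. \<forall>y\<in>G. x - y \<in> G)"

context
  fixes G :: "'g::linordered_ab_group_add set"
  assumes G: "is_subgroup G"
begin

lemma subgroup_0: "0 \<in> G"
  and subgroup_diff: "x \<in> G \<Longrightarrow> y \<in> G \<Longrightarrow> x - y \<in> G"
  using G by (auto simp: is_subgroup_def)

lemma subgroup_uminus: "x \<in> G \<Longrightarrow> - x \<in> G"
  using subgroup_diff [OF subgroup_0, of x] by simp

lemma subgroup_add: "x \<in> G \<Longrightarrow> y \<in> G \<Longrightarrow> x + y \<in> G"
  using subgroup_diff [OF _ subgroup_uminus, of x y] by simp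

lemma subgroup_sum: "(\<And>i. i \<in> A \<Longrightarrow> f i \<in> G) \<Longrightarrow> (\<Sum>i\<in>A. f i) \<in> G"
  by (induction A rule: infinite_finite_induct) (auto intro: subgroup_0 subgroup_add)

lemma subgroup_gmul: "x \<in> G \<Longrightarrow> gmul k x \<in> G"
  unfolding gmul_def by (auto intro: subgroup_sum subgroup_uminus)

lemma subgroup_coset_eq: "(\<lambda>b. x + b) ` G = (\<lambda>b. y + b) ` G \<longleftrightarrow> x - y \<in> G"
proof
  assume "(\<lambda>b. x + b) ` G = (\<lambda>b. y + b) ` G"
  moreover have "x + 0 \<in> (\<lambda>b. x + b) ` G" using subgroup_0 by (rule imageI)
  ultimately obtain b where "x + 0 = y + b" "b \<in> G" by auto
  then show "x - y \<in> G" by (simp add: algebra_simps)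
next
  have sub: "(\<lambda>b. x + b) ` G \<subseteq> (\<lambda>b. y + b) ` G" if "x - y \<in> G" for x y
  proof
    fix z assume "z \<in> (\<lambda>b. x + b) ` G"
    then obtain b where b: "b \<in> G" "z = x + b" by auto
    then have "z = y + ((x - y) + b)" by simp
    with subgroup_add [OF that b(1)] show "z \<in> (\<lambda>b. y + b) ` G" by blast
  qed
  assume "x - y \<in> G"
  with sub [of x y] sub [of y x] subgroup_uminus [of "x - y"]
  show "(\<lambda>b. x + b) ` G = (\<lambda>b. y + b) ` G" by auto
qed

text \<open>The integers \<open>c\<close> with \<open>gmul c \<gamma> \<in> G\<close> are the
  multiples of the least positive one, \<open>m\<close>. The multiples of \<open>\<gamma>\<close> by
  0 up to \<open>m - 1\<close> then represent each coset once, so \<open>m\<close> is the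
  index.\<close>

lemma gindex_cyclic_extension:
  assumes k: "0 < k" "gmul k \<gamma> \<in> G"
  defines "e \<equiv> int (gindex {g + gmul c \<gamma> | g c. g \<in> G} G)"
  shows "0 < e" "gmul c \<gamma> \<in> G \<longleftrightarrow> e dvd c"
proof -
  define m where "m = (LEAST m. 0 < m \<and> gmul (int m) \<gamma> \<in> G)"
  have "0 < nat k \<and> gmul (int (nat k)) \<gamma> \<in> G" using k by simp
  then have m: "0 < m \<and> gmul (int m) \<gamma> \<in> G" unfolding m_def by (rule LeastI)
  have least: "m \<le> l" if "0 < l" "gmul (int l) \<gamma> \<in> G" for l
    unfolding m_def using that by (intro Least_le) simp
  have iff: "gmul c \<gamma> \<in> G \<longleftrightarrow> int m dvd c" for c
  proof
    assume c: "gmul c \<gamma> \<in> G"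
    have eq: "c = (c div int m) * int m + c mod int m" by simp
    have mod: "gmul (c mod int m) \<gamma> = gmul c \<gamma> - gmul (c div int m) (gmul (int m) \<gamma>)"
      by (subst (2) eq) (simp only: gmul_add gmul_mult add_diff_cancel_left')
    have "gmul (c mod int m) \<gamma> \<in> G"
      unfolding mod using c m subgroup_diff subgroup_gmul by blast
    moreover have "0 \<le> c mod int m" "c mod int m < int m" using m by simp_all
    ultimately have "c mod int m = 0"
      using least [of "nat (c mod int m)"] by (cases "c mod int m = 0") auto
    then show "int m dvd c" by auto
  next
    assume "int m dvd c"
    then obtain d where "c = d * int m" by (metis dvd_def mult.commute)
    then show "gmul c \<gamma> \<in> G" using m by (simp add: gmul_mult subgroup_gmul)
  qed
  let ?coset = "\<lambda>x. (\<lambda>b. x + b) ` G"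
  have "?coset ` {g + gmul c \<gamma> | g c. g \<in> G} = (\<lambda>l. ?coset (gmul (int l) \<gamma>)) ` {..<m}"
  proof (intro equalityI subsetI)
    fix X assume "X \<in> ?coset ` {g + gmul c \<gamma> | g c. g \<in> G}"
    then obtain g c where gc: "g \<in> G" "X = ?coset (g + gmul c \<gamma>)" by auto
    let ?l = "nat (c mod int m)"
    have l: "int ?l = c mod int m" "?l < m" using m by (simp_all add: nat_less_iff)
    have "int m dvd c - c mod int m" by (rule dvd_minus_mod)
    then have "gmul (c - int ?l) \<gamma> \<in> G" using iff l by simp
    then have "g + gmul c \<gamma> - gmul (int ?l) \<gamma> \<in> G"
      using subgroup_add [OF gc(1), of "gmul (c - int ?l) \<gamma>"] by (simp only: gmul_diff add_diff_eq)
    then have "X = ?coset (gmul (int ?l) \<gamma>)" using gc subgroup_coset_eq by simp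
    with l show "X \<in> (\<lambda>l. ?coset (gmul (int l) \<gamma>)) ` {..<m}" by blast
  next
    fix X assume "X \<in> (\<lambda>l. ?coset (gmul (int l) \<gamma>)) ` {..<m}"
    then obtain l where "X = ?coset (0 + gmul (int l) \<gamma>)" by auto
    then show "X \<in> ?coset ` {g + gmul c \<gamma> | g c. g \<in> G}" using subgroup_0 by blast
  qed
  moreover have "inj_on (\<lambda>l. ?coset (gmul (int l) \<gamma>)) {..<m}"
  proof (rule inj_onI)
    fix a b assume ab: "a \<in> {..<m}" "b \<in> {..<m}" "?coset (gmul (int a) \<gamma>) = ?coset (gmul (int b) \<gamma>)"
    then have "int m dvd int a - int b" using subgroup_coset_eq iff by (simp add: gmul_diff [symmetric])
    then have "int a mod int m = int b mod int m" by (simp add: mod_eq_dvd_iff)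
    with ab show "a = b" by simp
  qed
  ultimately have "e = int m" unfolding e_def gindex_def by (simp add: card_image)
  with m iff show "0 < e" "gmul c \<gamma> \<in> G \<longleftrightarrow> e dvd c" by auto
qed

end

lemma subgroup_vgrp:
  fixes \<mu> :: "'k::field poly \<Rightarrow> 'g::linordered_ab_group_add"
  assumes val: "ring_val \<mu>"
  shows "is_subgroup (vgrp \<mu>)"
  unfolding is_subgroup_def
proof (intro conjI ballI)
  show "0 \<in> vgrp \<mu>" unfolding vgrp_def by (rule CollectI, rule exI [of _ 1], rule exI [of _ 1]) simp
  fix x y assume "x \<in> vgrp \<mu>" "y \<in> vgrp \<mu>"
  then obtain a b c d where *: "a \<noteq> 0" "b \<noteq> 0" "c \<noteq> 0" "d \<noteq> 0" "x = \<mu> a - \<mu> b" "y = \<mu> c - \<mu> d"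
    by (auto simp: vgrp_def)
  then have "x - y = \<mu> (a * d) - \<mu> (b * c)" by (simp add: val_mult [OF val])
  with * show "x - y \<in> vgrp \<mu>" unfolding vgrp_def by (metis (mono_tags, lifting) mem_Collect_eq mult_eq_0_iff)
qed

lemma val_in_vgrp:
  assumes "ring_val \<mu>" "f \<noteq> 0"
  shows "\<mu> f \<in> vgrp \<mu>"
  unfolding vgrp_def using assms by (intro CollectI exI [of _ f] exI [of _ 1]) (simp add: val_1)

lemma Fract_power: "Fract a 1 ^ n = Fract (a ^ n) 1" for a :: "'a::idom"
  by (induction n) (simp_all add: One_fract_def)

lemma Fract_nz: "a \<noteq> 0 \<Longrightarrow> Fract a 1 \<noteq> 0" for a :: "'a::idom"
  by (simp add: Zero_fract_def eq_fract)

lemma muF_poly: "ring_val \<mu> \<Longrightarrow> f \<noteq> 0 \<Longrightarrow> muF \<mu> (Fract f 1) = \<mu> f"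
  by (simp add: muF_Fract val_1)

section \<open>Valuations and value groups along a fixed chain\<close>

locale maclane =
  fixes C :: "('k::field, 'g::linordered_ab_group_add) mlc" and r :: nat
  assumes div: "divisible_group TYPE('g)"
    and chain: "maclane_chain C r"
    and basis: "basis_data C r"
begin

lemma ring_val_vK: "ring_val (vK C)"
  using chain by (simp add: maclane_chain_def is_valuation_def ring_val_def)

lemma augmentation_base: "augmentation (\<lambda>b. vK C (coeff b 0)) (phi C 0) (gm C 0)"
proof
  obtain a where a: "phi C 0 = [:a, 1:]" using chain by (auto simp: maclane_chain_def)
  then have deg: "degree (phi C 0) = 1" by simp
  then show "0 < degree (phi C 0)" by simp
  have const: "\<exists>c. p = [:c:]" if "degree p < degree (phi C 0)" for p
    using that deg by (metis degree_eq_zeroE less_one)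
  fix x y :: "'k poly"
  assume xy: "x \<noteq> 0" "y \<noteq> 0" "degree x < degree (phi C 0)" "degree y < degree (phi C 0)"
  then obtain c d where cd: "x = [:c:]" "y = [:d:]" using const by metis
  then have nz: "c \<noteq> 0" "d \<noteq> 0" using xy by auto
  show "min (vK C (coeff x 0)) (vK C (coeff y 0)) \<le> vK C (coeff (x + y) 0)" if "x + y \<noteq> 0"
    using that nz val_add [OF ring_val_vK, of c d] by (simp add: cd)
  have small: "degree (x * y) < degree (phi C 0)" using deg by (simp add: cd)
  show "x * y mod phi C 0 \<noteq> 0 \<and> vK C (coeff (x * y mod phi C 0) 0) = vK C (coeff x 0) + vK C (coeff y 0)"
    unfolding mod_poly_less [OF small] using nz val_mult [OF ring_val_vK, of c d] by (simp add: cd mult.commute)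
  show "vK C (coeff x 0) + vK C (coeff y 0) < vK C (coeff (x * y div phi C 0) 0) + gm C 0"
    if "x * y div phi C 0 \<noteq> 0"
    using that div_poly_less [OF small] by simp
qed

lemma key: "i < r \<Longrightarrow> keypoly (mu C i) (phi C (Suc i))"
  and key_gt: "i < r \<Longrightarrow> mu C i (phi C (Suc i)) < gm C (Suc i)"
  and not_mdvd_phi: "i < r \<Longrightarrow> \<not> mdvd (mu C i) (phi C (Suc i)) (phi C i)"
  using chain unfolding maclane_chain_def by (metis Suc_leI diff_Suc_1 le_add1 plus_1_eq_Suc)+

lemma muprev_simps [simp]:
  "muprev C 0 = (\<lambda>b. vK C (coeff b 0))" "muprev C (Suc i) = mu C i"
  by (simp_all add: muprev_def)

lemma Gprev_simps [simp]:
  "Gprev C 0 = value_group (vK C)" "Gprev C (Suc i) = vgrp (mu C i)"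
  by (simp_all add: Gprev_def)

lemma mu_eq_aug: "mu C i = aug (muprev C i) (phi C i) (gm C i)"
  by (cases i) simp_all

lemma augmentation_mu: "i \<le> r \<Longrightarrow> augmentation (muprev C i) (phi C i) (gm C i)"
proof (induction i)
  case 0
  show ?case using augmentation_base by simp
next
  case (Suc i)
  then have "ring_val (mu C i)"
    using augmentation.ring_val_aug mu_eq_aug [of i] by (metis Suc_leD)
  then show ?case
    using augmentation_keypoly [OF _ key key_gt] Suc.prems by simp
qed

lemma ring_val_mu: "i \<le> r \<Longrightarrow> ring_val (mu C i)"
  using augmentation.ring_val_aug [OF augmentation_mu] mu_eq_aug by metis

lemma ring_val_w: "i \<le> r \<Longrightarrow> ring_val (muF (mu C i))"
  by (rule ring_val_muF [OF ring_val_mu])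

lemma degree_phi: "i \<le> r \<Longrightarrow> 0 < degree (phi C i)"
  using augmentation.deg [OF augmentation_mu] .

lemma phi_nonzero: "i \<le> r \<Longrightarrow> phi C i \<noteq> 0"
  using degree_phi by fastforce

lemma mu_phi: "i \<le> r \<Longrightarrow> mu C i (phi C i) = gm C i"
  using augmentation.aug_phi [OF augmentation_mu] mu_eq_aug by metis

lemma mu_small: "i \<le> r \<Longrightarrow> a \<noteq> 0 \<Longrightarrow> degree a < degree (phi C i) \<Longrightarrow> mu C i a = muprev C i a"
  using augmentation.aug_small [OF augmentation_mu] mu_eq_aug by metis

lemma unit_small: "i \<le> r \<Longrightarrow> a \<noteq> 0 \<Longrightarrow> degree a < degree (phi C i) \<Longrightarrow> mdvd (mu C i) a 1"
  using augmentation.small_unit [OF augmentation_mu] mu_eq_aug by metis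

lemma mu_le: "i < r \<Longrightarrow> f \<noteq> 0 \<Longrightarrow> mu C i f \<le> mu C (Suc i) f"
  using le_aug_keypoly [OF ring_val_mu key key_gt] by simp

text \<open>Here the non-divisibility between consecutive key polynomials enters. It makes negative
  powers of \<open>phi C i\<close> transportable from stage \<open>Suc i\<close> onwards.\<close>

lemma mu_phi_Suc: "i < r \<Longrightarrow> mu C (Suc i) (phi C i) = gm C i"
  and unit_phi: "i < r \<Longrightarrow> mdvd (mu C (Suc i)) (phi C i) 1"
  using not_mdvd_aug [OF ring_val_mu key key_gt not_mdvd_phi] mu_phi by simp_all

lemma unit_Suc:
  assumes "i < r" "mdvd (mu C i) a 1"
  shows "mdvd (mu C (Suc i)) a 1" "mu C (Suc i) a = mu C i a"
  using unit_mono [OF ring_val_mu ring_val_mu mu_le] assms by auto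

lemma unit_quot_Suc:
  assumes "i < r" "q \<in> unit_quot (mu C i)"
  shows "q \<in> unit_quot (mu C (Suc i))" "muF (mu C (Suc i)) q = muF (mu C i) q"
  using unit_quot_mono [OF ring_val_mu ring_val_mu mu_le] assms by auto

lemma mu_const: "i \<le> r \<Longrightarrow> c \<noteq> 0 \<Longrightarrow> mu C i [:c:] = vK C c"
proof (induction i)
  case 0
  then show ?case using mu_small [of 0 "[:c:]"] degree_phi [of 0] by simp
next
  case (Suc i)
  then show ?case using mu_small [of "Suc i" "[:c:]"] degree_phi [of "Suc i"] by (simp del: mu.simps)
qed

lemma unit_const: "i \<le> r \<Longrightarrow> c \<noteq> 0 \<Longrightarrow> mdvd (mu C i) [:c:] 1"
  using unit_small degree_phi by simp

lemma subgroup_Gprev: "i \<le> r \<Longrightarrow> is_subgroup (Gprev C i)"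
proof (cases i)
  case 0
  have "is_subgroup (value_group (vK C))"
    unfolding is_subgroup_def
  proof (intro conjI ballI)
    show "0 \<in> value_group (vK C)"
      unfolding value_group_def by (intro CollectI exI [of _ 1]) (simp add: val_1 [OF ring_val_vK])
    fix x y assume "x \<in> value_group (vK C)" "y \<in> value_group (vK C)"
    then obtain a b where ab: "a \<noteq> 0" "b \<noteq> 0" "x = vK C a" "y = vK C b" by (auto simp: value_group_def)
    have "vK C (a / b) + vK C b = vK C a" using val_mult [OF ring_val_vK, of "a / b" b] ab by simp
    then have "x - y = vK C (a / b)" using ab by (simp add: diff_eq_eq)
    with ab show "x - y \<in> value_group (vK C)" by (auto simp: value_group_def)
  qed
  with 0 show ?thesis by simp
next
  case (Suc j)
  assume "i \<le> r"
  with Suc show ?thesis by (simp add: subgroup_vgrp ring_val_mu)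
qed

lemma value_group_subset: "i \<le> r \<Longrightarrow> value_group (vK C) \<subseteq> Gprev C i"
proof (cases i)
  case (Suc j)
  assume "i \<le> r"
  with Suc have j: "j \<le> r" by simp
  show ?thesis
  proof
    fix x assume "x \<in> value_group (vK C)"
    then obtain c where c: "c \<noteq> 0" "x = vK C c" by (auto simp: value_group_def)
    then have "mu C j [:c:] \<in> vgrp (mu C j)" using j by (intro val_in_vgrp ring_val_mu) auto
    with c j Suc show "x \<in> Gprev C i" by (simp add: mu_const)
  qed
qed simp

lemma muprev_in_Gprev:
  assumes "i \<le> r" "a \<noteq> 0" "degree a < degree (phi C i)"
  shows "muprev C i a \<in> Gprev C i"
proof (cases i)
  case 0
  obtain b where "phi C 0 = [:b, 1:]" using chain by (auto simp: maclane_chain_def)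
  with assms 0 obtain c where "a = [:c:]" by (metis degree_eq_zeroE degree_pCons_eq_if less_Suc0 one_neq_zero pCons_eq_0_iff degree_0)
  with assms 0 show ?thesis by (auto simp: value_group_def)
next
  case (Suc j)
  with assms show ?thesis by (simp add: val_in_vgrp ring_val_mu)
qed

lemma mu_attained:
  assumes "i \<le> r" "f \<noteq> 0"
  obtains s where "s \<le> degree f" "expc (phi C i) f s \<noteq> 0"
    "mu C i f = muprev C i (expc (phi C i) f s) + gmul (int s) (gm C i)"
  using augmentation.aug_attained [OF augmentation_mu [OF assms(1)] assms(2)] mu_eq_aug by metis

lemma mu_attained_le:
  assumes "i \<le> r" "expc (phi C i) f s \<noteq> 0"
  shows "mu C i f \<le> muprev C i (expc (phi C i) f s) + gmul (int s) (gm C i)"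
  using augmentation.aug_le [OF augmentation_mu [OF assms(1)] assms(2)] mu_eq_aug by metis

text \<open>The value of \<open>f\<close> may grow at the next stage, so \<open>f\<close> itself is
  no witness. But its old value is that of a coefficient plus a multiple of \<open>gm C i\<close>,
  and both of these survive: small polynomials and \<open>phi C i\<close> keep their values.\<close>

lemma vgrp_mu_mono:
  assumes "i < r"
  shows "vgrp (mu C i) \<subseteq> vgrp (mu C (Suc i))"
proof
  note val = ring_val_mu [of "Suc i"]
  have sub: "is_subgroup (vgrp (mu C (Suc i)))" using assms by (intro subgroup_vgrp val) simp
  have *: "mu C i f \<in> vgrp (mu C (Suc i))" if f: "f \<noteq> 0" for f
  proof -
    obtain s where s: "expc (phi C i) f s \<noteq> 0"
      "mu C i f = muprev C i (expc (phi C i) f s) + gmul (int s) (gm C i)"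
      using mu_attained [of i f] assms f by auto
    have deg: "degree (expc (phi C i) f s) < degree (phi C i)"
      using assms by (intro degree_expc degree_phi) simp
    have "mu C (Suc i) (expc (phi C i) f s) = muprev C i (expc (phi C i) f s)"
      using unit_Suc(2) [OF assms unit_small [OF _ s(1) deg]] mu_small [OF _ s(1) deg] assms by simp
    moreover have "mu C (Suc i) (expc (phi C i) f s) \<in> vgrp (mu C (Suc i))"
      using s assms by (intro val_in_vgrp val) auto
    moreover have "gm C i \<in> vgrp (mu C (Suc i))"
      using mu_phi_Suc [OF assms] val_in_vgrp [OF val, of "phi C i"] phi_nonzero assms by simp
    ultimately show ?thesis
      unfolding s(2) using sub by (intro subgroup_add subgroup_gmul) auto
  qed
  fix x assume "x \<in> vgrp (mu C i)"
  then obtain f g where "f \<noteq> 0" "g \<noteq> 0" "x = mu C i f - mu C i g" by (auto simp: vgrp_def)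
  then show "x \<in> vgrp (mu C (Suc i))" using subgroup_diff [OF sub * *] by simp
qed

lemma Gprev_subset: "i \<le> r \<Longrightarrow> Gprev C i \<subseteq> vgrp (mu C i)"
proof (cases i)
  case 0
  assume "i \<le> r"
  show ?thesis
  proof
    fix x assume "x \<in> Gprev C i"
    then obtain c where c: "c \<noteq> 0" "x = vK C c" using 0 by (auto simp: value_group_def)
    then have "mu C i [:c:] \<in> vgrp (mu C i)" using \<open>i \<le> r\<close> by (intro val_in_vgrp ring_val_mu) auto
    with c \<open>i \<le> r\<close> show "x \<in> vgrp (mu C i)" by (simp add: mu_const)
  qed
next
  case (Suc j)
  assume "i \<le> r"
  with Suc show ?thesis using vgrp_mu_mono [of j] by (simp del: mu.simps)
qed

lemma vgrp_mu:
  assumes "i \<le> r"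
  shows "vgrp (mu C i) = {g + gmul c (gm C i) | g c. g \<in> Gprev C i}"
proof (intro equalityI subsetI)
  have sub: "is_subgroup (vgrp (mu C i))" by (intro subgroup_vgrp ring_val_mu assms)
  fix x assume "x \<in> {g + gmul c (gm C i) | g c. g \<in> Gprev C i}"
  then obtain g c where x: "g \<in> Gprev C i" "x = g + gmul c (gm C i)" by blast
  have "gm C i \<in> vgrp (mu C i)"
    using mu_phi [OF assms] val_in_vgrp [OF ring_val_mu phi_nonzero, OF assms assms] by simp
  then show "x \<in> vgrp (mu C i)"
    unfolding x using x(1) Gprev_subset [OF assms] sub by (intro subgroup_add subgroup_gmul) auto
next
  note sub = subgroup_Gprev [OF assms]
  fix x assume "x \<in> vgrp (mu C i)"
  then obtain f g where fg: "f \<noteq> 0" "g \<noteq> 0" "x = mu C i f - mu C i g" by (auto simp: vgrp_def)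
  have *: "\<exists>a s. a \<in> Gprev C i \<and> mu C i f = a + gmul s (gm C i)" if "f \<noteq> 0" for f
    using mu_attained [OF assms that] muprev_in_Gprev [OF assms _ degree_expc [OF degree_phi [OF assms]]]
    by metis
  obtain a s b t where ab: "a \<in> Gprev C i" "mu C i f = a + gmul s (gm C i)"
    "b \<in> Gprev C i" "mu C i g = b + gmul t (gm C i)" using * fg by metis
  then have "x = (a - b) + gmul (s - t) (gm C i)" using fg by (simp add: gmul_diff)
  with subgroup_diff [OF sub ab(1,3)] show "x \<in> {g + gmul c (gm C i) | g c. g \<in> Gprev C i}" by blast
qed

text \<open>Some positive multiple of \<open>gm C i\<close> lies in the value group, so the index is
  finite and \<open>card\<close> does not return its default 0.\<close>

lemma ee_pos: "i \<le> r \<Longrightarrow> 0 < ee C i"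
  and gmul_gm_in_Gprev_iff: "i \<le> r \<Longrightarrow> gmul c (gm C i) \<in> Gprev C i \<longleftrightarrow> ee C i dvd c"
proof -
  assume i: "i \<le> r"
  then obtain k where "0 < k" "gmul k (gm C i) \<in> value_group (vK C)"
    using chain unfolding maclane_chain_def rat_hull_def by blast
  then have k: "0 < k" "gmul k (gm C i) \<in> Gprev C i" using value_group_subset [OF i] by auto
  from gindex_cyclic_extension [OF subgroup_Gprev [OF i] k]
  show "0 < ee C i" "gmul c (gm C i) \<in> Gprev C i \<longleftrightarrow> ee C i dvd c"
    by (simp_all add: ee_def vgrp_mu [OF i])
qed

end

section \<open>Adapted bases\<close>

declare mu.simps [simp del] io.simps [simp del] pii.simps [simp del]

definition zspan :: "(nat \<Rightarrow> 'g::ab_group_add) \<Rightarrow> nat \<Rightarrow> 'g set" where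
  "zspan B n = {\<Sum>j=1..n. gmul (c j) (B j) | c. True}"

lemma qindep_unique:
  fixes B :: "nat \<Rightarrow> 'g::linordered_ab_group_add"
  assumes "divisible_group TYPE('g)" "qindep B n"
    and "(\<Sum>j=1..n. qmul (a j) (B j)) = (\<Sum>j=1..n. qmul (b j) (B j))" "j \<in> {1..n}"
  shows "a j = b j"
  using coordq_eq [OF assms(1,2) refl, of a] coordq_eq [OF assms(1,2) assms(3), of] assms(4)
  by (simp add: fun_eq_iff) metis

lemma subgroup_zspan: "is_subgroup (zspan B n)" for B :: "nat \<Rightarrow> 'g::linordered_ab_group_add"
  unfolding is_subgroup_def
proof (intro conjI ballI)
  show "0 \<in> zspan B n" unfolding zspan_def by (rule CollectI, rule exI [of _ "\<lambda>_. 0"]) simp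
  fix x y assume "x \<in> zspan B n" "y \<in> zspan B n"
  then obtain c d where "x = (\<Sum>j=1..n. gmul (c j) (B j))" "y = (\<Sum>j=1..n. gmul (d j) (B j))"
    unfolding zspan_def by blast
  then have "x - y = (\<Sum>j=1..n. gmul (c j - d j) (B j))" by (simp add: gmul_diff sum_subtractf)
  then show "x - y \<in> zspan B n"
    unfolding zspan_def by (intro CollectI exI [of _ "\<lambda>j. c j - d j"]) simp
qed

lemma zspan_base: "j \<in> {1..n} \<Longrightarrow> B j \<in> zspan B n"
  unfolding zspan_def
  by (rule CollectI, rule exI [of _ "\<lambda>t. if t = j then 1 else 0"])
    (simp add: if_distrib [of "\<lambda>k. gmul k _"] cong: if_cong)

context maclane
begin

lemma G1_eq: "G1 C = zspan (io0 C) (rk C)"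
  using basis by (simp add: basis_data_def zspan_def)

lemma Gup_0: "Gup C 0 = G1 C"
  by (simp add: Gup_def)

lemma Gup_Suc: "x \<in> Gup C (Suc m) \<longleftrightarrow> (\<exists>g c. g \<in> Gup C m \<and> x = g + gmul c (gm C m))"
proof
  assume "x \<in> Gup C (Suc m)"
  then obtain g c where "g \<in> G1 C" "x = g + (\<Sum>t<Suc m. gmul (c t) (gm C t))" by (auto simp: Gup_def)
  then have "g + (\<Sum>t<m. gmul (c t) (gm C t)) \<in> Gup C m"
    "x = (g + (\<Sum>t<m. gmul (c t) (gm C t))) + gmul (c m) (gm C m)"
    by (auto simp: Gup_def add.assoc)
  then show "\<exists>g c. g \<in> Gup C m \<and> x = g + gmul c (gm C m)" by blast
next
  assume "\<exists>g c. g \<in> Gup C m \<and> x = g + gmul c (gm C m)"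
  then obtain g c d where *: "g \<in> G1 C" "x = (g + (\<Sum>t<m. gmul (d t) (gm C t))) + gmul c (gm C m)"
    unfolding Gup_def by blast
  then have "x = g + (\<Sum>t<Suc m. gmul ((d(m := c)) t) (gm C t))"
    by (simp add: add.assoc)
  with * show "x \<in> Gup C (Suc m)" unfolding Gup_def by blast
qed

lemma subgroup_Gup: "is_subgroup (Gup C m)"
proof (induction m)
  case 0
  show ?case by (simp add: Gup_0 G1_eq subgroup_zspan)
next
  case (Suc m)
  show ?case
    unfolding is_subgroup_def
  proof (intro conjI ballI)
    show "0 \<in> Gup C (Suc m)"
      unfolding Gup_Suc using subgroup_0 [OF Suc] by (intro exI [of _ 0]) simp
    fix x y assume "x \<in> Gup C (Suc m)" "y \<in> Gup C (Suc m)"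
    then obtain g c g' c' where *: "g \<in> Gup C m" "x = g + gmul c (gm C m)" "g' \<in> Gup C m" "y = g' + gmul c' (gm C m)"
      unfolding Gup_Suc by blast
    then have "x - y = (g - g') + gmul (c - c') (gm C m)" by (simp add: gmul_diff)
    with subgroup_diff [OF Suc *(1,3)] show "x - y \<in> Gup C (Suc m)" unfolding Gup_Suc by blast
  qed
qed

lemma Gup_mono: "x \<in> Gup C m \<Longrightarrow> x \<in> Gup C (Suc m)"
  unfolding Gup_Suc by (intro exI [of _ x] exI [of _ 0]) simp

lemma gm_in_Gup: "gm C m \<in> Gup C (Suc m)"
  unfolding Gup_Suc using subgroup_0 [OF subgroup_Gup] by (intro exI [of _ 0] exI [of _ 1]) simp

lemma Gup_subset: "i \<le> r \<Longrightarrow> Gup C i \<subseteq> Gprev C i"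
proof (induction i)
  case 0
  then show ?case using basis unfolding basis_data_def Gup_0 Gprev_simps by blast
next
  case (Suc i)
  show ?case
  proof
    fix x assume "x \<in> Gup C (Suc i)"
    then have "\<exists>g c. g \<in> Gprev C i \<and> x = g + gmul c (gm C i)" unfolding Gup_Suc using Suc by auto
    then show "x \<in> Gprev C (Suc i)" using vgrp_mu [of i] Suc.prems by auto
  qed
qed

lemma hh_in_Gup: "i \<le> r \<Longrightarrow> hh C i \<in> Gup C i"
  using basis by (simp add: basis_data_def)

text \<open>Compare \<open>u\<close> with the element \<open>g\<close> of \<open>Gup C i\<close>
  occurring in the shifted value. Their difference is a multiple of \<open>gm C i\<close> inside
  \<open>Gprev C i\<close>, so \<open>ee C i\<close> divides the multiplier and the difference is a
  multiple of \<open>hh C i\<close>, which belongs to \<open>Gup C i\<close>.\<close>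

lemma in_Gup_if_shift:
  assumes i: "i \<le> r" and u: "u \<in> Gprev C i" "u + gmul s (gm C i) \<in> Gup C (Suc i)"
  shows "u \<in> Gup C i"
proof -
  obtain g c where g: "g \<in> Gup C i" "u + gmul s (gm C i) = g + gmul c (gm C i)"
    using u(2) unfolding Gup_Suc by blast
  then have eq: "u - g = gmul (c - s) (gm C i)" by (simp add: gmul_diff algebra_simps)
  have "u - g \<in> Gprev C i"
    using u g Gup_subset [OF i] by (intro subgroup_diff [OF subgroup_Gprev [OF i]]) auto
  then have "ee C i dvd c - s" unfolding eq gmul_gm_in_Gprev_iff [OF i] .
  then obtain k where "c - s = k * ee C i" by (metis dvd_def mult.commute)
  then have "u - g = gmul k (hh C i)" unfolding eq by (simp add: gmul_mult hh_def)
  then have "u = g + gmul k (hh C i)" by (simp add: algebra_simps)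
  then show ?thesis
    using subgroup_add [OF subgroup_Gup g(1)] subgroup_gmul [OF subgroup_Gup hh_in_Gup [OF i]] by simp
qed

text \<open>The invariant carried along the chain: independence makes coordinates unique, generation
  makes them integral, and membership in \<open>unit_quot\<close> lets the elements
  \<open>pii C i j\<close> pass to later stages.\<close>

definition adapted_basis :: "nat \<Rightarrow> bool" where
  "adapted_basis i \<longleftrightarrow> qindep (io C i) (rk C) \<and> Gup C i = zspan (io C i) (rk C) \<and>
     (\<forall>j\<in>{1..rk C}. pii C i j \<in> unit_quot (mu C i) \<and> muF (mu C i) (pii C i j) = io C i j)"

lemma adapted_basis_0: "adapted_basis 0"
  unfolding adapted_basis_def
proof (intro conjI ballI)
  show "qindep (io C 0) (rk C)"
    using basis by (intro qindep_if_zindep [OF div]) (simp add: basis_data_def io.simps)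
  show "Gup C 0 = zspan (io C 0) (rk C)" by (simp add: Gup_0 G1_eq io.simps)
  fix j assume "j \<in> {1..rk C}"
  then have j: "pk0 C j \<noteq> 0" "vK C (pk0 C j) = io0 C j" using basis by (auto simp: basis_data_def)
  show "pii C 0 j \<in> unit_quot (mu C 0)"
    using unit_quot_poly [OF ring_val_mu unit_const] j by (simp add: pii.simps io.simps)
  show "muF (mu C 0) (pii C 0 j) = io C 0 j"
    using muF_poly [OF ring_val_mu, of 0 "[:pk0 C j:]"] mu_const [of 0] j by (simp add: pii.simps io.simps)
qed

section \<open>Passage from stage \<open>i\<close> to stage \<open>Suc i\<close>\<close>

context
  fixes i
  assumes i: "i \<le> r" and good: "adapted_basis i"
begin

lemma indep: "qindep (io C i) (rk C)"
  and Gup_zspan: "Gup C i = zspan (io C i) (rk C)"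
  and pii_unit: "j \<in> {1..rk C} \<Longrightarrow> pii C i j \<in> unit_quot (mu C i)"
  and muF_pii: "j \<in> {1..rk C} \<Longrightarrow> muF (mu C i) (pii C i j) = io C i j"
  using good by (auto simp: adapted_basis_def)

lemma pii_nz: "j \<in> {1..rk C} \<Longrightarrow> pii C i j \<noteq> 0"
  using unit_quot_nz [OF ring_val_mu [OF i] pii_unit] .

lemma Fract_phi_nz: "Fract (phi C i) 1 \<noteq> 0"
  by (rule Fract_nz [OF phi_nonzero [OF i]])

lemma eI_pos: "0 < eI C i t"
  by (simp add: eI_def eB_def quotient_of_denom_pos')

lemma hI_coprime: "coprime (hI C i t) (eI C i t)"
  unfolding hI_def eI_def hB_def eB_def by (rule quotient_of_coprime [OF surjective_pairing])

text \<open>The coordinates of \<open>gm C i\<close> are obtained by dividing the integral ones of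
  \<open>hh C i\<close> by \<open>ee C i\<close>; this guarantees that \<open>coordq\<close>
  describes an existing expansion.\<close>

lemma gm_expand: "gm C i = (\<Sum>j=1..rk C. qmul (of_int (hI C i j) / of_int (eI C i j)) (io C i j))"
proof -
  obtain c where c: "hh C i = (\<Sum>j=1..rk C. gmul (c j) (io C i j))"
    using hh_in_Gup [OF i] Gup_zspan unfolding zspan_def by blast
  have "gm C i = qmul (1 / of_int (ee C i)) (hh C i)"
    using ee_pos [OF i] qmul_eq_iff [OF div, of "ee C i" 1 "hh C i" "gm C i"] by (simp add: hh_def)
  also have "\<dots> = (\<Sum>j=1..rk C. qmul (1 / of_int (ee C i) * of_int (c j)) (io C i j))"
    unfolding c by (simp only: qmul_sum_right [OF div] qmul_mult [OF div] qmul_of_int [OF div])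
  finally have *: "gm C i = (\<Sum>j=1..rk C. qmul (1 / of_int (ee C i) * of_int (c j)) (io C i j))" .
  have q: "of_int (hI C i j) / of_int (eI C i j) = coordq (io C i) (rk C) (gm C i) j" for j
    unfolding hI_def eI_def hB_def eB_def by (rule quotient_of_div [OF surjective_pairing, symmetric])
  show ?thesis
    unfolding q coordq_eq [OF div indep *] by (subst *) (auto intro!: sum.cong)
qed

lemma gmul_gm_expand:
  "gmul k (gm C i) = (\<Sum>j=1..rk C. qmul (of_int (k * hI C i j) / of_int (eI C i j)) (io C i j))"
  by (subst gm_expand)
    (simp add: qmul_of_int [OF div, symmetric] qmul_sum_right [OF div] qmul_mult [OF div, symmetric])

lemma qmul_exact: "e dvd k \<Longrightarrow> 0 < e \<Longrightarrow> qmul (of_int k / of_int e) (x :: 'g) = gmul (k div e) x"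
  by (simp add: qmul_eq_iff [OF div] gmul_mult [symmetric])

lemma gmul_epr_expand:
  "gmul (epr (eI C i) (Suc (rk C))) (gm C i)
    = (\<Sum>j=1..rk C. gmul (epr (eI C i) (Suc (rk C)) * hI C i j div eI C i j) (io C i j))"
  unfolding gmul_gm_expand
proof (intro sum.cong refl qmul_exact eI_pos)
  fix j assume "j \<in> {1..rk C}"
  then have "eI C i j dvd epr (eI C i) (Suc (rk C))" by (intro E_dvd_epr [of "eI C i", OF eI_pos]) auto
  then show "eI C i j dvd epr (eI C i) (Suc (rk C)) * hI C i j" by simp
qed

text \<open>Clearing all denominators of \<open>gm C i\<close> puts it into \<open>Gup C i\<close>,
  which gives one divisibility. Conversely \<open>hh C i\<close> has integral coordinates, so every
  reduced denominator divides \<open>ee C i\<close>.\<close>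

lemma ee_eq_epr: "ee C i = epr (eI C i) (Suc (rk C))"
proof (rule zdvd_antisym_nonneg)
  show "0 \<le> ee C i" using ee_pos [OF i] by simp
  show "0 \<le> epr (eI C i) (Suc (rk C))" using epr_pos [of "eI C i", OF eI_pos, of "Suc (rk C)"] by simp
  have "gmul (epr (eI C i) (Suc (rk C))) (gm C i) \<in> zspan (io C i) (rk C)"
    unfolding gmul_epr_expand
    using zspan_base [of _ "rk C" "io C i"]
    by (intro subgroup_sum [OF subgroup_zspan] subgroup_gmul [OF subgroup_zspan])
  then show "ee C i dvd epr (eI C i) (Suc (rk C))"
    using Gup_subset [OF i] Gup_zspan gmul_gm_in_Gprev_iff [OF i] by auto
  show "epr (eI C i) (Suc (rk C)) dvd ee C i"
  proof (rule epr_dvd [of "eI C i", OF eI_pos])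
    fix t assume "t \<in> {1..<Suc (rk C)}"
    then have t: "t \<in> {1..rk C}" by auto
    obtain c where c: "hh C i = (\<Sum>j=1..rk C. gmul (c j) (io C i j))"
      using hh_in_Gup [OF i] Gup_zspan unfolding zspan_def by blast
    then have "(\<Sum>j=1..rk C. qmul (of_int (ee C i * hI C i j) / of_int (eI C i j)) (io C i j))
      = (\<Sum>j=1..rk C. qmul (of_int (c j)) (io C i j))"
      by (simp add: hh_def gmul_gm_expand qmul_of_int [OF div])
    from qindep_unique [OF div indep this t]
    have "(of_int (ee C i * hI C i t) :: rat) = of_int (c t * eI C i t)"
      using eI_pos [of t] by (simp add: field_simps)
    then have "ee C i * hI C i t = c t * eI C i t" by linarith
    then have "eI C i t dvd ee C i * hI C i t" by simp
    then show "eI C i t dvd ee C i"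
      using hI_coprime [of t] by (simp add: coprime_commute coprime_dvd_mult_left_iff)
  qed simp
qed

lemma hh_expand: "hh C i = (\<Sum>j=1..rk C. gmul (ee C i * hI C i j div eI C i j) (io C i j))"
  unfolding hh_def using gmul_epr_expand by (simp add: ee_eq_epr)

lemma coordq_zspan:
  "coordq (io C i) (rk C) (\<Sum>j=1..rk C. gmul (c j) (io C i j)) = (\<lambda>j. if j \<in> {1..rk C} then of_int (c j) else 0)"
  by (rule coordq_eq_int [OF div indep refl])

lemma pipow_zspan:
  "pipow C i (\<Sum>j=1..rk C. gmul (c j) (io C i j)) = (\<Prod>j\<in>{1..rk C}. pii C i j powi c j)"
  unfolding pipow_def coordq_zspan by (intro prod.cong) auto

lemma in_Gup_iff: "\<alpha> \<in> Gup C i \<longleftrightarrow> (\<exists>c. \<alpha> = (\<Sum>j=1..rk C. gmul (c j) (io C i j)))"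
  unfolding Gup_zspan zspan_def by blast

lemma pipow_unit: "pipow C i \<alpha> \<in> unit_quot (mu C i)"
  unfolding pipow_def using ring_val_mu [OF i] pii_unit
  by (intro unit_quot_prod unit_quot_power_int) auto

lemma pipow_nz: "pipow C i \<alpha> \<noteq> 0"
  by (rule unit_quot_nz [OF ring_val_mu [OF i] pipow_unit])

lemma muF_monomial:
  "muF (mu C i) (\<Prod>j\<in>{1..rk C}. pii C i j powi c j) = (\<Sum>j=1..rk C. gmul (c j) (io C i j))"
  using pii_nz muF_pii
  by (subst val_prod [OF ring_val_w [OF i]])
    (auto intro!: sum.cong simp: power_int_eq_0_iff val_power_int [OF ring_val_w [OF i]])

lemma muF_pipow: "\<alpha> \<in> Gup C i \<Longrightarrow> muF (mu C i) (pipow C i \<alpha>) = \<alpha>"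
  unfolding in_Gup_iff using pipow_zspan muF_monomial by auto

lemma pipow_add:
  assumes "\<alpha> \<in> Gup C i" "\<beta> \<in> Gup C i"
  shows "pipow C i (\<alpha> + \<beta>) = pipow C i \<alpha> * pipow C i \<beta>"
proof -
  obtain c d where c: "\<alpha> = (\<Sum>j=1..rk C. gmul (c j) (io C i j))" and d: "\<beta> = (\<Sum>j=1..rk C. gmul (d j) (io C i j))"
    using assms unfolding in_Gup_iff by blast
  have "\<alpha> + \<beta> = (\<Sum>j=1..rk C. gmul (c j + d j) (io C i j))"
    by (simp add: c d gmul_add sum.distrib)
  then have "pipow C i (\<alpha> + \<beta>) = (\<Prod>j\<in>{1..rk C}. pii C i j powi (c j + d j))" by (simp only: pipow_zspan)
  also have "\<dots> = pipow C i \<alpha> * pipow C i \<beta>"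
    unfolding c d pipow_zspan prod.distrib [symmetric]
    by (intro prod.cong refl) (simp add: power_int_add_nz pii_nz)
  finally show ?thesis .
qed

lemma pipow_0: "pipow C i 0 = 1"
  using pipow_zspan [of "\<lambda>_. 0"] by simp

lemma pipow_uminus: "\<alpha> \<in> Gup C i \<Longrightarrow> pipow C i (- \<alpha>) * pipow C i \<alpha> = 1"
  using pipow_add [of "- \<alpha>" \<alpha>] subgroup_uminus [OF subgroup_Gup, of \<alpha> i] pipow_0 by simp

lemma muF_phi: "muF (mu C i) (Fract (phi C i) 1) = gm C i"
  using muF_poly [OF ring_val_mu [OF i] phi_nonzero [OF i]] mu_phi [OF i] by simp

lemma uminus_hh_in_Gup: "- hh C i \<in> Gup C i"
  by (rule subgroup_uminus [OF subgroup_Gup hh_in_Gup [OF i]])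

lemma YY_nz: "YY C i \<noteq> 0"
  unfolding YY_def using Fract_phi_nz pipow_nz by simp

lemma muF_YY: "muF (mu C i) (YY C i) = 0"
proof -
  note w = ring_val_w [OF i]
  have "muF (mu C i) (YY C i) = gmul (int (nat (ee C i))) (gm C i) + - hh C i"
    unfolding YY_def using Fract_phi_nz pipow_nz uminus_hh_in_Gup
    by (simp add: val_mult [OF w] val_power [OF w] muF_phi muF_pipow)
  then show ?thesis using ee_pos [OF i] by (simp add: hh_def)
qed

abbreviation "WW \<equiv> Wel (eI C i) (hI C i) (Fract (phi C i) 1) (pii C i)"
abbreviation "PP \<equiv> Pel (eI C i) (hI C i) (Fract (phi C i) 1) (pii C i)"

text \<open>By \<open>ee_eq_epr\<close> the ramification index is the exponent in the last
  interpolating element, so the identities for \<open>Wel\<close> and \<open>Pel\<close> apply to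
  the chain.\<close>

lemma YY_eq_WW: "YY C i = WW (Suc (rk C))"
proof -
  have "- hh C i = (\<Sum>j=1..rk C. gmul (- (ee C i * hI C i j div eI C i j)) (io C i j))"
    by (simp add: hh_expand gmul_minus sum_negf)
  then have "pipow C i (- hh C i) = (\<Prod>j\<in>{1..rk C}. pii C i j powi (- (ee C i * hI C i j div eI C i j)))"
    by (simp only: pipow_zspan)
  moreover have "{1..<Suc (rk C)} = {1..rk C}" by auto
  moreover have "Fract (phi C i) 1 powi ee C i = Fract (phi C i) 1 ^ nat (ee C i)"
    using ee_pos [OF i] by (simp add: power_int_def)
  ultimately show ?thesis
    unfolding YY_def Wel_def ee_eq_epr [symmetric]
    by simp
qed

lemma pii_Suc: "pii C (Suc i) j = PP j"
  unfolding Pel_def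
  by (simp add: pii.simps Let_def lI_def l'I_def)

lemma monomial_eq:
  "\<exists>c. Fract (phi C i) 1 powi s * (\<Prod>j\<in>{1..rk C}. pii C i j powi m j) =
     (\<Prod>t\<in>{1..rk C}. pii C (Suc i) t powi c t) *
     YY C i powi (Lp C i * s - (\<Sum>j\<in>{1..rk C}. m j * Lj C i j))"
  using monomial_span [where E = "eI C i" and H = "hI C i" and \<phi> = "Fract (phi C i) 1" and p = "pii C i"
      and n = "rk C" and s = s and m = m, OF eI_pos hI_coprime Fract_phi_nz pii_nz]
  unfolding YY_eq_WW pii_Suc Lp_def Lj_def lI_def l'I_def .

lemma io_Suc_eq:
  "io C (Suc i) j = qmul (of_int (dd (eI C i) j) / of_int (eI C i j)) (io C i j) +
     (\<Sum>m\<in>{j<..rk C}. qmul (of_int (lI C i j * epr (eI C i) j * hI C i m) / of_int (eI C i m)) (io C i m))"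
  by (simp add: io.simps Let_def hI_def eI_def lI_def)

text \<open>Substituting the expansion of \<open>gm C i\<close> removes the rational entries: the
  terms before \<open>j\<close> cancel, the tail is kept, and the Bezout identity
  \<open>ell_spec\<close> gives the diagonal entry. What remains mirrors the exponents of
  \<open>pii C (Suc i) j\<close>, whose value can then be read off.\<close>

lemma io_Suc_integral:
  assumes j: "j \<in> {1..rk C}"
  shows "io C (Suc i) j = gmul (lI C i j * epr (eI C i) j) (gm C i) +
     (\<Sum>t\<in>{1..<j}. gmul ((- (lI C i j * epr (eI C i) j * hI C i t)) div eI C i t) (io C i t)) +
     gmul (l'I C i j) (io C i j)"
proof -
  define le where "le = lI C i j * epr (eI C i) j"
  define g where "g = (\<lambda>m. qmul (of_int (le * hI C i m) / of_int (eI C i m)) (io C i m))"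
  have "gmul le (gm C i) = (\<Sum>m=1..rk C. g m)" by (simp add: gmul_gm_expand g_def)
  also have "{1..rk C} = {1..<j} \<union> ({j} \<union> {j<..rk C})" using j by auto
  also have "(\<Sum>m\<in>\<dots>. g m) = (\<Sum>m\<in>{1..<j}. g m) + (g j + (\<Sum>m\<in>{j<..rk C}. g m))"
    by (subst sum.union_disjoint) (auto simp: sum.union_disjoint)
  finally have 1: "gmul le (gm C i) = (\<Sum>m\<in>{1..<j}. g m) + (g j + (\<Sum>m\<in>{j<..rk C}. g m))" .
  have "gmul ((- (le * hI C i t)) div eI C i t) (io C i t) = - g t" if t: "t \<in> {1..<j}" for t
  proof -
    have "eI C i t dvd epr (eI C i) j" using t by (intro E_dvd_epr [of "eI C i", OF eI_pos]) auto
    then have d: "eI C i t dvd le * hI C i t" by (simp add: le_def)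
    then have "(- (le * hI C i t)) div eI C i t = - (le * hI C i t div eI C i t)"
      by (simp add: dvd_neg_div)
    then show ?thesis using d unfolding g_def qmul_exact [OF d eI_pos] by (simp add: gmul_minus)
  qed
  then have 2: "(\<Sum>t\<in>{1..<j}. gmul ((- (le * hI C i t)) div eI C i t) (io C i t)) = - (\<Sum>t\<in>{1..<j}. g t)"
    by (simp add: sum_negf)
  have 3: "g j + gmul (l'I C i j) (io C i j) = qmul (of_int (dd (eI C i) j) / of_int (eI C i j)) (io C i j)"
  proof -
    have "lI C i j * hI C i j * epr (eI C i) j + l'I C i j * eI C i j = dd (eI C i) j"
      unfolding lI_def l'I_def using j by (intro ell_spec [of "eI C i" "hI C i", OF eI_pos hI_coprime]) auto
    then have "of_int (dd (eI C i) j) = (of_int (le * hI C i j + l'I C i j * eI C i j) :: rat)"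
      by (simp add: le_def ac_simps)
    then have "of_int (dd (eI C i) j) / of_int (eI C i j) =
      (of_int (le * hI C i j) / of_int (eI C i j) + of_int (l'I C i j) :: rat)"
      using eI_pos [of j] by (simp add: field_simps)
    then show ?thesis by (simp only: g_def qmul_add [OF div] qmul_of_int [OF div])
  qed
  have 4: "io C (Suc i) j = (g j + gmul (l'I C i j) (io C i j)) + (\<Sum>m\<in>{j<..rk C}. g m)"
    unfolding 3 io_Suc_eq by (simp add: g_def le_def)
  show ?thesis
    unfolding le_def [symmetric] 1 2 4 by (simp add: algebra_simps)
qed

lemma io_Suc_in_Gup: "j \<in> {1..rk C} \<Longrightarrow> io C (Suc i) j \<in> Gup C (Suc i)"
proof -
  assume j: "j \<in> {1..rk C}"
  have io: "io C i t \<in> Gup C (Suc i)" if "t \<in> {1..rk C}" for t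
    using Gup_mono zspan_base [OF that, of "io C i"] Gup_zspan by simp
  show ?thesis
    unfolding io_Suc_integral [OF j] using j io gm_in_Gup
    by (intro subgroup_add [OF subgroup_Gup] subgroup_sum [OF subgroup_Gup] subgroup_gmul [OF subgroup_Gup]) auto
qed

text \<open>The change of basis is lower triangular with non-zero diagonal, so the coefficients
  vanish by forward substitution.\<close>

lemma qindep_Suc: "qindep (io C (Suc i)) (rk C)"
  unfolding qindep_def
proof (intro allI impI)
  fix c assume 0: "(\<Sum>j=1..rk C. qmul (c j) (io C (Suc i) j)) = 0"
  define Q where "Q = (\<lambda>m j. if m = j then of_int (dd (eI C i) j) / of_int (eI C i j)
    else if j < m then of_int (lI C i j * epr (eI C i) j * hI C i m) / of_int (eI C i m) else (0 :: rat))"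
  have Q: "io C (Suc i) j = (\<Sum>m=1..rk C. qmul (Q m j) (io C i m))" if j: "j \<in> {1..rk C}" for j
  proof -
    have split: "{1..rk C} = {1..<j} \<union> ({j} \<union> {j<..rk C})" using j by auto
    have "(\<Sum>m=1..rk C. qmul (Q m j) (io C i m)) = (\<Sum>m\<in>{1..<j}. qmul (Q m j) (io C i m)) +
      (qmul (Q j j) (io C i j) + (\<Sum>m\<in>{j<..rk C}. qmul (Q m j) (io C i m)))"
      unfolding split by (subst sum.union_disjoint) (auto simp: sum.union_disjoint)
    also have "(\<Sum>m\<in>{1..<j}. qmul (Q m j) (io C i m)) = 0"
      by (intro sum.neutral) (auto simp: Q_def qmul_0 [OF div])
    also have "(\<Sum>m\<in>{j<..rk C}. qmul (Q m j) (io C i m)) =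
      (\<Sum>m\<in>{j<..rk C}. qmul (of_int (lI C i j * epr (eI C i) j * hI C i m) / of_int (eI C i m)) (io C i m))"
      by (intro sum.cong) (auto simp: Q_def)
    finally show ?thesis unfolding io_Suc_eq by (simp add: Q_def)
  qed
  have "(\<Sum>j=1..rk C. qmul (c j) (io C (Suc i) j)) = (\<Sum>j=1..rk C. \<Sum>m=1..rk C. qmul (c j * Q m j) (io C i m))"
    by (intro sum.cong refl) (simp only: Q qmul_sum_right [OF div] qmul_mult [OF div])
  also have "\<dots> = (\<Sum>m=1..rk C. qmul (\<Sum>j=1..rk C. c j * Q m j) (io C i m))"
    by (subst sum.swap) (simp only: qmul_sum [OF div])
  finally have "(\<Sum>m=1..rk C. qmul (\<Sum>j=1..rk C. c j * Q m j) (io C i m)) = 0" using 0 by simp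
  then have "\<forall>m\<in>{1..rk C}. (\<Sum>j=1..rk C. c j * Q m j) = 0"
    by (rule indep [unfolded qindep_def, THEN spec, THEN mp])
  then have "c m = 0" if "m \<in> {1..rk C}" for m using that
  proof (induction m rule: less_induct)
    case (less m)
    have "c j * Q m j = (if j = m then c m * Q m m else 0)" if "j \<in> {1..rk C}" for j
      using less.IH [of j] less.prems that by (auto simp: Q_def)
    then have "(\<Sum>j=1..rk C. c j * Q m j) = (\<Sum>j=1..rk C. if j = m then c m * Q m m else 0)"
      by (intro sum.cong) auto
    also have "\<dots> = c m * Q m m" using less.prems by simp
    finally have "c m * Q m m = 0" using less.prems by simp
    moreover have "Q m m \<noteq> 0" using dd_pos [of "eI C i" m] eI_pos by (simp add: Q_def less_imp_neq [symmetric])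
    ultimately show ?case by simp
  qed
  then show "\<forall>j\<in>{1..rk C}. c j = 0" by blast
qed

lemma muF_Suc_phi:
  assumes "i < r"
  shows "muF (mu C (Suc i)) (Fract (phi C i) 1) = gm C i"
  using assms muF_poly [OF ring_val_mu phi_nonzero [OF i]] mu_phi_Suc by simp

lemma muF_Suc_pipow:
  assumes "i < r" "\<alpha> \<in> Gup C i"
  shows "muF (mu C (Suc i)) (pipow C i \<alpha>) = \<alpha>"
  using unit_quot_Suc(2) [OF assms(1) pipow_unit] muF_pipow [OF assms(2)] by simp

lemma muF_Suc_YY:
  assumes "i < r"
  shows "muF (mu C (Suc i)) (YY C i) = 0"
proof -
  have w: "ring_val (muF (mu C (Suc i)))" using assms by (intro ring_val_w) simp
  have "muF (mu C (Suc i)) (YY C i) = gmul (int (nat (ee C i))) (gm C i) + - hh C i"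
    unfolding YY_def using Fract_phi_nz pipow_nz
    by (simp add: val_mult [OF w] val_power [OF w] muF_Suc_phi [OF assms]
        muF_Suc_pipow [OF assms uminus_hh_in_Gup])
  then show ?thesis using ee_pos [OF i] by (simp add: hh_def)
qed

lemma adapted_basis_Suc:
  assumes lt: "i < r"
  shows "adapted_basis (Suc i)"
proof -
  let ?w = "muF (mu C (Suc i))"
  have r: "Suc i \<le> r" using lt by simp
  note val = ring_val_mu [OF r] and w = ring_val_w [OF r]
  have phi: "Fract (phi C i) 1 \<in> unit_quot (mu C (Suc i))" "?w (Fract (phi C i) 1) = gm C i"
    using unit_quot_poly [OF val unit_phi [OF lt]] muF_poly [OF val phi_nonzero [OF i]] mu_phi_Suc [OF lt] by simp_all
  have p: "pii C i t \<in> unit_quot (mu C (Suc i))" "?w (pii C i t) = io C i t" if "t \<in> {1..rk C}" for t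
    using unit_quot_Suc [OF lt pii_unit [OF that]] muF_pii [OF that] by simp_all
  have P: "PP j = Fract (phi C i) 1 powi (lI C i j * epr (eI C i) j) *
     (\<Prod>t\<in>{1..<j}. pii C i t powi ((- (lI C i j * epr (eI C i) j * hI C i t)) div eI C i t)) *
     pii C i j powi l'I C i j" for j
    unfolding Pel_def lI_def l'I_def ..
  have unit: "pii C (Suc i) j \<in> unit_quot (mu C (Suc i))" if "j \<in> {1..rk C}" for j
    unfolding pii_Suc P using that phi p
    by (intro unit_quot_mult [OF val] unit_quot_power_int [OF val] unit_quot_prod [OF val]) auto
  have io: "?w (pii C (Suc i) j) = io C (Suc i) j" if j: "j \<in> {1..rk C}" for j
  proof -
    have nz: "pii C i t \<noteq> 0" if "t \<in> {1..<j} \<or> t = j" for t using that j by (intro pii_nz) auto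
    have "?w (\<Prod>t\<in>{1..<j}. pii C i t powi ((- (lI C i j * epr (eI C i) j * hI C i t)) div eI C i t))
      = (\<Sum>t\<in>{1..<j}. gmul ((- (lI C i j * epr (eI C i) j * hI C i t)) div eI C i t) (io C i t))"
    proof (subst val_prod [OF w])
      show "pii C i t powi ((- (lI C i j * epr (eI C i) j * hI C i t)) div eI C i t) \<noteq> 0"
        if "t \<in> {1..<j}" for t using nz that by (simp add: power_int_eq_0_iff)
      show "(\<Sum>t\<in>{1..<j}. ?w (pii C i t powi ((- (lI C i j * epr (eI C i) j * hI C i t)) div eI C i t)))
        = (\<Sum>t\<in>{1..<j}. gmul ((- (lI C i j * epr (eI C i) j * hI C i t)) div eI C i t) (io C i t))"
        by (intro sum.cong refl, subst val_power_int [OF w])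
          (use nz p j in auto)
    qed
    moreover have "(\<Prod>t\<in>{1..<j}. pii C i t powi ((- (lI C i j * epr (eI C i) j * hI C i t)) div eI C i t)) \<noteq> 0"
      using nz by (auto simp: power_int_eq_0_iff)
    ultimately show ?thesis
      unfolding pii_Suc P io_Suc_integral [OF j]
      using nz [of j] Fract_phi_nz p [OF j] phi
      by (simp add: val_mult [OF w] val_power_int [OF w] power_int_eq_0_iff)
  qed
  note wY = muF_Suc_YY [OF lt] YY_nz
  have "Gup C (Suc i) = zspan (io C (Suc i)) (rk C)"
  proof (intro equalityI subsetI)
    fix x assume "x \<in> zspan (io C (Suc i)) (rk C)"
    then obtain c where x: "x = (\<Sum>j=1..rk C. gmul (c j) (io C (Suc i) j))" unfolding zspan_def by blast
    show "x \<in> Gup C (Suc i)"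
      unfolding x by (intro subgroup_sum [OF subgroup_Gup] subgroup_gmul [OF subgroup_Gup] io_Suc_in_Gup)
  next
    fix x assume "x \<in> Gup C (Suc i)"
    then obtain u s where u: "u \<in> Gup C i" "x = u + gmul s (gm C i)" unfolding Gup_Suc by blast
    then obtain m where m: "u = (\<Sum>j=1..rk C. gmul (m j) (io C i j))" using in_Gup_iff by blast
    \<comment> \<open>Generation follows without inverting the matrix: taking values in the monomial
      identity removes the power of \<open>YY C i\<close> and leaves an integral combination of the
      new basis.\<close>
    obtain c N where c: "Fract (phi C i) 1 powi s * (\<Prod>j\<in>{1..rk C}. pii C i j powi m j) =
      (\<Prod>t\<in>{1..rk C}. pii C (Suc i) t powi c t) * YY C i powi N" using monomial_eq by blast
    have prod_w: "?w (\<Prod>t\<in>{1..rk C}. q t powi c t) = (\<Sum>t=1..rk C. gmul (c t) (?w (q t)))"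
      if "\<And>t. t \<in> {1..rk C} \<Longrightarrow> q t \<in> unit_quot (mu C (Suc i))" for q c
      using unit_quot_nz [OF val that]
      by (subst val_prod [OF w]) (auto intro!: sum.cong simp: power_int_eq_0_iff val_power_int [OF w])
    have nz: "(\<Prod>t\<in>{1..rk C}. q t powi c t) \<noteq> 0"
      if "\<And>t. t \<in> {1..rk C} \<Longrightarrow> q t \<in> unit_quot (mu C (Suc i))" for q c
      using unit_quot_nz [OF val that] by (auto simp: power_int_eq_0_iff)
    have 1: "?w (\<Prod>j\<in>{1..rk C}. pii C i j powi m j) = u"
      unfolding m by (rule trans [OF prod_w [OF p(1)]]) (auto intro!: sum.cong simp: p(2))
    have 2: "?w (\<Prod>t\<in>{1..rk C}. pii C (Suc i) t powi c t) = (\<Sum>t=1..rk C. gmul (c t) (io C (Suc i) t))"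
      by (rule trans [OF prod_w [OF unit]]) (auto intro!: sum.cong simp: io)
    have "?w (Fract (phi C i) 1 powi s * (\<Prod>j\<in>{1..rk C}. pii C i j powi m j)) = x"
      using nz [where q = "pii C i" and c = m, OF p(1)] Fract_phi_nz phi(2) 1 unfolding u(2)
      by (simp add: val_mult [OF w] val_power_int [OF w] power_int_eq_0_iff add.commute)
    moreover have "?w ((\<Prod>t\<in>{1..rk C}. pii C (Suc i) t powi c t) * YY C i powi N) =
      (\<Sum>t=1..rk C. gmul (c t) (io C (Suc i) t))"
      using nz [where q = "pii C (Suc i)" and c = c, OF unit] wY 2
      by (simp add: val_mult [OF w] val_power_int [OF w] power_int_eq_0_iff)
    ultimately show "x \<in> zspan (io C (Suc i)) (rk C)" using c unfolding zspan_def by auto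
  qed
  with qindep_Suc unit io show ?thesis unfolding adapted_basis_def by blast
qed

end

lemma adapted_basis: "i \<le> r \<Longrightarrow> adapted_basis i"
  by (induction i) (auto intro: adapted_basis_0 adapted_basis_Suc)

end

section \<open>Coefficients of residual polynomials\<close>

lemma Fract_sum: "(\<Sum>s\<in>A. Fract (f s) 1) = Fract (\<Sum>s\<in>A. f s) 1" for f :: "'b \<Rightarrow> 'a::idom"
  by (induction A rule: infinite_finite_induct) (simp_all add: Zero_fract_def)

lemma cmul_cls:
  assumes val: "ring_val \<mu>" and p: "vge (muF \<mu>) 0 p" and q: "vge (muF \<mu>) 0 q"
  shows "cmul \<mu> (cls \<mu> p) (cls \<mu> q) = cls \<mu> (p * q)"
proof -
  note w = ring_val_muF [OF val]
  have "vge (muF \<mu>) 0 (p + (crep (cls \<mu> p) - p))"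
    by (intro vge_add [OF w] p vgt_imp_vge crep_cls)
  then have "vge (muF \<mu>) 0 (crep (cls \<mu> p))" by simp
  then show ?thesis
    unfolding cmul_def cls_eq_iff [OF val] by (rule vgt_diff_mult [OF w _ q crep_cls crep_cls])
qed

lemma crep_unit:
  assumes val: "ring_val \<mu>" and "q \<noteq> 0" "muF \<mu> q = 0"
  shows "crep (cls \<mu> q) \<noteq> 0" "muF \<mu> (crep (cls \<mu> q)) = 0"
  using val_add_eq [OF ring_val_muF [OF val], of q "crep (cls \<mu> q) - q"] crep_cls [of \<mu> q] assms by auto

definition const_fract :: "'k::field \<Rightarrow> 'k poly fract" where
  "const_fract c = Fract [:c:] 1"

lemma const_fract_mult: "const_fract (a * b) = const_fract a * const_fract b"
  by (simp add: const_fract_def mult.commute)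

lemma const_fract_1: "const_fract 1 = 1"
  by (simp add: const_fract_def One_fract_def pCons_one)

lemma const_fract_inverse: "const_fract (inverse a) = inverse (const_fract a)"
proof (cases "a = 0")
  case True
  then show ?thesis by (simp add: const_fract_def Zero_fract_def [symmetric])
next
  case False
  then have "const_fract (inverse a) * const_fract a = 1"
    by (simp add: const_fract_mult [symmetric] const_fract_1)
  then show ?thesis by (metis inverse_unique mult.commute)
qed

lemma const_fract_power_int: "const_fract (a powi k) = const_fract a powi k"
proof -
  have "const_fract (a ^ n) = const_fract a ^ n" for a :: 'a and n
    by (induction n) (simp_all add: const_fract_mult const_fract_1)
  then show ?thesis by (simp add: power_int_def const_fract_inverse)
qed

lemma const_fract_prod: "const_fract (\<Prod>i\<in>A. f i) = (\<Prod>i\<in>A. const_fract (f i))"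
  by (induction A rule: infinite_finite_induct) (simp_all add: const_fract_mult const_fract_1)

context maclane
begin

lemma pipow_power:
  assumes "i \<le> r" "\<alpha> \<in> Gup C i"
  shows "pipow C i \<alpha> ^ k = pipow C i (gmul (int k) \<alpha>)"
proof (induction k)
  case 0
  then show ?case using pipow_0 [OF assms(1) adapted_basis [OF assms(1)]] by simp
next
  case (Suc k)
  have "gmul (int (Suc k)) \<alpha> = \<alpha> + gmul (int k) \<alpha>" by (simp add: gmul_add)
  with Suc show ?case
    using pipow_add [OF assms(1) adapted_basis [OF assms(1)] assms(2) subgroup_gmul [OF subgroup_Gup assms(2)]] by simp
qed

lemma pipow_0_const:
  assumes "\<alpha> \<in> G1 C"
  shows "pipow C 0 (- \<alpha>) = Fract [:1 / piK C \<alpha>:] 1"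
proof -
  have "const_fract (piK C \<alpha>) = pipow C 0 \<alpha>"
    by (simp add: piK_def pipow_def const_fract_prod const_fract_power_int pii.simps io.simps const_fract_def [symmetric])
  moreover have "pipow C 0 (- \<alpha>) * pipow C 0 \<alpha> = 1"
    using assms by (intro pipow_uminus [OF _ adapted_basis]) (simp_all add: Gup_0)
  ultimately have "pipow C 0 (- \<alpha>) = const_fract (inverse (piK C \<alpha>))"
    unfolding const_fract_inverse by (metis inverse_unique mult.commute)
  then show ?thesis by (simp add: const_fract_def divide_inverse)
qed

text \<open>This evaluates the left endpoint of a segment: its monomial is the new normalising
  factor times exactly the power of \<open>YY C i\<close> that occurs in \<open>eps\<close>.\<close>

lemma monomial_pipow:
  assumes lt: "i < r" and u: "u \<in> Gup C i"
  shows "Fract (phi C i) 1 ^ s * pipow C i u = pipow C (Suc i) (u + gmul (int s) (gm C i)) *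
    YY C i powi \<lfloor>of_int (Lp C i) * of_nat s - Lmap C i u\<rfloor>"
proof -
  have i: "i \<le> r" "Suc i \<le> r" using lt by auto
  note good = adapted_basis [OF i(1)] and good' = adapted_basis [OF i(2)] and w = ring_val_w [OF i(2)]
  obtain m where m: "u = (\<Sum>j=1..rk C. gmul (m j) (io C i j))" using u in_Gup_iff [OF i(1) good] by blast
  let ?N = "Lp C i * int s - (\<Sum>j\<in>{1..rk C}. m j * Lj C i j)"
  obtain c where c: "Fract (phi C i) 1 powi int s * (\<Prod>j\<in>{1..rk C}. pii C i j powi m j) =
     (\<Prod>t\<in>{1..rk C}. pii C (Suc i) t powi c t) * YY C i powi ?N"
    using monomial_eq [OF i(1) good] by blast
  let ?x = "\<Sum>t=1..rk C. gmul (c t) (io C (Suc i) t)"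
  have c': "Fract (phi C i) 1 ^ s * pipow C i u = pipow C (Suc i) ?x * YY C i powi ?N"
    using c unfolding m pipow_zspan [OF i(1) good] pipow_zspan [OF i(2) good'] by simp
  \<comment> \<open>Comparing values identifies the unspecified monomial in the new
    generators.\<close>
  have "muF (mu C (Suc i)) (Fract (phi C i) 1 ^ s * pipow C i u) = u + gmul (int s) (gm C i)"
    using Fract_phi_nz [OF i(1) good] pipow_nz [OF i(1) good]
    by (simp add: val_mult [OF w] val_power [OF w] muF_Suc_phi [OF i(1) good lt]
        muF_Suc_pipow [OF i(1) good lt u] add.commute)
  moreover have "muF (mu C (Suc i)) (pipow C (Suc i) ?x * YY C i powi ?N) = ?x"
    using YY_nz [OF i(1) good] pipow_nz [OF i(2) good'] in_Gup_iff [OF i(2) good']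
    by (subst val_mult [OF w])
      (auto simp: power_int_eq_0_iff val_power_int [OF w] muF_Suc_YY [OF i(1) good lt] intro!: muF_pipow [OF i(2) good'])
  ultimately have x: "?x = u + gmul (int s) (gm C i)" using c' by simp
  \<comment> \<open>The coordinates of \<open>u\<close> are integers, so the floor rounds
    nothing.\<close>
  have "Lmap C i u = of_int (\<Sum>j\<in>{1..rk C}. m j * Lj C i j)"
    unfolding Lmap_def m coordq_zspan [OF i(1) good] by (simp add: if_distrib cong: if_cong)
  then have "of_int (Lp C i) * of_nat s - Lmap C i u = of_int ?N" by simp
  then have "\<lfloor>of_int (Lp C i) * of_nat s - Lmap C i u\<rfloor> = ?N" by (simp only: floor_of_int)
  then show ?thesis using c' x by simp
qed

text \<open>Membership of \<open>YY C i\<close> in \<open>unit_quot\<close> is available only at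
  stage \<open>Suc i\<close>. So \<open>canon_cls\<close> is applied with the power of
  \<open>phi C i\<close> as polynomial factor, which keeps its value, and with \<open>pipow\<close>
  as the invertible factor.\<close>

lemma zz_eq:
  assumes lt: "i < r"
  shows "zz C i = cls (mu C (Suc i)) (YY C i)"
proof -
  have i: "i \<le> r" "Suc i \<le> r" using lt by auto
  note good = adapted_basis [OF i(1)]
  have Y: "YY C i = Fract (phi C i ^ nat (ee C i)) 1 * pipow C i (- hh C i)"
    by (simp add: YY_def Fract_power)
  have "mu C (Suc i) (phi C i ^ nat (ee C i)) = mu C i (phi C i ^ nat (ee C i))"
    using phi_nonzero [OF i(1)] mu_phi [OF i(1)] mu_phi_Suc [OF lt]
    by (simp add: val_power [OF ring_val_mu] i)
  then show ?thesis
    unfolding zz_def Y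
    using muF_YY [OF i(1) good, unfolded Y] phi_nonzero [OF i(1)]
    by (intro canon_cls [OF ring_val_mu ring_val_mu mu_le] pipow_unit [OF i(1) good]) (use i lt in auto)
qed

text \<open>The normalising factor on the right belongs to \<open>mu C i a\<close>, not to the value
  of \<open>a\<close> at stage \<open>Suc i\<close>. If the latter is larger, both sides are the
  zero class.\<close>

lemma Reval_eps:
  assumes lt: "i < r" and a: "a \<noteq> 0" and \<alpha>: "mu C i a \<in> Gup C (Suc i)"
  shows "cmul (mu C (Suc i)) (eps C i a) (Reval C i a) =
    cls (mu C (Suc i)) (Fract a 1 * pipow C (Suc i) (- mu C i a))"
proof -
  have i: "i \<le> r" "Suc i \<le> r" using lt by auto
  note good = adapted_basis [OF i(1)] and good' = adapted_basis [OF i(2)]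
  note val = ring_val_mu [OF i(1)] and val' = ring_val_mu [OF i(2)] and w = ring_val_w [OF i(2)]
  let ?w = "muF (mu C (Suc i))" and ?F = "Fract (phi C i) 1"
  define e s0 T b u Y D where "e = nat (ee C i)" and "s0 = sI C i a" and "T = {s. onS C i a s}"
    and "b = bco C i a" and "u = uco C i a" and "Y = YY C i" and "D = pipow C (Suc i) (- mu C i a)"
  define N where "N = \<lfloor>of_int (Lp C i) * of_nat s0 - Lmap C i (u s0)\<rfloor>"
  have e: "0 < e" "int e = ee C i" using ee_pos [OF i(1)] by (auto simp: e_def)
  have Y: "Y \<noteq> 0" "?w Y = 0"
    unfolding Y_def by (rule YY_nz [OF i(1) good], rule muF_Suc_YY [OF i(1) good lt])

  have T: "s \<in> T \<longleftrightarrow> s \<le> degree a \<and> b s \<noteq> 0 \<and> u s + gmul (int s) (gm C i) = mu C i a" for s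
    by (simp add: T_def onS_def b_def u_def)
  have finT: "finite T" by (rule finite_subset [of _ "{..degree a}"]) (auto simp: T)
  obtain s where "s \<le> degree a" "expc (phi C i) a s \<noteq> 0"
    "mu C i a = muprev C i (expc (phi C i) a s) + gmul (int s) (gm C i)" using mu_attained [OF i(1) a] .
  then have "s \<in> T" unfolding T by (simp add: b_def u_def bco_def uco_def)
  then have "T \<noteq> {}" by blast
  have s0_Min: "s0 = Min T" by (simp add: s0_def sI_def T_def)
  have s0T: "s0 \<in> T" unfolding s0_Min using finT \<open>T \<noteq> {}\<close> by (rule Min_in)
  have s0_le: "s0 \<le> s" if "s \<in> T" for s unfolding s0_Min using finT that by (rule Min_le)
  have degb: "degree (b s) < degree (phi C i)" for s
    unfolding b_def bco_def by (intro degree_expc degree_phi i)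
  have ub: "u s = muprev C i (b s)" for s by (simp add: u_def b_def uco_def)
  have mub: "mu C i (b s) = u s" "mu C (Suc i) (b s) = u s" if "s \<in> T" for s
    using mu_small [OF i(1) _ degb] unit_Suc(2) [OF lt unit_small [OF i(1) _ degb]] that T ub by auto
  have uG: "u s \<in> Gup C i" if "s \<in> T" for s
    using that T \<alpha> muprev_in_Gprev [OF i(1) _ degb] ub
    by (intro in_Gup_if_shift [OF i(1), of _ "int s"]) auto
  have uG': "- u s \<in> Gup C i" if "s \<in> T" for s
    by (rule subgroup_uminus [OF subgroup_Gup uG [OF that]])
  \<comment> \<open>Points of the segment satisfy
    \<open>gmul (int s - int s0) (gm C i) = u s0 - u s\<close>, an element of
    \<open>Gprev C i\<close>; hence \<open>e\<close> divides the distance of their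
    abscissas.\<close>
  have T_image: "T = (\<lambda>k. s0 + k * e) ` {k. k \<le> dR C i a \<and> s0 + k * e \<in> T}"
  proof (intro equalityI subsetI)
    fix s assume s: "s \<in> T"
    have "gmul (int s - int s0) (gm C i) = u s0 - u s"
      using s s0T T by (simp add: gmul_diff algebra_simps)
    also have "\<dots> \<in> Gprev C i"
      using Gup_subset [OF i(1)] uG s s0T by (intro subgroup_diff [OF subgroup_Gprev [OF i(1)]]) auto
    finally have "int e dvd int s - int s0" unfolding gmul_gm_in_Gprev_iff [OF i(1)] e(2) .
    then have "int e dvd int (s - s0)" using s0_le [OF s] by (simp add: of_nat_diff)
    then have dv: "e dvd s - s0" by (simp only: int_dvd_int_iff)
    have "s \<le> s'I C i a" using s finT by (simp add: s'I_def T_def [symmetric])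
    then have "(s - s0) div e \<le> dR C i a"
      unfolding dR_def e_def [symmetric] s0_def [symmetric] by (intro div_le_mono) simp
    moreover have "s = s0 + (s - s0) div e * e" using dv s0_le [OF s] by simp
    ultimately show "s \<in> (\<lambda>k. s0 + k * e) ` {k. k \<le> dR C i a \<and> s0 + k * e \<in> T}" using s by auto
  qed auto

  \<comment> \<open>Explicit fractions representing the coefficients of the residual polynomial, 0
    where no point lies on the segment.\<close>
  define q where "q = (\<lambda>k. if s0 + k * e \<in> T then Fract (b (s0 + k * e)) 1 * pipow C i (- u (s0 + k * e)) else 0)"
  have q_nonneg: "vge ?w 0 (q k)" for k
  proof (cases "s0 + k * e \<in> T")
    case True
    then have "?w (q k) = 0"
      using T mub(2) [OF True] Fract_nz [of "b (s0 + k * e)"] pipow_nz [OF i(1) good]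
      by (simp add: q_def val_mult [OF w] muF_poly [OF val'] muF_Suc_pipow [OF i(1) good lt uG' [OF True]])
    then show ?thesis by (simp add: vge_def)
  qed (simp add: q_def)
  \<comment> \<open>The coefficients \<open>b s\<close> are small, so they have the same value at
    both stages and \<open>canon_cls\<close> applies.\<close>
  have canon_R: "canon (mu C i) (mu C (Suc i)) (Rco C i a k) = cls (mu C (Suc i)) (q k)" for k
  proof (cases "s0 + k * e \<in> T")
    case True
    let ?s = "s0 + k * e"
    have "Rco C i a k = cls (mu C i) (Fract (b ?s) 1 * pipow C i (- u ?s))"
      using True by (simp add: Rco_def Let_def T_def s0_def e_def b_def u_def)
    moreover have "muF (mu C i) (Fract (b ?s) 1 * pipow C i (- u ?s)) = 0"
      using T True mub(1) [OF True] Fract_nz [of "b ?s"] pipow_nz [OF i(1) good]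
      by (simp add: val_mult [OF ring_val_w [OF i(1)]] muF_poly [OF val] muF_pipow [OF i(1) good uG' [OF True]])
    ultimately show ?thesis
      using T True mub [OF True] canon_cls [OF val val' mu_le [OF lt] _ _ pipow_unit [OF i(1) good]]
      by (simp add: q_def)
  next
    case False
    then have "Rco C i a k = cls (mu C i) 0"
      by (simp add: Rco_def Let_def T_def s0_def e_def)
    with False show ?thesis using canon_zero [OF val val' mu_le [OF lt]] by (simp add: q_def)
  qed
  have zz: "zz C i = cls (mu C (Suc i)) Y" unfolding Y_def by (rule zz_eq [OF lt])
  note crep_Y = crep_unit [OF val' Y]
  have Y_pow: "vge ?w 0 (Y ^ k)" for k
    using Y by (intro vge_power [OF w]) (simp add: vge_def)
  have Reval: "Reval C i a = cls (mu C (Suc i)) (\<Sum>k\<le>dR C i a. q k * Y ^ k)"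
    unfolding Reval_def canon_R zz cls_eq_iff [OF val'] sum_subtractf [symmetric]
  proof (intro vgt_sum [OF w] vgt_diff_mult [OF w] crep_cls Y_pow vgt_diff_power [OF w])
    fix k
    have "vge ?w 0 (q k + (crep (cls (mu C (Suc i)) (q k)) - q k))"
      by (intro vge_add [OF w] q_nonneg vgt_imp_vge crep_cls)
    then show "vge ?w 0 (crep (cls (mu C (Suc i)) (q k)))" by simp
  qed (use Y crep_Y in \<open>simp_all add: vge_def\<close>)
  have eps: "eps C i a = cls (mu C (Suc i)) (Y powi N)"
    unfolding eps_def cpowi_def zz cls_eq_iff [OF val']
    using vgt_diff_power_int [OF w crep_Y(1) Y(1) crep_Y(2) Y(2) crep_cls]
    by (simp add: N_def s0_def u_def uI_def)
  have "cmul (mu C (Suc i)) (eps C i a) (Reval C i a)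
    = cls (mu C (Suc i)) (Y powi N * (\<Sum>k\<le>dR C i a. q k * Y ^ k))"
    unfolding eps Reval
  proof (intro cmul_cls [OF val'] vge_sum [OF w])
    show "vge ?w 0 (Y powi N)" using Y by (simp add: vge_def val_power_int [OF w])
    show "vge ?w 0 (q k * Y ^ k)" for k using vge_mult [OF w q_nonneg Y_pow] by simp
  qed
  also have "Y powi N * (\<Sum>k\<le>dR C i a. q k * Y ^ k) = (\<Sum>s\<in>T. Fract (b s * phi C i ^ s) 1 * D)"
  proof -
    \<comment> \<open>\<open>monomial_pipow\<close> at the left endpoint, multiplied by the inverse
      \<open>D\<close> of the new normalising factor.\<close>
    have YN: "Y powi N = D * (?F ^ s0 * pipow C i (u s0))"
    proof -
      have "?F ^ s0 * pipow C i (u s0) = pipow C (Suc i) (mu C i a) * Y powi N"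
        using monomial_pipow [OF lt uG [OF s0T], of s0] T s0T by (simp add: N_def Y_def)
      then have "D * (?F ^ s0 * pipow C i (u s0)) = (D * pipow C (Suc i) (mu C i a)) * Y powi N"
        by simp
      also have "D * pipow C (Suc i) (mu C i a) = 1"
        unfolding D_def by (rule pipow_uminus [OF i(2) good' \<alpha>])
      finally show ?thesis by simp
    qed
    \<comment> \<open>On the segment \<open>u\<close> drops by \<open>hh C i\<close> from each
      lattice point to the next, so all factors \<open>pipow C i\<close> cancel and only powers of
      \<open>phi C i\<close> remain.\<close>
    have summand: "Y powi N * (q k * Y ^ k) = Fract (b (s0 + k * e) * phi C i ^ (s0 + k * e)) 1 * D"
      if k: "s0 + k * e \<in> T" for k
    proof -
      let ?s = "s0 + k * e"
      have hG: "gmul (int k) (- hh C i) \<in> Gup C i"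
        by (intro subgroup_gmul [OF subgroup_Gup] uminus_hh_in_Gup [OF i(1) good])
      have "u ?s + gmul (int s0 + int k * ee C i) (gm C i) = u s0 + gmul (int s0) (gm C i)"
        using T k s0T e(2) by simp
      then have "u ?s + gmul (int k) (hh C i) = u s0"
        by (simp add: gmul_add gmul_mult hh_def algebra_simps)
      then have "- u ?s + (u s0 + gmul (int k) (- hh C i)) = 0"
        by (simp add: gmul_minus_right diff_eq_eq)
      then have one: "pipow C i (- u ?s) * (pipow C i (u s0) * pipow C i (- hh C i) ^ k) = 1"
        using pipow_add [OF i(1) good uG [OF s0T] hG]
          pipow_add [OF i(1) good uG' [OF k] subgroup_add [OF subgroup_Gup uG [OF s0T] hG]]
          pipow_0 [OF i(1) good] pipow_power [OF i(1) uminus_hh_in_Gup [OF i(1) good]] by simp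
      have Yk: "Y ^ k = ?F ^ (k * e) * pipow C i (- hh C i) ^ k"
        by (simp add: Y_def YY_def e_def power_mult_distrib power_mult [symmetric] mult.commute)
      have "Y powi N * (q k * Y ^ k) = (Fract (b ?s) 1 * (?F ^ s0 * ?F ^ (k * e)) * D) *
        (pipow C i (- u ?s) * (pipow C i (u s0) * pipow C i (- hh C i) ^ k))"
        unfolding YN Yk q_def using k by (simp add: ac_simps)
      also have "\<dots> = Fract (b ?s) 1 * ?F ^ ?s * D" unfolding one by (simp add: power_add)
      finally show ?thesis by (simp add: Fract_power)
    qed
    have "Y powi N * (\<Sum>k\<le>dR C i a. q k * Y ^ k) = (\<Sum>k\<le>dR C i a. Y powi N * (q k * Y ^ k))"
      by (simp add: sum_distrib_left)
    also have "\<dots> = (\<Sum>k\<in>{k. k \<le> dR C i a \<and> s0 + k * e \<in> T}. Y powi N * (q k * Y ^ k))"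
      by (intro sum.mono_neutral_right) (auto simp: q_def)
    also have "\<dots> = (\<Sum>k\<in>{k. k \<le> dR C i a \<and> s0 + k * e \<in> T}. Fract (b (s0 + k * e) * phi C i ^ (s0 + k * e)) 1 * D)"
      by (intro sum.cong) (auto simp: summand)
    also have "\<dots> = (\<Sum>s\<in>(\<lambda>k. s0 + k * e) ` {k. k \<le> dR C i a \<and> s0 + k * e \<in> T}. Fract (b s * phi C i ^ s) 1 * D)"
      using e by (subst sum.reindex) (auto simp: inj_on_def)
    also note T_image [symmetric]
    finally show ?thesis .
  qed
  also have "cls (mu C (Suc i)) (\<Sum>s\<in>T. Fract (b s * phi C i ^ s) 1 * D) = cls (mu C (Suc i)) (Fract a 1 * D)"
  proof -
    let ?t = "\<lambda>s. b s * phi C i ^ s"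
    \<comment> \<open>Terms off the segment lie strictly above \<open>mu C i a\<close>, also at
      stage \<open>Suc i\<close>, and become negligible after multiplication by
      \<open>D\<close>.\<close>
    have "vgt (mu C i) (mu C i a) (?t s)" if "s \<notin> T" "s \<le> degree a" for s
    proof (cases "b s = 0")
      case False
      then have "mu C i a \<le> u s + gmul (int s) (gm C i)"
        using mu_attained_le [OF i(1), of a s] by (simp add: b_def u_def bco_def uco_def)
      moreover have "u s + gmul (int s) (gm C i) \<noteq> mu C i a" using that False T by auto
      moreover have "mu C i (?t s) = u s + gmul (int s) (gm C i)"
        using False phi_nonzero [OF i(1)] mu_small [OF i(1) False degb] ub
        by (simp add: val_mult [OF val] val_power [OF val] mu_phi [OF i(1)])
      ultimately show ?thesis by (auto simp: vgt_def)
    qed simp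
    then have "vgt (mu C i) (mu C i a) (\<Sum>s\<in>{..degree a} - T. ?t s)" by (intro vgt_sum [OF val]) auto
    then have "vgt (mu C (Suc i)) (mu C i a) (\<Sum>s\<in>{..degree a} - T. ?t s)"
      using mu_le [OF lt] by (auto simp: vgt_def intro: order_less_le_trans)
    moreover have "(\<Sum>s\<in>{..degree a} - T. ?t s) = a - (\<Sum>s\<in>T. ?t s)"
    proof -
      have "a = (\<Sum>s\<le>degree a. ?t s)"
        unfolding b_def bco_def by (rule expansion_sum [OF degree_phi [OF i(1)] order_refl])
      moreover have "(\<Sum>s\<in>{..degree a} - T. ?t s) = (\<Sum>s\<le>degree a. ?t s) - (\<Sum>s\<in>T. ?t s)"
        using T by (intro sum_diff) auto
      ultimately show ?thesis by simp
    qed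
    ultimately have "vgt (mu C (Suc i)) (mu C i a) (a - (\<Sum>s\<in>T. ?t s))" by simp
    then have 1: "vgt ?w (mu C i a) (Fract (a - (\<Sum>s\<in>T. ?t s)) 1)"
      by (simp add: vge_Fract [OF val'] val_1 [OF val'])
    have "vge ?w (- mu C i a) D"
      unfolding D_def
      by (simp add: vge_def muF_pipow [OF i(2) good' subgroup_uminus [OF subgroup_Gup \<alpha>]])
    from vgt_mult [OF w 1 this] have "vgt ?w 0 (Fract (a - (\<Sum>s\<in>T. ?t s)) 1 * D)" by simp
    moreover have "Fract (a - (\<Sum>s\<in>T. ?t s)) 1 * D = Fract a 1 * D - (\<Sum>s\<in>T. Fract (?t s) 1 * D)"
      unfolding sum_distrib_right [symmetric] Fract_sum left_diff_distrib [symmetric] by simp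
    ultimately have "cls (mu C (Suc i)) (Fract a 1 * D) = cls (mu C (Suc i)) (\<Sum>s\<in>T. Fract (?t s) 1 * D)"
      unfolding cls_eq_iff [OF val'] by simp
    then show ?thesis by simp
  qed
  finally show ?thesis unfolding D_def .
qed

end

theorem mainTheorem17:
  fixes C :: "('k::field, 'g::linordered_ab_group_add) mlc" and r :: nat and f :: "'k poly"
  assumes "divisible_group TYPE('g)"
    and "maclane_chain C r"
    and "basis_data C r"
    and "f \<noteq> 0"
    and "att C r f"
  shows "\<forall>j\<le>dR C r f. Rco C r f j \<noteq> cls (mu C r) 0 \<longrightarrow>
           (let a = expc (phi C r) f (sI C r f + j * nat (ee C r)) in
             (r = 0 \<longrightarrow> (\<exists>c. c \<noteq> 0 \<and> a = [:c:] \<and> vK C c \<in> G1 C \<and>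
                 Rco C r f j = cls (mu C 0) (Fract [:c / piK C (vK C c):] 1))) \<and>
             (0 < r \<longrightarrow> att C (r - 1) a \<and>
                 Rco C r f j = cmul (mu C r) (eps C (r - 1) a) (Reval C (r - 1) a)))"
proof (intro allI impI)
  interpret maclane C r by (rule maclane.intro [OF assms(1-3)])
  fix j assume "Rco C r f j \<noteq> cls (mu C r) 0"
  define t where "t = sI C r f + j * nat (ee C r)"
  define a where "a = expc (phi C r) f t"
  \<comment> \<open>The default coefficient in \<open>Rco\<close> is the zero class, so a non-zero
    class certifies a point on the segment.\<close>
  have on: "onS C r f t" and R: "Rco C r f j = cls (mu C r) (Fract a 1 * pipow C r (- muprev C r a))"
    using \<open>Rco C r f j \<noteq> cls (mu C r) 0\<close>
    by (auto simp: Rco_def Let_def t_def a_def bco_def uco_def split: if_splits)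
  have a: "a \<noteq> 0" "muprev C r a + gmul (int t) (gm C r) = mu C r f"
    using on by (auto simp: onS_def bco_def uco_def a_def)
  have deg: "degree a < degree (phi C r)"
    unfolding a_def by (intro degree_expc degree_phi) simp
  \<comment> \<open>The hypothesis on \<open>f\<close> places only the shifted ordinate in
    \<open>Gup C (Suc r)\<close>. Membership of the ordinate in \<open>Gup C r\<close> is the
    condition on \<open>vK C c\<close> for \<open>r = 0\<close>, and \<open>att C (r - 1) a\<close>
    for \<open>r > 0\<close>.\<close>
  have G: "muprev C r a \<in> Gup C r"
    using assms(4,5) a muprev_in_Gprev [OF _ a(1) deg]
    by (intro in_Gup_if_shift [of r _ "int t"]) (auto simp: att_def)
  show "let a = expc (phi C r) f (sI C r f + j * nat (ee C r)) in
    (r = 0 \<longrightarrow> (\<exists>c. c \<noteq> 0 \<and> a = [:c:] \<and> vK C c \<in> G1 C \<and>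
       Rco C r f j = cls (mu C 0) (Fract [:c / piK C (vK C c):] 1))) \<and>
    (0 < r \<longrightarrow> att C (r - 1) a \<and> Rco C r f j = cmul (mu C r) (eps C (r - 1) a) (Reval C (r - 1) a))"
    unfolding Let_def t_def [symmetric] a_def [symmetric]
  proof (cases r)
    case 0
    obtain d where "phi C 0 = [:d, 1:]" using chain by (auto simp: maclane_chain_def)
    then have "degree a = 0" using deg 0 by simp
    then obtain c where c: "a = [:c:]" by (metis degree_eq_zeroE)
    have v: "vK C c \<in> G1 C" using G 0 c by (simp add: Gup_0)
    have "Rco C r f j = cls (mu C 0) (Fract [:c / piK C (vK C c):] 1)"
      unfolding R using 0 c pipow_0_const [OF v] by simp
    with c v a 0 show "(r = 0 \<longrightarrow> (\<exists>c. c \<noteq> 0 \<and> a = [:c:] \<and> vK C c \<in> G1 C \<and>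
       Rco C r f j = cls (mu C 0) (Fract [:c / piK C (vK C c):] 1))) \<and>
      (0 < r \<longrightarrow> att C (r - 1) a \<and> Rco C r f j = cmul (mu C r) (eps C (r - 1) a) (Reval C (r - 1) a))"
      by auto
  next
    case (Suc i)
    have "att C i a" using G Suc by (simp add: att_def)
    moreover have "Rco C r f j = cmul (mu C r) (eps C i a) (Reval C i a)"
      unfolding R using Reval_eps [of i a] a G Suc by simp
    ultimately show "(r = 0 \<longrightarrow> (\<exists>c. c \<noteq> 0 \<and> a = [:c:] \<and> vK C c \<in> G1 C \<and>
       Rco C r f j = cls (mu C 0) (Fract [:c / piK C (vK C c):] 1))) \<and>
      (0 < r \<longrightarrow> att C (r - 1) a \<and> Rco C r f j = cmul (mu C r) (eps C (r - 1) a) (Reval C (r - 1) a))"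
      using Suc by simp
  qed
qed

end
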